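(* Let $q$ be a prime power, $f_1=t-1$, $\phi\in\Phi^*$ and $d=|\phi|$. Write $S_m=S_m(\phi)$, $Q_n^*=Q_n^*(f_1)$, and $S_\alpha=S_{\alpha_1}\cdots S_{\alpha_l}$ for an integer sequence $\alpha=(\alpha_1,\dots,\alpha_l)$. For a partition $\lambda=(\lambda_1,\dots,\lambda_l)$ with $l=l(\lambda)$ and a positive integer $k$, $$Q_k^*S_\lambda.1=\sum_{\tau\subset\underline\lambda}\ \Big(\prod_{i=1}^lA(q^d;\tau_i)\Big)(-1)^{|\tau|d}\,S_{\lambda-\tau}\,Q^*_{k-|\tau|d}.1,$$ where the sum is over all compositions $\tau=(\tau_1,\dots,\tau_l)$ with $\tau\subset\underline\lambda$ and $\tau_i>0$ for $1\le i\le l$.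
   Context: $M_n=\mathbb F_{q^n}^\times\subset M=\overline{\mathbb F}_q^\times$; $M_n^*$ is the group of complex characters of $M_n$, with $M_m^*\subset M_n^*$ for $m\mid n$ (via the norm map); $M^*=\bigcup_n M_n^*$. The Frobenius $x\mapsto x^q$ acts on $M$ and $M^*$; $\Phi$ and $\Phi^*$ are the sets of its orbits in $M$ and $M^*$. Elements of $\Phi$ are identified with monic irreducible polynomials $f\ne t$ over $\mathbb F_q$, $|f|=\deg f$; $|\phi|$ is the size of $\phi\in\Phi^*$. $\mathcal F_G=\bigotimes_{\phi\in\Phi^*}\mathbb C[p_n(\phi):n\ge1]$ is the polynomial algebra on independent generators $p_n(\phi)$. For $f\in\Phi$ with root $x$, $$p_n(f)=\frac{(-1)^{n|f|-1}}{q^{n|f|}-1}\sum_{\xi\in M^*_{n|f|}}\overline{\xi(x)}\,p_{n|f|/|\phi_\xi|}(\phi_\xi),$$ where $\phi_\xi$ is the orbit of $\xi$. The $p_n(f)$ ($n\ge1,f\in\Phi$) are also algebraically independent generators of $\mathcal F_G$. In particular $p_n(f_1)=\frac{(-1)^{n-1}}{q^n-1}\sum_{|\phi|\,\mid\, n}|\phi|\,p_{n/|\phi|}(\phi)$. Here $\partial/\partial p_n(\phi)$ is taken with respect to the generators indexed by $\Phi^*$ and $\partial/\partial p_n(f)$ with respect to the generators indexed by $\Phi$; $p_n(\phi),p_n(f)$ act by multiplication. The operators $S_n(\phi)$, $Q_n^*(f_1)\in\mathrm{End}(\mathcal F_G)$, $n\in\mathbb Z$, are defined by $$\sum_{n\in\mathbb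 Z}S_n(\phi)z^n=\exp\Big(\sum_{n\ge1}\tfrac1n p_n(\phi)z^n\Big)\exp\Big(-\sum_{n\ge1}\tfrac{\partial}{\partial p_n(\phi)}z^{-n}\Big),$$ $$\sum_{n\in\mathbb Z}Q_n^*(f_1)z^{-n}=\exp\Big(-\sum_{n\ge1}\tfrac{1-q^{-n}}{n}p_n(f_1)z^n\Big)\exp\Big(\sum_{n\ge1}\tfrac{\partial}{\partial p_n(f_1)}z^{-n}\Big).$$ "$X.1$" denotes the operator $X$ applied to $1\in\mathcal F_G$. For a partition $\lambda=(\lambda_1,\dots,\lambda_l)$, $\underline\lambda=(\lambda_1+l,\lambda_2+l-1,\dots,\lambda_l+1)$. For compositions, $\tau\subset\mu$ means $\tau_i\le\mu_i$ for all $i$, and $|\tau|=\sum_i\tau_i$. Further, $$A(q^{d};i)=\begin{cases} q^{id}(q^{-d}-1), & i>1,\\ -q^{d}, & i=1.\end{cases}$$ *)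

theory Defs
  imports
    "HOL-Algebra.Algebraic_Closure_Type"
    "HOL-Combinatorics.Orbits"
    "HOL-Library.Cardinality"
    "HOL-Library.Poly_Mapping"
    Complex_Main
begin

section \<open>The groups $M_n$, their characters, and $M^*$\<close>

text \<open>
  Throughout, \<^typ>\<open>'a\<close> is the finite field with \<open>q = CARD('a)\<close> elements and
  \<^typ>\<open>'a alg_closure\<close> its algebraic closure.  Inside the latter, the field with \<open>q ^ n\<close> elements
  consists of the solutions of \<open>x ^ (q ^ n) = x\<close>.
\<close>

definition Mgrp :: "nat \<Rightarrow> 'a::finite_field alg_closure set" where
  "Mgrp n = {x. x \<noteq> 0 \<and> x ^ (CARD('a) ^ n) = x}"

text \<open>
  The norm \<open>Mgrp n \<rightarrow> Mgrp m\<close>, for \<open>m dvd n\<close>, as the product of the Galois conjugates over the field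
  with \<open>q ^ m\<close> elements.
\<close>

definition Mnorm :: "nat \<Rightarrow> nat \<Rightarrow> 'a::finite_field alg_closure \<Rightarrow> 'a alg_closure" where
  "Mnorm n m x = (\<Prod>i<n div m. x ^ (CARD('a) ^ (m * i)))"

text \<open>
  Complex characters of \<open>Mgrp n\<close>; they are extended by \<open>0\<close>, so that distinct functions are distinct
  characters.
\<close>

definition Mchars :: "nat \<Rightarrow> ('a::finite_field alg_closure \<Rightarrow> complex) set" where
  "Mchars n = {\<chi>. (\<forall>x\<in>Mgrp n. \<chi> x \<noteq> 0) \<and> (\<forall>x\<in>Mgrp n. \<forall>y\<in>Mgrp n. \<chi> (x * y) = \<chi> x * \<chi> y)
                  \<and> (\<forall>x. x \<notin> Mgrp n \<longrightarrow> \<chi> x = 0)}"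

lemma Mnorm_in_Mgrp:
  fixes x :: "'a::finite_field alg_closure"
  assumes x: "x \<in> Mgrp k" and mk: "m dvd k" and k: "k > 0"
  shows "Mnorm k m x \<in> Mgrp m"
proof -
  let ?q = "CARD('a)"
  let ?r = "k div m"
  define g where "g i = x ^ (?q ^ (m * i))" for i
  have m: "m * ?r = k" using mk by simp
  have r: "?r > 0" using m k by (metis mult_0_right neq0_conv)
  then obtain s where s: "?r = Suc s" using gr0_implies_Suc by blast
  have gr: "g ?r = g 0" using x unfolding g_def m by (simp add: Mgrp_def)
  have "Mnorm k m x ^ (?q ^ m) = (\<Prod>i<?r. g (Suc i))"
    unfolding Mnorm_def g_def
    by (simp add: power_add algebra_simps prod_power_distrib flip: power_mult)
  also have "\<dots> = (\<Prod>i<s. g (Suc i)) * g ?r" by (simp add: s)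
  also have "\<dots> = g 0 * (\<Prod>i<s. g (Suc i))" by (simp add: gr)
  also have "\<dots> = (\<Prod>i<?r. g i)" unfolding s by (rule prod.lessThan_Suc_shift [symmetric])
  finally have "Mnorm k m x ^ (?q ^ m) = Mnorm k m x" by (simp add: Mnorm_def g_def)
  moreover have "Mnorm k m x \<noteq> 0" using x by (simp add: Mnorm_def Mgrp_def)
  ultimately show ?thesis by (simp add: Mgrp_def)
qed

lemma Mnorm_trans:
  fixes x :: "'a::finite_field alg_closure"
  assumes "m dvd k" "k dvd n" "n > 0"
  shows "Mnorm k m (Mnorm n k x) = Mnorm n m x"
proof -
  let ?q = "CARD('a)"
  obtain a where a: "k = m * a" using assms by (elim dvdE)
  obtain b where b: "n = k * b" using assms by (elim dvdE)
  have pos: "m > 0" "k > 0" "a > 0" using assms a b by (auto intro: gr0I)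
  have ka: "k div m = a" and kb: "n div k = b" and nm: "n div m = b * a"
    using pos a b by (auto simp: ac_simps)
  define g where "g i = x ^ (?q ^ (m * i))" for i
  have "Mnorm k m (Mnorm n k x) = (\<Prod>i<a. \<Prod>j<b. g (i + j * a))"
    unfolding Mnorm_def ka kb g_def
    by (simp add: a power_add algebra_simps prod_power_distrib flip: power_mult)
  also have "\<dots> = (\<Prod>j<b. \<Prod>i<a. g (i + j * a))" by (rule prod.swap)
  also have "\<dots> = (\<Prod>j<b. prod g {j * a..<j * a + a})"
  proof (rule prod.cong [OF refl])
    fix j
    show "(\<Prod>i<a. g (i + j * a)) = prod g {j * a..<j * a + a}"
      using prod.shift_bounds_nat_ivl [of g 0 "j * a" a] by (simp add: atLeast0LessThan add.commute)
  qed
  also have "\<dots> = (\<Prod>i<b * a. g i)" by (rule prod.nat_group)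
  finally show ?thesis by (simp add: Mnorm_def nm g_def)
qed

text \<open>
  \<open>M\<^sup>*\<close> is the union of the groups \<open>M\<^sub>n\<^sup>*\<close>, where \<open>M\<^sub>m\<^sup>*\<close> is embedded into \<open>M\<^sub>n\<^sup>*\<close> for \<open>m dvd n\<close> by
  composing with the norm, i.e. the direct limit: a character of \<open>M\<^sub>m\<close> and a character of \<open>M\<^sub>n\<close> are
  identified if they have the same pull-back to some common \<open>M\<^sub>k\<close>.
\<close>

definition Mstar_rel ::
  "nat \<times> ('a::finite_field alg_closure \<Rightarrow> complex) \<Rightarrow> nat \<times> ('a alg_closure \<Rightarrow> complex) \<Rightarrow> bool" where
  "Mstar_rel = (\<lambda>(m, \<chi>) (n, \<psi>). m > 0 \<and> n > 0 \<and> \<chi> \<in> Mchars m \<and> \<psi> \<in> Mchars n \<and>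
     (\<exists>k>0. m dvd k \<and> n dvd k \<and> (\<forall>x\<in>Mgrp k. \<chi> (Mnorm k m x) = \<psi> (Mnorm k n x))))"

lemma part_equivp_Mstar_rel:
  "part_equivp (Mstar_rel :: nat \<times> ('a::finite_field alg_closure \<Rightarrow> complex) \<Rightarrow> _)"
proof (rule part_equivpI)
  have "(\<lambda>x. if x \<in> Mgrp 1 then 1 else 0) \<in> (Mchars 1 :: ('a alg_closure \<Rightarrow> complex) set)"
    by (auto simp: Mchars_def Mgrp_def power_mult_distrib)
  then have "Mstar_rel (1, \<lambda>x::'a alg_closure. if x \<in> Mgrp 1 then 1 else 0)
               (1, \<lambda>x. if x \<in> Mgrp 1 then 1 else 0)"
    by (auto simp: Mstar_rel_def)
  then show "\<exists>x::nat \<times> ('a alg_closure \<Rightarrow> complex). Mstar_rel x x" by blast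
  show "symp (Mstar_rel :: nat \<times> ('a alg_closure \<Rightarrow> complex) \<Rightarrow> _)"
    by (rule sympI) (auto simp: Mstar_rel_def; metis)
  show "transp (Mstar_rel :: nat \<times> ('a alg_closure \<Rightarrow> complex) \<Rightarrow> _)"
  proof (rule transpI)
    fix u v w :: "nat \<times> ('a alg_closure \<Rightarrow> complex)"
    assume 1: "Mstar_rel u v" and 2: "Mstar_rel v w"
    obtain l \<chi> m \<psi> n \<theta> where eq: "u = (l, \<chi>)" "v = (m, \<psi>)" "w = (n, \<theta>)"
      by (cases u, cases v, cases w)
    obtain k where k: "k > 0" "l dvd k" "m dvd k"
      "\<And>x. x \<in> Mgrp k \<Longrightarrow> \<chi> (Mnorm k l x) = \<psi> (Mnorm k m x)"
      using 1 by (auto simp: eq Mstar_rel_def)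
    obtain k' where k': "k' > 0" "m dvd k'" "n dvd k'"
      "\<And>x. x \<in> Mgrp k' \<Longrightarrow> \<psi> (Mnorm k' m x) = \<theta> (Mnorm k' n x)"
      using 2 by (auto simp: eq Mstar_rel_def)
    let ?K = "k * k'"
    have "\<chi> (Mnorm ?K l x) = \<theta> (Mnorm ?K n x)" if x: "x \<in> Mgrp ?K" for x
    proof -
      have "\<chi> (Mnorm ?K l x) = \<chi> (Mnorm k l (Mnorm ?K k x))"
        using k k' by (subst Mnorm_trans) auto
      also have "\<dots> = \<psi> (Mnorm k m (Mnorm ?K k x))"
        by (intro k(4) Mnorm_in_Mgrp x) (use k k' in auto)
      also have "\<dots> = \<psi> (Mnorm k' m (Mnorm ?K k' x))"
        using k k' by (subst (1 2) Mnorm_trans) auto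
      also have "\<dots> = \<theta> (Mnorm k' n (Mnorm ?K k' x))"
        by (intro k'(4) Mnorm_in_Mgrp x) (use k k' in auto)
      also have "\<dots> = \<theta> (Mnorm ?K n x)"
        using k k' by (subst Mnorm_trans) auto
      finally show ?thesis .
    qed
    moreover have "?K > 0" "l dvd ?K" "n dvd ?K" using k k' by auto
    ultimately show "Mstar_rel u w"
      using 1 2 unfolding eq Mstar_rel_def by blast
  qed
qed

quotient_type (overloaded) 'a Mstar =
  "nat \<times> ('a::finite_field alg_closure \<Rightarrow> complex)" / partial: Mstar_rel
  by (rule part_equivp_Mstar_rel)

text \<open>The element of \<open>M\<^sup>*\<close> given by a character \<open>\<chi> \<in> Mchars n\<close>, \<open>n > 0\<close>.\<close>

definition Mstar_of :: "nat \<Rightarrow> ('a::finite_field alg_closure \<Rightarrow> complex) \<Rightarrow> 'a Mstar" where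
  "Mstar_of n \<chi> = abs_Mstar (n, \<chi>)"

text \<open>The Frobenius \<open>\<xi> \<mapsto> \<xi>\<^sup>q\<close> of the (multiplicatively written) group \<open>M\<^sup>*\<close>.\<close>

lift_definition Mstar_frob :: "'a::finite_field Mstar \<Rightarrow> 'a Mstar"
  is "\<lambda>(n, \<chi>). (n, \<lambda>x. \<chi> x ^ CARD('a))"
proof -
  have ch: "(\<lambda>x. \<chi> x ^ CARD('a)) \<in> Mchars n" if "\<chi> \<in> Mchars n"
    for \<chi> :: "'a alg_closure \<Rightarrow> complex" and n
    using that by (auto simp: Mchars_def power_mult_distrib)
  show "Mstar_rel ((\<lambda>(n, \<chi>). (n, \<lambda>x. \<chi> x ^ CARD('a))) u) ((\<lambda>(n, \<chi>). (n, \<lambda>x. \<chi> x ^ CARD('a))) v)"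
    if "Mstar_rel u v" for u v :: "nat \<times> ('a alg_closure \<Rightarrow> complex)"
    using that by (cases u; cases v) (auto simp: Mstar_rel_def ch)
qed


section \<open>The index sets $\Phi^*$ and $\Phi$\<close>

text \<open>
  The Frobenius permutes \<open>M\<^sup>*\<close> with finite orbits, so \<^const>\<open>orbit\<close> (the set of proper iterates) gives
  its orbits.
\<close>

typedef (overloaded) 'a PhiStar = "range (orbit (Mstar_frob :: 'a::finite_field Mstar \<Rightarrow> 'a Mstar))"
  by blast

definition frob_orbit :: "'a::finite_field Mstar \<Rightarrow> 'a PhiStar" where
  "frob_orbit \<xi> = Abs_PhiStar (orbit Mstar_frob \<xi>)"

definition PhiStar_size :: "'a::finite_field PhiStar \<Rightarrow> nat" where
  "PhiStar_size \<phi> = card (Rep_PhiStar \<phi>)"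

lemma irreducible_t_minus_1: "irreducible [:-1, 1 :: 'a::field:]"
  by (rule irreducible_linear_field_poly) simp

typedef (overloaded) 'a Phi =
  "{f :: 'a::finite_field poly. lead_coeff f = 1 \<and> irreducible f \<and> f \<noteq> [:0, 1:]}"
  by (rule exI [of _ "[:-1, 1:]"]) (simp add: irreducible_t_minus_1)

setup_lifting type_definition_Phi

lift_definition f_one :: "'a::finite_field Phi" is "[:-1, 1:]"
  by (simp add: irreducible_t_minus_1)

definition Phi_deg :: "'a::finite_field Phi \<Rightarrow> nat" where
  "Phi_deg f = degree (Rep_Phi f)"

text \<open>
  Some root of \<open>f\<close>; the power sums defined below do not depend on the choice, since all roots of \<open>f\<close>
  are conjugate.
\<close>

definition Phi_root :: "'a::finite_field Phi \<Rightarrow> 'a alg_closure" where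
  "Phi_root f = (SOME x. poly (map_poly to_ac (Rep_Phi f)) x = 0)"


section \<open>Polynomial algebras over the complex numbers\<close>

text \<open>Polynomials in the indeterminates \<open>X\<^sub>i\<close>, where \<open>i\<close> runs through the type \<^typ>\<open>'i\<close>.\<close>

type_synonym 'i cpoly = "('i \<Rightarrow>\<^sub>0 nat) \<Rightarrow>\<^sub>0 complex"

definition const :: "complex \<Rightarrow> 'i cpoly" where
  "const c = Poly_Mapping.single 0 c"

definition indet :: "'i \<Rightarrow> 'i cpoly" where
  "indet i = Poly_Mapping.single (Poly_Mapping.single i 1) 1"

definition pderiv_at :: "'i \<Rightarrow> 'i cpoly \<Rightarrow> 'i cpoly" where
  "pderiv_at i F = (\<Sum>m\<in>Poly_Mapping.keys F.
     Poly_Mapping.single (m - Poly_Mapping.single i 1)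
       (of_nat (Poly_Mapping.lookup m i) * Poly_Mapping.lookup F m))"

definition substitute :: "('i \<Rightarrow> 'j cpoly) \<Rightarrow> 'i cpoly \<Rightarrow> 'j cpoly" where
  "substitute g F = (\<Sum>m\<in>Poly_Mapping.keys F. const (Poly_Mapping.lookup F m) *
     (\<Prod>i\<in>Poly_Mapping.keys m. g i ^ Poly_Mapping.lookup m i))"


section \<open>The algebra $\mathcal F_G$\<close>

text \<open>
  The generators are \<open>p\<^sub>n(\<phi>)\<close> with \<open>n \<ge> 1\<close>; the index \<open>(j, \<phi>)\<close> stands for \<open>p\<^sub>j\<^sub>+\<^sub>1(\<phi>)\<close>, so that there is
  no superfluous generator \<open>p\<^sub>0(\<phi>)\<close>.  All definitions below with an argument \<open>n\<close> of type \<^typ>\<open>nat\<close>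
  are only meant for \<open>n \<ge> 1\<close>.
\<close>

type_synonym 'a FG = "(nat \<times> 'a PhiStar) cpoly"

definition p_star :: "nat \<Rightarrow> 'a::finite_field PhiStar \<Rightarrow> 'a FG" where
  "p_star n \<phi> = indet (n - 1, \<phi>)"

definition d_star :: "nat \<Rightarrow> 'a::finite_field PhiStar \<Rightarrow> 'a FG \<Rightarrow> 'a FG" where
  "d_star n \<phi> = pderiv_at (n - 1, \<phi>)"

definition p_Phi :: "nat \<Rightarrow> 'a::finite_field Phi \<Rightarrow> 'a FG" where
  "p_Phi n f = (let N = n * Phi_deg f in
     const ((-1) ^ (N - 1) / (of_nat CARD('a) ^ N - 1)) *
     (\<Sum>\<xi>\<in>Mchars N. const (cnj (\<xi> (Phi_root f))) *
        (let \<phi> = frob_orbit (Mstar_of N \<xi>) in p_star (N div PhiStar_size \<phi>) \<phi>)))"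

text \<open>
  The \<open>p\<^sub>n(f)\<close> are algebraically independent generators, i.e. \<open>from_Phi\<close> is an isomorphism from the
  abstract polynomial algebra with indeterminates indexed by \<open>n \<ge> 1\<close> and \<open>f \<in> \<Phi>\<close> (with the same index
  shift) onto the algebra \<open>\<F>\<^sub>G\<close>.  The partial derivative with respect to \<open>p\<^sub>n(f)\<close> writes an
  element as a polynomial in these generators and differentiates that polynomial.
\<close>

definition from_Phi :: "(nat \<times> 'a::finite_field Phi) cpoly \<Rightarrow> 'a FG" where
  "from_Phi = substitute (\<lambda>(j, f). p_Phi (Suc j) f)"

definition d_Phi :: "nat \<Rightarrow> 'a::finite_field Phi \<Rightarrow> 'a FG \<Rightarrow> 'a FG" where
  "d_Phi n f F = from_Phi (pderiv_at (n - 1, f) (inv_into UNIV from_Phi F))"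


section \<open>Vertex operators\<close>

text \<open>
  For (commuting) operators \<open>D 1, D 2, \<dots>\<close> let \<open>D(z) = (\<Sum>n\<ge>1. D n z\<^sup>n)\<close>.  Then \<open>op_pow D k j\<close> is
  the coefficient of \<open>z\<^sup>j\<close> in \<open>D(z)\<^sup>k\<close>, and \<open>op_exp D j\<close> the coefficient of \<open>z\<^sup>j\<close> in
  \<open>exp (D(z)) = (\<Sum>k. D(z)\<^sup>k / k!)\<close>, where only the terms with \<open>k \<le> j\<close> contribute.
\<close>

fun op_pow :: "(nat \<Rightarrow> 'i cpoly \<Rightarrow> 'i cpoly) \<Rightarrow> nat \<Rightarrow> nat \<Rightarrow> 'i cpoly \<Rightarrow> 'i cpoly" where
  "op_pow D 0 j F = (if j = 0 then F else 0)"
| "op_pow D (Suc k) j F = (\<Sum>n=1..j. D n (op_pow D k (j - n) F))"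

definition op_exp :: "(nat \<Rightarrow> 'i cpoly \<Rightarrow> 'i cpoly) \<Rightarrow> nat \<Rightarrow> 'i cpoly \<Rightarrow> 'i cpoly" where
  "op_exp D j F = (\<Sum>k\<le>j. const (1 / fact k) * op_pow D k j F)"

text \<open>
  For \<open>A(z) = (\<Sum>i\<ge>0. A i z\<^sup>i)\<close> and \<open>B(z) = (\<Sum>j\<ge>0. B j z\<^sup>-\<^sup>j)\<close>, the coefficient of \<open>z\<^sup>n\<close> in
  \<open>A(z) B(z)\<close>.  When \<open>B\<close> comes from derivations as below, \<open>B j F = 0\<close> for almost all \<open>j\<close>.
\<close>

definition laurent_coeff ::
  "(nat \<Rightarrow> 'i cpoly \<Rightarrow> 'i cpoly) \<Rightarrow> (nat \<Rightarrow> 'i cpoly \<Rightarrow> 'i cpoly) \<Rightarrow> int \<Rightarrow> 'i cpoly \<Rightarrow> 'i cpoly" where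
  "laurent_coeff A B n F =
     Sum_any (\<lambda>j. if n + int j \<ge> 0 then A (nat (n + int j)) (B j F) else 0)"

definition S_op :: "'a::finite_field PhiStar \<Rightarrow> int \<Rightarrow> 'a FG \<Rightarrow> 'a FG" where
  "S_op \<phi> n = laurent_coeff
     (op_exp (\<lambda>m F. const (1 / of_nat m) * p_star m \<phi> * F))
     (op_exp (\<lambda>m F. - d_star m \<phi> F)) n"

text \<open>Note that \<open>Q\<^sub>n\<^sup>*(f\<^sub>1)\<close> is the coefficient of \<open>z\<^sup>-\<^sup>n\<close>.\<close>

definition Qstar_op :: "int \<Rightarrow> 'a::finite_field FG \<Rightarrow> 'a FG" where
  "Qstar_op n = laurent_coeff
     (op_exp (\<lambda>m F. - (const ((1 - 1 / of_nat CARD('a) ^ m) / of_nat m) * p_Phi m f_one * F)))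
     (op_exp (\<lambda>m F. d_Phi m f_one F)) (- n)"

definition S_seq :: "'a::finite_field PhiStar \<Rightarrow> int list \<Rightarrow> 'a FG \<Rightarrow> 'a FG" where
  "S_seq \<phi> \<alpha> = foldr (S_op \<phi>) \<alpha>"


section \<open>Partitions and compositions\<close>

definition is_partition :: "nat list \<Rightarrow> bool" where
  "is_partition la \<longleftrightarrow> sorted_wrt (\<ge>) la \<and> (\<forall>a\<in>set la. a > 0)"

text \<open>\<open>(\<lambda>\<^sub>1 + l, \<lambda>\<^sub>2 + l - 1, \<dots>, \<lambda>\<^sub>l + 1)\<close>\<close>

definition underlined :: "nat list \<Rightarrow> nat list" where
  "underlined la = map (\<lambda>i. la ! i + (length la - i)) [0..<length la]"

definition comps_below :: "nat list \<Rightarrow> nat list set" where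
  "comps_below mu = {tau. list_all2 (\<le>) tau mu \<and> (\<forall>a\<in>set tau. a > 0)}"

text \<open>\<open>A_coeff x i\<close> is \<open>A(x; i)\<close>, defined for \<open>i \<ge> 1\<close>.\<close>

definition A_coeff :: "complex \<Rightarrow> nat \<Rightarrow> complex" where
  "A_coeff x i = (if i = 1 then - x else x ^ i * (1 / x - 1))"

end

theory Submission
  imports Defs "HOL-Number_Theory.Residues"
begin

text \<open>
  Put \<open>d = |\<phi>|\<close> and collect the operators in the series \<open>S(w) = \<Sum> S\<^sub>n w\<^sup>n\<close> and
  \<open>Q(z) = \<Sum> Q\<^sup>*\<^sub>k z\<^sup>-\<^sup>k\<close>.  Each is a creation exponential times an annihilation exponential.
  With \<open>u = (-1)\<^sup>d w z\<^sup>-\<^sup>d\<close>, moving the annihilation exponential of one series past the creation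
  exponential of the other gives
  \<open>Q(z) S(w) = (1 - u) N\<close> and \<open>S(w) Q(z) = (1 - q\<^sup>-\<^sup>d u\<^sup>-\<^sup>1) N\<close> with the same normally ordered
  product \<open>N\<close> (lemma \<open>normal_ordering\<close>).  Formally, therefore,
  \<open>Q(z) S(w) = (1 - u) / (1 - q\<^sup>-\<^sup>d u\<^sup>-\<^sup>1) S(w) Q(z)\<close>, and the expansion of the fraction in powers of \<open>u\<close>
  is \<open>\<Sum>i\<ge>1. A(q\<^sup>d; i) u\<^sup>i\<close>.

  The infinite expansion has to be cut off, and this is where the bounds on \<open>\<tau>\<close> come from.  Let \<open>F\<close>
  be the result of applying \<open>l\<close> of the operators \<open>S\<^sub>n\<close> to \<open>1\<close>, and \<open>G\<close> that of applying \<open>l\<close> of them to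
  \<open>Q\<^sup>*\<^sub>k.1\<close>.  The annihilation exponential of \<open>S(w)\<close> acts on \<open>F\<close> only to order \<open>l\<close> in \<open>w\<^sup>-\<^sup>1\<close>, and on \<open>G\<close> only
  to order \<open>l + 1\<close>; so \<open>S\<^sub>m\<close> kills \<open>F\<close> for \<open>m < -l\<close> and \<open>G\<close> for \<open>m < -(l + 1)\<close>.
  Together these two facts force the remainder of the cut-off expansion to vanish
  (lemma \<open>exchange\<close>), and moving \<open>Q\<^sup>*\<^sub>k\<close> past one \<open>S\<close> after the other gives the theorem
  (theorem \<open>exchange_seq\<close>).

  The two commutation factors depend on the values of \<open>\<partial>/\<partial>p\<^sub>n(f\<^sub>1)\<close> on the generators \<open>p\<^sub>m(\<phi>)\<close> and of
  \<open>\<partial>/\<partial>p\<^sub>m(\<phi>)\<close> on \<open>p\<^sub>n(f\<^sub>1)\<close>, that is, on the change between the two systems of generators.  Here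
  \<open>\<partial>/\<partial>p\<^sub>n(f\<^sub>1) = (-1)\<^sup>n\<^sup>-\<^sup>1 \<Sum> \<partial>/\<partial>p\<^sub>n\<^sub>/\<^sub>|\<^sub>\<psi>\<^sub>|(\<psi>)\<close>, summed over the \<open>\<psi>\<close> with \<open>|\<psi>|\<close> dividing \<open>n\<close> (theorem
  \<open>d_Phi_f_one\<close>): by orthogonality of the characters of \<open>M\<^sub>n\<close> the right-hand side has the correct values
  on all \<open>p\<^sub>m(f)\<close>, and by the dual orthogonality relation these elements generate the algebra, so a
  derivation with these values is unique.  Orthogonality rests on \<open>M\<^sub>n\<close> being cyclic of order
  \<open>q\<^sup>n - 1\<close>; the passage from points of \<open>M\<^sub>n\<close> to polynomials and from characters to their Frobenius orbits
  rests on two facts: every point of \<open>M\<^sub>n\<close> is conjugate to the chosen root of some \<open>f\<close> whose degree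
  divides \<open>n\<close> (lemma \<open>Phi_conjugate\<close>), and every \<open>\<phi>\<close> whose size divides \<open>n\<close> consists of exactly
  \<open>|\<phi>|\<close> characters of \<open>M\<^sub>n\<close> (lemma \<open>card_PhiStar_fibre\<close>).
\<close>

section \<open>The groups $M_n$\<close>

lemma to_ac_poly_mult: "map_poly to_ac (p * q :: 'a::field poly) = map_poly to_ac p * map_poly to_ac q"
  by (rule poly_eqI) (simp add: coeff_map_poly coeff_mult to_ac_sum)

lemma card_gt_1: "CARD('a::finite_field) > 1"
  using card_mono[of "UNIV :: 'a set" "{0,1}"] by simp

lemma card_power_gt_1:
  assumes "n > 0"
  shows "CARD('a::finite_field) ^ n > 1"
  using card_gt_1[where 'a='a] assms by (rule one_less_power)

text \<open>
  All \<open>q\<close> elements of the field are roots of the difference of the two sides, whose degree is less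
  than \<open>q\<close> because the leading terms cancel.
\<close>

lemma poly_add_1_power_card:
  "([:1, 1:] :: 'a::finite_field poly) ^ CARD('a) = Polynomial.monom 1 CARD('a) + 1"
proof (rule ccontr)
  let ?q = "CARD('a)"
  define p where "p = ([:1, 1:] :: 'a poly) ^ ?q - (Polynomial.monom 1 ?q + 1)"
  assume "\<not> ?thesis"
  then have p0: "p \<noteq> 0" by (simp add: p_def)
  have q1: "?q > 1" by (rule card_gt_1)
  have c: "Polynomial.coeff ([:1, 1:] ^ ?q :: 'a poly) ?q = 1"
    using lead_coeff_power[of "[:1,1:] :: 'a poly" ?q] by (simp add: degree_power_eq)
  have "Polynomial.degree p \<le> ?q"
    unfolding p_def using q1
    by (intro degree_diff_le degree_add_le) (auto simp: degree_power_eq degree_monom_le)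
  moreover have "Polynomial.coeff p ?q = 0" using q1 c by (simp add: p_def)
  ultimately have "Polynomial.degree p < ?q"
    using p0 by (metis le_neq_implies_less leading_coeff_0_iff)
  moreover have "{x. poly p x = 0} = (UNIV :: 'a set)"
    by (auto simp: p_def poly_monom finite_field_power_card_eq_same)
  then have "?q \<le> Polynomial.degree p"
    using card_poly_roots_bound[OF p0] by simp
  ultimately show False by simp
qed

text \<open>
  The polynomial identity may be evaluated at points of the algebraic closure; homogenising it gives
  additivity of the Frobenius without writing \<open>q\<close> as a power of the characteristic.
\<close>

lemma frobenius_add:
  fixes x y :: "'a::finite_field alg_closure"
  shows "(x + y) ^ CARD('a) = x ^ CARD('a) + y ^ CARD('a)"
proof (cases "y = 0")
  case False
  have pw: "map_poly to_ac (p ^ n) = map_poly to_ac p ^ n" for p :: "'a poly" and n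
    by (induction n) (simp_all add: to_ac_poly_mult)
  have "map_poly to_ac ([:1, 1:] ^ CARD('a) :: 'a poly) = map_poly to_ac (Polynomial.monom 1 CARD('a) + 1)"
    by (simp add: poly_add_1_power_card)
  also have "\<dots> = Polynomial.monom 1 CARD('a) + 1"
    by (rule poly_eqI) (simp add: coeff_map_poly)
  finally have "[:1, 1::'a alg_closure:] ^ CARD('a) = Polynomial.monom 1 CARD('a) + 1"
    by (simp add: pw map_poly_pCons)
  then have "poly ([:1, 1:] ^ CARD('a)) (x / y) = poly (Polynomial.monom 1 CARD('a) + 1) (x / y)" by simp
  then have "(1 + x / y) ^ CARD('a) = (x / y) ^ CARD('a) + 1" by (simp add: poly_monom)
  then have "y ^ CARD('a) * (1 + x / y) ^ CARD('a) = x ^ CARD('a) + y ^ CARD('a)"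
    using False by (simp add: power_divide field_simps)
  moreover have "y * (1 + x / y) = x + y" using False by (simp add: field_simps)
  ultimately show ?thesis by (simp flip: power_mult_distrib)
qed (simp add: power_0_left)

lemma frobenius_power_add:
  fixes x y :: "'a::finite_field alg_closure"
  shows "(x + y) ^ (CARD('a) ^ n) = x ^ (CARD('a) ^ n) + y ^ (CARD('a) ^ n)"
  by (induction n) (simp_all add: power_mult frobenius_add mult.commute[of "CARD('a)"])

lemma frobenius_inj:
  fixes x y :: "'a::finite_field alg_closure"
  assumes "x ^ (CARD('a) ^ n) = y ^ (CARD('a) ^ n)"
  shows "x = y"
proof -
  have "(x - y + y) ^ (CARD('a) ^ n) = (x - y) ^ (CARD('a) ^ n) + y ^ (CARD('a) ^ n)"
    by (rule frobenius_power_add)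
  with assms have "(x - y) ^ (CARD('a) ^ n) = 0" by simp
  then show ?thesis by simp
qed

lemma Mgrp_iff: "x \<in> Mgrp n \<longleftrightarrow> x ^ (CARD('a) ^ n - 1) = 1" if "n > 0"
  for x :: "'a::finite_field alg_closure"
proof -
  have "CARD('a) ^ n = Suc (CARD('a) ^ n - 1)" by simp
  moreover have "CARD('a) ^ n - 1 > 0" using card_power_gt_1 [where 'a='a, OF that] by simp
  ultimately show ?thesis unfolding Mgrp_def
    by (metis (mono_tags, lifting) mem_Collect_eq mult_cancel_left mult.right_neutral power_Suc zero_power zero_neq_one)
qed

lemma of_nat_card_eq_0: "of_nat CARD('a) = (0 :: 'a::finite_field alg_closure)"
  by (metis CHAR_dvd_CARD CHAR_alg_closure of_nat_eq_0_iff_char_dvd)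

text \<open>
  The elements of \<open>Mgrp n\<close> are the roots of \<open>t\<^sup>N - 1\<close> with \<open>N = q\<^sup>n - 1\<close>.  As \<open>N = -1\<close> in the field, the
  derivative is \<open>- t\<^sup>N\<^sup>-\<^sup>1\<close>, which vanishes only at \<open>0\<close>, so that no root is multiple.
\<close>

lemma card_Mgrp:
  assumes "n > 0"
  shows "finite (Mgrp n :: 'a::finite_field alg_closure set)"
    and "card (Mgrp n :: 'a::finite_field alg_closure set) = CARD('a) ^ n - 1"
proof -
  let ?N = "CARD('a) ^ n - 1"
  have N0: "?N > 0" using card_power_gt_1 [where 'a='a, OF assms] by simp
  define p where "p = (Polynomial.monom 1 ?N - 1 :: 'a alg_closure poly)"
  have roots: "poly p x = 0 \<longleftrightarrow> x \<in> Mgrp n" for x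
    by (simp add: p_def poly_monom Mgrp_iff assms)
  have p0: "p \<noteq> 0"
  proof
    assume "p = 0"
    then have "poly p 0 = 0" by simp
    then show False using N0 by (simp add: p_def poly_monom power_0_left)
  qed
  have degp: "Polynomial.degree p = ?N"
    unfolding p_def using N0 degree_add_eq_left[of "-1" "Polynomial.monom (1::'a alg_closure) ?N"]
    by (simp add: degree_monom_eq)
  show fin: "finite (Mgrp n :: 'a alg_closure set)"
    using poly_roots_finite[OF p0] by (simp add: roots)
  have "of_nat ?N = (of_nat (CARD('a) ^ n) - 1 :: 'a alg_closure)"
    by (simp add: of_nat_diff)
  then have ofN: "of_nat ?N = (-1 :: 'a alg_closure)"
    using assms by (simp add: of_nat_card_eq_0)
  have simple: "\<not> [:-a, 1:] ^ 2 dvd p" for a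
  proof
    assume "[:-a, 1:] ^ 2 dvd p"
    then obtain r where r: "p = [:-a, 1:] * ([:-a, 1:] * r)"
      by (metis dvdE mult.assoc power2_eq_square)
    have 1: "poly p a = 0" by (simp add: r)
    have "poly (pderiv p) a = 0" unfolding r pderiv_mult poly_add poly_mult by simp
    moreover have "poly (pderiv p) a = of_nat ?N * a ^ (?N - 1)"
      unfolding p_def by (simp add: pderiv_monom pderiv_diff poly_monom)
    ultimately have "(-1) * a ^ (?N - 1) = 0" unfolding ofN by simp
    then have "a = 0" by simp
    with 1 show False using N0 by (simp add: p_def poly_monom power_0_left)
  qed
  obtain A where A: "size A = Polynomial.degree p"
      "p = smult (Polynomial.lead_coeff p) (\<Prod>x\<in>#A. [:-x, 1:])"
    using alg_closed_imp_factorization[OF p0] by blast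
  have "count A a \<le> 1" for a
  proof (rule ccontr)
    assume "\<not> count A a \<le> 1"
    then have "replicate_mset 2 a \<subseteq># A" by (simp add: subseteq_mset_def)
    then obtain B where "A = replicate_mset 2 a + B" by (metis subset_mset.le_iff_add)
    then have "[:-a, 1:] ^ 2 dvd (\<Prod>x\<in>#A. [:-x, 1:])" by simp
    then have "[:-a, 1:] ^ 2 dvd p" by (metis A(2) dvd_smult)
    with simple show False by blast
  qed
  then have "A = mset_set (set_mset A)"
    by (intro multiset_eqI) (metis count_mset_set(1,3) finite_set_mset le_antisym less_one not_in_iff count_greater_eq_one_iff)
  then have "card (set_mset A) = ?N" by (metis A(1) degp size_mset_set)
  moreover have "set_mset A = {x. poly p x = 0}"
    by (subst A(2)) (use p0 in \<open>auto simp: poly_prod_mset\<close>)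
  ultimately have "card {x. poly p x = 0} = Polynomial.degree p" by (simp add: degp)
  then show "card (Mgrp n :: 'a alg_closure set) = CARD('a) ^ n - 1"
    by (simp add: roots degp)
qed

text \<open>
  Every element is a nonnegative power of \<open>g\<close>; for the finite group \<open>Mgrp n\<close> this is generation.
\<close>

definition Mgen :: "nat \<Rightarrow> 'a::finite_field alg_closure \<Rightarrow> bool" where
  "Mgen n g \<longleftrightarrow> g \<in> Mgrp n \<and> (\<forall>x\<in>Mgrp n. \<exists>i. x = g ^ i)"

text \<open>
  Together with \<open>0\<close>, the group \<open>Mgrp n\<close> is a finite field, because it is the set of points fixed by a power
  of the Frobenius; and the multiplicative group of a finite field is cyclic.
\<close>

lemma Mgen_exists:
  assumes "n > 0"
  shows "\<exists>g :: 'a::finite_field alg_closure. Mgen n g"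
proof -
  define K :: "'a alg_closure ring" where
    "K = \<lparr>carrier = insert 0 (Mgrp n), monoid.mult = (*), one = 1, ring.zero = 0, add = (+)\<rparr>"
  have q: "CARD('a) ^ n > 1" using assms by (rule card_power_gt_1)
  have car: "x \<in> carrier K \<longleftrightarrow> x ^ (CARD('a) ^ n) = x" for x
    using q by (auto simp: K_def Mgrp_def)
  have add: "x + y \<in> carrier K" if "x \<in> carrier K" "y \<in> carrier K" for x y
    using that by (simp add: car frobenius_power_add)
  have uminus: "- x \<in> carrier K" if "x \<in> carrier K" for x
  proof -
    have "(- x + x) ^ (CARD('a) ^ n) = (- x) ^ (CARD('a) ^ n) + x ^ (CARD('a) ^ n)"
      by (rule frobenius_power_add)
    then show ?thesis using that q by (simp add: car power_0_left add_eq_0_iff2)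
  qed
  have mult: "x * y \<in> carrier K" if "x \<in> carrier K" "y \<in> carrier K" for x y
    using that by (simp add: car power_mult_distrib)
  have inv: "inverse x \<in> carrier K" if "x \<in> carrier K" for x
    using that by (simp add: car power_inverse)
  have zo: "0 \<in> carrier K" "1 \<in> carrier K" using q by (simp_all add: car)
  have ops [simp]: "x \<oplus>\<^bsub>K\<^esub> y = x + y" "x \<otimes>\<^bsub>K\<^esub> y = x * y" "\<zero>\<^bsub>K\<^esub> = 0" "\<one>\<^bsub>K\<^esub> = 1" for x y
    by (simp_all add: K_def)
  have cr: "cring K"
  proof (rule cringI)
    show "abelian_group K"
    proof (rule abelian_groupI)
      show "\<exists>y\<in>carrier K. y \<oplus>\<^bsub>K\<^esub> x = \<zero>\<^bsub>K\<^esub>" if "x \<in> carrier K" for x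
        by (rule bexI[OF _ uminus[OF that]]) simp
    qed (simp_all only: ops add zo add_0_left add_0_right ac_simps)
    show "Group.comm_monoid K"
      by (rule comm_monoidI) (simp_all only: ops mult zo mult_1_left mult_1_right ac_simps)
  qed (simp only: ops distrib_right)
  interpret K: field K
  proof (rule cring.cring_fieldI2[OF cr])
    show "\<zero>\<^bsub>K\<^esub> \<noteq> \<one>\<^bsub>K\<^esub>" by simp
    show "\<exists>b\<in>carrier K. a \<otimes>\<^bsub>K\<^esub> b = \<one>\<^bsub>K\<^esub>" if "a \<in> carrier K" "a \<noteq> \<zero>\<^bsub>K\<^esub>" for a
      using that by (intro bexI[of _ "inverse a"]) (auto simp: inv)
  qed
  have pw: "x [^]\<^bsub>K\<^esub> (i::nat) = x ^ i" for x i
    by (induction i) (simp_all add: nat_pow_def mult.commute)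
  have fin: "finite (carrier K)" using card_Mgrp(1)[OF assms, where 'a='a] by (simp add: K_def)
  have "carrier (Multiplicative_Group.mult_of K) = Mgrp n" by (auto simp: K_def Mgrp_def)
  note gen = K.finite_field_mult_group_has_gen[OF fin, unfolded this pw]
  then show ?thesis
  proof (elim bexE)
    fix a :: "'a alg_closure" assume "a \<in> Mgrp n" and eq: "Mgrp n = {a ^ i |i::nat. i \<in> UNIV}"
    then have "\<exists>i. x = a ^ i" if "x \<in> Mgrp n" for x using that by (subst (asm) eq) simp
    with \<open>a \<in> Mgrp n\<close> show ?thesis unfolding Mgen_def by blast
  qed
qed

lemma Mgrp_mult: "x \<in> Mgrp n \<Longrightarrow> y \<in> Mgrp n \<Longrightarrow> x * y \<in> Mgrp n"
  by (simp add: Mgrp_def power_mult_distrib)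

lemma Mgrp_one: "1 \<in> Mgrp n"
  by (simp add: Mgrp_def)

lemma Mgrp_power: "x \<in> Mgrp n \<Longrightarrow> x ^ i \<in> Mgrp n"
  by (induction i) (simp_all add: Mgrp_mult Mgrp_one)

lemma power_mod_exponent:
  fixes g :: "'b::monoid_mult"
  assumes "g ^ N = 1"
  shows "g ^ i = g ^ (i mod N)"
proof -
  have "g ^ i = g ^ (N * (i div N) + i mod N)" by simp
  also have "\<dots> = g ^ (i mod N)" using assms by (simp only: power_add power_mult) simp
  finally show ?thesis .
qed

lemma Mgen_powers_bij_betw:
  fixes g :: "'a::finite_field alg_closure"
  assumes "Mgen n g" "n > 0"
  shows "bij_betw (\<lambda>i. g ^ i) {..<CARD('a) ^ n - 1} (Mgrp n)"
proof -
  let ?N = "CARD('a) ^ n - 1"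
  have N: "?N > 0" using card_power_gt_1 [where 'a='a, OF assms(2)] by simp
  have gN: "g ^ ?N = 1" using assms by (simp add: Mgen_def Mgrp_iff)
  have red: "g ^ i = g ^ (i mod ?N)" for i by (rule power_mod_exponent[OF gN])
  have img: "(\<lambda>i. g ^ i) ` {..<?N} = Mgrp n"
  proof (intro equalityI subsetI)
    fix x :: "'a alg_closure" assume "x \<in> Mgrp n"
    then obtain i where "x = g ^ i" using assms by (auto simp: Mgen_def)
    then have "x = g ^ (i mod ?N)" using red by simp
    then show "x \<in> (\<lambda>i. g ^ i) ` {..<?N}" using N by (intro image_eqI[of _ _ "i mod ?N"]) auto
  qed (use assms in \<open>auto simp: Mgen_def Mgrp_power\<close>)
  then have "inj_on (\<lambda>i. g ^ i) {..<?N}"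
    by (intro eq_card_imp_inj_on) (use card_Mgrp(2)[OF assms(2), where 'a='a] in auto)
  with img show ?thesis by (simp add: bij_betw_def)
qed

lemma Mgen_power_eq_iff:
  fixes g :: "'a::finite_field alg_closure"
  assumes "Mgen n g" "n > 0"
  shows "g ^ i = g ^ j \<longleftrightarrow> i mod (CARD('a) ^ n - 1) = j mod (CARD('a) ^ n - 1)"
proof -
  let ?N = "CARD('a) ^ n - 1"
  have N: "?N > 0" using card_power_gt_1 [where 'a='a, OF assms(2)] by simp
  have gN: "g ^ ?N = 1" using assms by (simp add: Mgen_def Mgrp_iff)
  have red: "g ^ i = g ^ (i mod ?N)" for i by (rule power_mod_exponent[OF gN])
  have "g ^ i = g ^ j \<longleftrightarrow> g ^ (i mod ?N) = g ^ (j mod ?N)" using red[of i] red[of j] by simp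
  also have "\<dots> \<longleftrightarrow> i mod ?N = j mod ?N"
    using Mgen_powers_bij_betw[OF assms] N by (auto simp: bij_betw_def inj_on_def)
  finally show ?thesis .
qed

section \<open>Characters of $M_n$ and their orthogonality\<close>

lemma Mchars_mult: "\<xi> \<in> Mchars n \<Longrightarrow> x \<in> Mgrp n \<Longrightarrow> y \<in> Mgrp n \<Longrightarrow> \<xi> (x * y) = \<xi> x * \<xi> y"
  by (simp add: Mchars_def)

lemma Mchars_one: "\<xi> \<in> Mchars n \<Longrightarrow> \<xi> 1 = 1"
proof -
  assume "\<xi> \<in> Mchars n"
  then have "\<xi> (1 * 1) = \<xi> 1 * \<xi> 1" "\<xi> 1 \<noteq> 0" by (simp_all only: Mchars_mult Mgrp_one) (auto simp: Mchars_def Mgrp_one)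
  then show ?thesis by simp
qed

lemma Mchars_power: "\<xi> \<in> Mchars n \<Longrightarrow> x \<in> Mgrp n \<Longrightarrow> \<xi> (x ^ i) = \<xi> x ^ i"
  by (induction i) (simp_all add: Mchars_one Mchars_mult Mgrp_power)

lemma Mchars_root_of_unity:
  fixes \<xi> :: "'a::finite_field alg_closure \<Rightarrow> complex"
  assumes "\<xi> \<in> Mchars n" "x \<in> Mgrp n" "n > 0"
  shows "\<xi> x ^ (CARD('a) ^ n - 1) = 1"
  using assms Mchars_power[OF assms(1,2), of "CARD('a) ^ n - 1"] by (simp add: Mgrp_iff Mchars_one)

lemma Mchars_eqI:
  assumes "\<xi> \<in> Mchars n" "\<xi>' \<in> Mchars n" "Mgen n g" "\<xi> g = \<xi>' g"
  shows "\<xi> = \<xi>'"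
proof
  fix x
  show "\<xi> x = \<xi>' x"
  proof (cases "x \<in> Mgrp n")
    case True
    then obtain i where "x = g ^ i" "g \<in> Mgrp n" using assms(3) by (auto simp: Mgen_def)
    then show ?thesis using assms by (simp add: Mchars_power)
  qed (use assms in \<open>simp add: Mchars_def\<close>)
qed

text \<open>
  A generator may be sent to an arbitrary root of unity of the right order; this is well defined
  because exponents of a generator are determined modulo the group order.
\<close>

lemma Mchars_exists:
  fixes g :: "'a::finite_field alg_closure" and \<zeta> :: complex
  assumes g: "Mgen n g" and n: "n > 0" and z: "\<zeta> ^ (CARD('a) ^ n - 1) = 1"
  shows "\<exists>\<xi>\<in>Mchars n. \<xi> g = \<zeta>"
proof -
  let ?N = "CARD('a) ^ n - 1"
  have N: "?N > 0" using card_power_gt_1 [where 'a='a, OF n] by simp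
  have red: "\<zeta> ^ i = \<zeta> ^ (i mod ?N)" for i by (rule power_mod_exponent[OF z])
  define \<xi> where "\<xi> x = (if x \<in> Mgrp n then \<zeta> ^ (SOME i. x = g ^ i) else 0)" for x
  have xi: "\<xi> (g ^ i) = \<zeta> ^ i" for i
  proof -
    have "g ^ i = g ^ (SOME j. g ^ i = g ^ j)" by (rule someI[of _ i]) simp
    then have "i mod ?N = (SOME j. g ^ i = g ^ j) mod ?N" by (simp only: Mgen_power_eq_iff[OF g n])
    then have "\<zeta> ^ (SOME j. g ^ i = g ^ j) = \<zeta> ^ i" using red by metis
    moreover have "g ^ i \<in> Mgrp n" using g by (simp add: Mgen_def Mgrp_power)
    ultimately show ?thesis by (simp add: \<xi>_def)
  qed
  have z0: "\<zeta> \<noteq> 0" using z N by (auto simp: power_0_left)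
  have "\<xi> \<in> Mchars n"
    unfolding Mchars_def
  proof (intro CollectI conjI ballI allI impI)
    fix x y :: "'a alg_closure" assume "x \<in> Mgrp n" "y \<in> Mgrp n"
    then obtain i j where "x = g ^ i" "y = g ^ j" using g unfolding Mgen_def by metis
    then show "\<xi> (x * y) = \<xi> x * \<xi> y" by (simp add: xi flip: power_add)
  qed (use z0 in \<open>auto simp: \<xi>_def\<close>)
  moreover have "\<xi> g = \<zeta>" using xi[of 1] by simp
  ultimately show ?thesis by blast
qed

lemma card_Mchars:
  assumes "n > 0"
  shows "finite (Mchars n :: ('a::finite_field alg_closure \<Rightarrow> complex) set)"
    and "card (Mchars n :: ('a alg_closure \<Rightarrow> complex) set) = CARD('a) ^ n - 1"
proof -
  let ?N = "CARD('a) ^ n - 1"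
  have N: "?N > 0" using card_power_gt_1 [where 'a='a, OF assms] by simp
  obtain g :: "'a alg_closure" where g: "Mgen n g" using Mgen_exists[OF assms] by blast
  have "inj_on (\<lambda>\<xi>. \<xi> g) (Mchars n)" by (intro inj_onI) (use Mchars_eqI[OF _ _ g] in blast)
  moreover have "(\<lambda>\<xi>. \<xi> g) ` Mchars n = {z. z ^ ?N = 1}"
  proof (intro equalityI subsetI)
    fix z assume "z \<in> (\<lambda>\<xi>. \<xi> g) ` Mchars n"
    then show "z \<in> {z. z ^ ?N = 1}" using Mchars_root_of_unity[OF _ _ assms, of _ g] g
      unfolding Mgen_def by blast
  next
    fix z :: complex assume "z \<in> {z. z ^ ?N = 1}"
    then show "z \<in> (\<lambda>\<xi>. \<xi> g) ` Mchars n" using Mchars_exists[OF g assms, of z] by blast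
  qed
  ultimately have b: "bij_betw (\<lambda>\<xi>. \<xi> g) (Mchars n) {z. z ^ ?N = 1}" by (simp add: bij_betw_def)
  have "finite {z::complex. z ^ ?N = 1}" by (rule finite_roots_unity) (use N in simp)
  moreover have "card {z::complex. z ^ ?N = 1} = ?N" by (rule card_roots_unity_eq[OF N])
  ultimately show "finite (Mchars n :: ('a alg_closure \<Rightarrow> complex) set)"
    "card (Mchars n :: ('a alg_closure \<Rightarrow> complex) set) = ?N"
    using b by (metis bij_betw_finite, metis bij_betw_same_card)
qed

lemma Mchars_cnj:
  fixes \<xi> :: "'a::finite_field alg_closure \<Rightarrow> complex"
  assumes "\<xi> \<in> Mchars n" "x \<in> Mgrp n" "n > 0"
  shows "\<xi> x * cnj (\<xi> x) = 1"
proof -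
  let ?N = "CARD('a) ^ n - 1"
  have N: "?N > 0" using card_power_gt_1 [where 'a='a, OF assms(3)] by simp
  have "norm (\<xi> x) = 1" using power_eq_1_iff[OF Mchars_root_of_unity[OF assms]] N by simp
  then show ?thesis using complex_norm_square[of "\<xi> x", symmetric] by (simp only: of_real_1 power_one)
qed

lemma sum_root_of_unity:
  fixes z :: complex
  assumes "z ^ N = 1"
  shows "(\<Sum>i<N. z ^ i) = (if z = 1 then of_nat N else 0)"
  unfolding sum_gp_strict assms by (simp only: diff_self div_0)

text \<open>
  If \<open>x \<noteq> 1\<close>, some character \<open>\<xi>\<^sub>0\<close> has \<open>\<xi>\<^sub>0(x) \<noteq> 1\<close>, and multiplying the summation variable by \<open>\<xi>\<^sub>0\<close>
  multiplies the sum by a number different from \<open>1\<close>.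
\<close>

lemma Mchars_orthogonal_elements:
  fixes x :: "'a::finite_field alg_closure"
  assumes n: "n > 0" and x: "x \<in> Mgrp n"
  shows "(\<Sum>\<xi>\<in>Mchars n. cnj (\<xi> x)) = (if x = 1 then of_nat (CARD('a) ^ n - 1) else 0)"
proof (cases "x = 1")
  case True
  then show ?thesis by (simp add: Mchars_one card_Mchars n)
next
  case False
  let ?N = "CARD('a) ^ n - 1"
  have N: "?N > 0" using card_power_gt_1 [where 'a='a, OF n] by simp
  obtain g :: "'a alg_closure" where g: "Mgen n g" using Mgen_exists[OF n] by blast
  \<comment> \<open>A primitive root of unity at the generator gives a character that separates all elements.\<close>
  define \<zeta> where "\<zeta> = cis (2 * pi / ?N)"
  have "\<zeta> ^ ?N = cis (real ?N * (2 * pi / real ?N))" by (simp only: \<zeta>_def Complex.DeMoivre)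
  also have "real ?N * (2 * pi / real ?N) = 2 * pi" using N by (simp del: of_nat_diff)
  finally have "\<zeta> ^ ?N = 1" by simp
  then obtain \<xi>0 where \<xi>0: "\<xi>0 \<in> Mchars n" "\<xi>0 g = \<zeta>" using Mchars_exists[OF g n] by blast
  obtain i where i: "i < ?N" "x = g ^ i" using Mgen_powers_bij_betw[OF g n] x by (auto simp: bij_betw_def)
  \<comment> \<open>The powers of \<open>\<zeta>\<close> with exponents below the group order are distinct, so \<open>\<xi>0 x\<close> is not \<open>1\<close>.\<close>
  have "\<xi>0 x = \<zeta> ^ i" using \<xi>0 g by (simp add: i Mchars_power Mgen_def)
  also have "\<dots> \<noteq> 1"
  proof
    assume "\<zeta> ^ i = 1"
    moreover have "\<zeta> ^ i = cis (2 * pi * real i / real ?N)"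
      unfolding \<zeta>_def Complex.DeMoivre by (simp only: times_divide_eq_right mult.commute)
    moreover have "inj_on (\<lambda>k. cis (2 * pi * real k / real ?N)) {..<?N}"
      using bij_betw_roots_unity[OF N] by (simp add: bij_betw_def)
    ultimately have "i = 0" using i N inj_onD[of "\<lambda>k. cis (2 * pi * real k / real ?N)" "{..<?N}" i 0] by simp
    with i False show False by simp
  qed
  finally have ne: "cnj (\<xi>0 x) \<noteq> 1" by (metis complex_cnj_cnj complex_cnj_one)
  have mem: "(\<lambda>y. \<eta> y * \<xi> y) \<in> Mchars n" if "\<eta> \<in> Mchars n" "\<xi> \<in> Mchars n" for \<eta> \<xi> :: "'a alg_closure \<Rightarrow> complex"
    using that by (auto simp: Mchars_def)
  have cmem: "(\<lambda>y. cnj (\<xi>0 y)) \<in> Mchars n" using \<xi>0 by (auto simp: Mchars_def)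
  have canc: "\<xi>0 y * (cnj (\<xi>0 y) * \<xi> y) = \<xi> y" if "\<xi> \<in> Mchars n" for \<xi> y
  proof (cases "y \<in> Mgrp n")
    case True
    have "\<xi>0 y * (cnj (\<xi>0 y) * \<xi> y) = (\<xi>0 y * cnj (\<xi>0 y)) * \<xi> y" by (simp only: mult.assoc)
    then show ?thesis using Mchars_cnj[OF \<xi>0(1) True n] by simp
  qed (use that in \<open>simp add: Mchars_def\<close>)
  have canc': "cnj (\<xi>0 y) * (\<xi>0 y * \<xi> y) = \<xi> y" if "\<xi> \<in> Mchars n" for \<xi> y
    using canc[OF that, of y] by (simp only: mult.left_commute)
  have "(\<Sum>\<xi>\<in>Mchars n. cnj (\<xi> x)) = (\<Sum>\<xi>\<in>Mchars n. cnj (\<xi>0 x * \<xi> x))"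
  proof (rule sum.reindex_bij_witness[of _ "\<lambda>\<xi> y. \<xi>0 y * \<xi> y" "\<lambda>\<xi> y. cnj (\<xi>0 y) * \<xi> y"])
    fix \<xi> :: "'a alg_closure \<Rightarrow> complex" assume \<xi>: "\<xi> \<in> Mchars n"
    show "(\<lambda>y. \<xi>0 y * (cnj (\<xi>0 y) * \<xi> y)) = \<xi>" "(\<lambda>y. cnj (\<xi>0 y) * (\<xi>0 y * \<xi> y)) = \<xi>"
      by (intro ext, simp only: canc canc' \<xi>)+
    show "(\<lambda>y. cnj (\<xi>0 y) * \<xi> y) \<in> Mchars n" "(\<lambda>y. \<xi>0 y * \<xi> y) \<in> Mchars n"
      by (rule mem[OF cmem \<xi>] mem[OF \<xi>0(1) \<xi>])+
    show "cnj (\<xi>0 x * (cnj (\<xi>0 x) * \<xi> x)) = cnj (\<xi> x)" by (simp only: canc \<xi>)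
  qed
  also have "\<dots> = cnj (\<xi>0 x) * (\<Sum>\<xi>\<in>Mchars n. cnj (\<xi> x))" by (simp add: sum_distrib_left)
  finally show ?thesis using ne False by simp
qed

text \<open>
  Along the powers of a generator \<open>g\<close> this is a geometric sum whose ratio is \<open>1\<close> exactly when the two
  characters agree at \<open>g\<close>.
\<close>

lemma Mchars_orthogonal_characters:
  fixes \<xi> \<eta> :: "'a::finite_field alg_closure \<Rightarrow> complex"
  assumes n: "n > 0" and xi: "\<xi> \<in> Mchars n" "\<eta> \<in> Mchars n"
  shows "(\<Sum>x\<in>Mgrp n. \<xi> x * cnj (\<eta> x)) = (if \<xi> = \<eta> then of_nat (CARD('a) ^ n - 1) else 0)"
proof -
  let ?N = "CARD('a) ^ n - 1"
  obtain g :: "'a alg_closure" where g: "Mgen n g" using Mgen_exists[OF n] by blast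
  then have gm: "g \<in> Mgrp n" by (simp add: Mgen_def)
  define z where "z = \<xi> g * cnj (\<eta> g)"
  have zN: "z ^ ?N = 1"
    using Mchars_root_of_unity[OF xi(1) gm n] Mchars_root_of_unity[OF xi(2) gm n]
    by (simp add: z_def power_mult_distrib flip: complex_cnj_power)
  have "z = 1 \<longleftrightarrow> \<xi> g = \<eta> g"
  proof
    assume "z = 1"
    then have "\<xi> g * cnj (\<eta> g) = 1" by (simp only: z_def)
    then have "\<xi> g * (\<eta> g * cnj (\<eta> g)) = \<eta> g" by (metis mult.left_commute mult.right_neutral)
    then show "\<xi> g = \<eta> g" by (simp add: Mchars_cnj[OF xi(2) gm n])
  qed (simp add: z_def Mchars_cnj[OF xi(2) gm n])
  also have "\<dots> \<longleftrightarrow> \<xi> = \<eta>" using Mchars_eqI[OF xi g] by blast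
  finally have z1: "z = 1 \<longleftrightarrow> \<xi> = \<eta>" .
  have "(\<Sum>x\<in>Mgrp n. \<xi> x * cnj (\<eta> x)) = (\<Sum>i<?N. \<xi> (g ^ i) * cnj (\<eta> (g ^ i)))"
    by (rule sum.reindex_bij_betw[OF Mgen_powers_bij_betw[OF g n], symmetric])
  also have "\<dots> = (\<Sum>i<?N. z ^ i)"
    by (simp only: Mchars_power[OF xi(1) gm] Mchars_power[OF xi(2) gm] z_def power_mult_distrib complex_cnj_power)
  also have "\<dots> = (if \<xi> = \<eta> then of_nat ?N else 0)"
    by (simp only: sum_root_of_unity[OF zN] z1)
  finally show ?thesis .
qed

section \<open>Irreducible polynomials and conjugate points\<close>

definition ac_eval :: "'a::field poly \<Rightarrow> 'a alg_closure \<Rightarrow> 'a alg_closure" where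
  "ac_eval f x = poly (map_poly to_ac f) x"

lemma ac_eval_0 [simp]: "ac_eval 0 x = 0"
  and ac_eval_1 [simp]: "ac_eval 1 x = 1"
  by (simp_all add: ac_eval_def)

lemma ac_eval_pCons [simp]: "ac_eval (pCons a f) x = to_ac a + x * ac_eval f x"
  by (simp add: ac_eval_def map_poly_pCons)

lemma ac_eval_mult: "ac_eval (f * g) x = ac_eval f x * ac_eval g x"
  by (simp add: ac_eval_def to_ac_poly_mult)

lemma ac_eval_add: "ac_eval (f + g) x = ac_eval f x + ac_eval g x"
proof -
  have "map_poly to_ac (f + g) = map_poly to_ac f + map_poly to_ac g"
    by (rule poly_eqI) (simp add: coeff_map_poly)
  then show ?thesis by (simp add: ac_eval_def)
qed

lemma ac_eval_power_card:
  fixes f :: "'a::finite_field poly"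
  shows "ac_eval f (x ^ CARD('a)) = ac_eval f x ^ CARD('a)"
proof (induction f)
  case 0
  then show ?case by (simp add: power_0_left)
next
  case (pCons a f)
  have "to_ac a ^ CARD('a) = to_ac a"
    by (metis finite_field_power_card_eq_same to_ac_power)
  then show ?case using pCons by (simp add: frobenius_add power_mult_distrib)
qed

lemma power_card_Suc: "x ^ (CARD('a) ^ Suc i) = (x ^ (CARD('a) ^ i)) ^ CARD('a)"
  for x :: "'b::monoid_mult"
  by (simp only: power_Suc2 power_mult)

lemma power_card_add: "x ^ (CARD('a) ^ (i + j)) = (x ^ (CARD('a) ^ i)) ^ (CARD('a) ^ j)"
  for x :: "'b::monoid_mult"
  by (simp only: power_add power_mult)

lemma ac_eval_power_card_power:
  fixes f :: "'a::finite_field poly"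
  shows "ac_eval f (x ^ (CARD('a) ^ i)) = ac_eval f x ^ (CARD('a) ^ i)"
proof (induction i)
  case (Suc i)
  show ?case unfolding power_card_Suc ac_eval_power_card Suc ..
qed simp

text \<open>
  The fixed points are \<open>0\<close> and the \<open>q - 1\<close> elements of \<open>Mgrp 1\<close>, and the \<open>q\<close> elements of the base field are
  among them.
\<close>

lemma frobenius_fixed_iff:
  fixes y :: "'a::finite_field alg_closure"
  shows "y ^ CARD('a) = y \<longleftrightarrow> y \<in> range to_ac"
proof -
  have fin: "finite (Mgrp 1 :: 'a alg_closure set)" using card_Mgrp(1)[of 1] by simp
  have eq: "{y :: 'a alg_closure. y ^ CARD('a) = y} = insert 0 (Mgrp 1)"
    by (auto simp: Mgrp_def power_0_left)
  have "(0 :: 'a alg_closure) \<notin> Mgrp 1" by (simp add: Mgrp_def)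
  with fin have "card (insert 0 (Mgrp 1 :: 'a alg_closure set)) = Suc (card (Mgrp 1 :: 'a alg_closure set))"
    by (rule card_insert_disjoint)
  also have "\<dots> = CARD('a)" using card_Mgrp(2)[of 1, where 'a='a] card_gt_1[where 'a='a] by simp
  finally have "card {y :: 'a alg_closure. y ^ CARD('a) = y} = CARD('a)" by (simp only: eq)
  moreover have "card (range (to_ac :: 'a \<Rightarrow> _)) = CARD('a)" by (simp add: card_image inj_to_ac)
  moreover have "range (to_ac :: 'a \<Rightarrow> _) \<subseteq> {y. y ^ CARD('a) = y}"
    using finite_field_power_card_eq_same[where 'a='a] by (auto simp flip: to_ac_power)
  moreover have "finite {y :: 'a alg_closure. y ^ CARD('a) = y}" using fin by (simp only: eq finite_insert)
  ultimately have "range (to_ac :: 'a \<Rightarrow> _) = {y. y ^ CARD('a) = y}"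
    by (intro card_subset_eq) simp_all
  then show ?thesis by blast
qed

lemma frobenius_uminus:
  fixes y :: "'a::finite_field alg_closure"
  shows "(- y) ^ CARD('a) = - (y ^ CARD('a))"
proof -
  have "(- y + y) ^ CARD('a) = (- y) ^ CARD('a) + y ^ CARD('a)" by (rule frobenius_add)
  then have "0 = (- y) ^ CARD('a) + y ^ CARD('a)" by (simp add: power_0_left)
  then show ?thesis by (metis add_eq_0_iff2)
qed

lemma frobenius_sum:
  fixes f :: "'b \<Rightarrow> 'a::finite_field alg_closure"
  shows "(\<Sum>i\<in>A. f i) ^ CARD('a) = (\<Sum>i\<in>A. f i ^ CARD('a))"
  by (induction A rule: infinite_finite_induct) (simp_all add: frobenius_add power_0_left)

lemma frobenius_poly_mult:
  fixes f g :: "'a::finite_field alg_closure poly"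
  shows "map_poly (\<lambda>c. c ^ CARD('a)) (f * g) = map_poly (\<lambda>c. c ^ CARD('a)) f * map_poly (\<lambda>c. c ^ CARD('a)) g"
  by (rule poly_eqI) (simp add: coeff_map_poly coeff_mult frobenius_sum power_mult_distrib power_0_left)

text \<open>
  The Frobenius permutes the linear factors cyclically, so that it fixes the coefficients of the product.
\<close>

lemma conjugates_poly:
  fixes x :: "'a::finite_field alg_closure"
  assumes x: "x ^ (CARD('a) ^ n) = x"
  obtains g :: "'a poly" where "map_poly to_ac g = (\<Prod>i<n. [:- (x ^ (CARD('a) ^ i)), 1:])"
proof -
  let ?F = "map_poly (\<lambda>c::'a alg_closure. c ^ CARD('a))"
  define G where "G m = (\<Prod>i<m. [:- (x ^ (CARD('a) ^ i)), 1:])" for m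
  have F1: "?F 1 = 1" by (simp add: power_0_left)
  have F: "?F (G m) = (\<Prod>i<m. [:- (x ^ (CARD('a) ^ Suc i)), 1:])" for m
  proof (induction m)
    case 0
    then show ?case by (simp add: G_def F1 del: map_poly_1)
  next
    case (Suc m)
    have "?F [:- (x ^ (CARD('a) ^ m)), 1:] = [:- (x ^ (CARD('a) ^ Suc m)), 1:]"
      unfolding power_card_Suc by (simp add: map_poly_pCons power_0_left frobenius_uminus)
    moreover have "G (Suc m) = G m * [:- (x ^ (CARD('a) ^ m)), 1:]" by (simp add: G_def)
    ultimately show ?case by (simp only: frobenius_poly_mult Suc prod.lessThan_Suc)
  qed
  have "?F (G n) = G n"
  proof (cases n)
    case (Suc m)
    have "?F (G n) = (\<Prod>i<m. [:- (x ^ (CARD('a) ^ Suc i)), 1:]) * [:- (x ^ (CARD('a) ^ n)), 1:]"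
      by (simp only: F prod.lessThan_Suc Suc)
    also have "\<dots> = [:- (x ^ (CARD('a) ^ 0)), 1:] * (\<Prod>i<m. [:- (x ^ (CARD('a) ^ Suc i)), 1:])"
      unfolding x by (simp only: power_0 power_one_right mult.commute)
    also have "\<dots> = G n" unfolding G_def Suc by (rule prod.lessThan_Suc_shift[symmetric])
    finally show ?thesis .
  qed (simp add: F G_def)
  then have "Polynomial.coeff (G n) i ^ CARD('a) = Polynomial.coeff (G n) i" for i
    by (metis (no_types, lifting) coeff_map_poly zero_power zero_less_card_finite)
  then have "Polynomial.coeff (G n) i \<in> range to_ac" for i by (simp only: frobenius_fixed_iff)
  then have "map_poly to_ac (map_poly of_ac (G n)) = G n"
    by (intro poly_eqI) (simp add: coeff_map_poly to_ac_of_ac)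
  then show ?thesis using that G_def by metis
qed

text \<open>
  A vanishing polynomial of least degree divides all others, by division with remainder.
\<close>

lemma monic_min_poly:
  fixes x :: "'a::field alg_closure"
  obtains m :: "'a poly" where "Polynomial.lead_coeff m = 1" "irreducible m" "ac_eval m x = 0"
    "\<And>h. ac_eval h x = 0 \<Longrightarrow> m dvd h"
proof -
  define P where "P k \<longleftrightarrow> (\<exists>p :: 'a poly. p \<noteq> 0 \<and> ac_eval p x = 0 \<and> Polynomial.degree p = k)" for k
  obtain p0 :: "'a poly" where "p0 \<noteq> 0" "poly (map_poly to_ac p0) x = 0"
    by (rule alg_closure_algebraic[of x])
  then have "P (Polynomial.degree p0)" by (auto simp: P_def ac_eval_def)
  then have PL: "P (LEAST k. P k)" by (rule LeastI)
  then obtain p :: "'a poly" where p: "p \<noteq> 0" "ac_eval p x = 0" "Polynomial.degree p = (LEAST k. P k)"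
    by (auto simp: P_def)
  have min: "Polynomial.degree p \<le> Polynomial.degree h" if "h \<noteq> 0" "ac_eval h x = 0" for h
    unfolding p(3) by (rule Least_le) (use that in \<open>auto simp: P_def\<close>)
  define m where "m = Polynomial.smult (inverse (Polynomial.lead_coeff p)) p"
  have sm: "ac_eval (Polynomial.smult c h) x = to_ac c * ac_eval h x" for c h
    using ac_eval_mult[of "[:c:]" h x] by simp
  have m: "Polynomial.lead_coeff m = 1" "m \<noteq> 0" "ac_eval m x = 0" "Polynomial.degree m = Polynomial.degree p"
    using p(1,2) by (simp_all add: m_def sm)
  have deg0: "Polynomial.degree m > 0"
  proof (rule ccontr)
    assume "\<not> ?thesis"
    then have "m = 1" using m(1) by (metis degree_eq_zeroE coeff_pCons_0 degree_0 gr0I one_pCons degree_pCons_0)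
    with m(3) show False by simp
  qed
  have dvd: "m dvd h" if "ac_eval h x = 0" for h
  proof (rule ccontr)
    assume "\<not> m dvd h"
    then have "h mod m \<noteq> 0" by (simp add: mod_eq_0_iff_dvd)
    moreover have "ac_eval (m * (h div m) + h mod m) x = 0" using that by simp
    then have "ac_eval (h mod m) x = 0" by (simp only: ac_eval_add ac_eval_mult m(3)) simp
    ultimately have "Polynomial.degree p \<le> Polynomial.degree (h mod m)" by (rule min)
    moreover have "Polynomial.degree (h mod m) < Polynomial.degree m"
      using degree_mod_less'[of m h] m(2) \<open>h mod m \<noteq> 0\<close> by simp
    ultimately show False using m(4) by simp
  qed
  have "irreducible m"
  proof (rule irreducibleI)
    show "\<not> m dvd 1" using deg0 by (auto dest: dvd_imp_degree_le)
    fix a b assume ab: "m = a * b"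
    then have nz: "a \<noteq> 0" "b \<noteq> 0" using m(2) by auto
    have deg: "Polynomial.degree m = Polynomial.degree a + Polynomial.degree b"
      unfolding ab by (rule degree_mult_eq) (use nz in auto)
    have "ac_eval a x = 0 \<or> ac_eval b x = 0" using m(3) by (simp add: ab ac_eval_mult)
    then show "a dvd 1 \<or> b dvd 1"
    proof
      assume "ac_eval a x = 0"
      then have "Polynomial.degree b = 0" using min[OF nz(1)] deg m(4) by simp
      then show ?thesis using nz by (simp add: is_unit_iff_degree)
    next
      assume "ac_eval b x = 0"
      then have "Polynomial.degree a = 0" using min[OF nz(2)] deg m(4) by simp
      then show ?thesis using nz by (simp add: is_unit_iff_degree)
    qed
  qed (rule m(2))
  with m dvd show ?thesis by (intro that[of m])
qed

lemma irreducible_dvd_of_common_root: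
  fixes f h :: "'a::field poly"
  assumes "irreducible f" "ac_eval f x = 0" "ac_eval h x = 0"
  shows "f dvd h"
proof -
  obtain m :: "'a poly" where m: "irreducible m" "\<And>h. ac_eval h x = 0 \<Longrightarrow> m dvd h"
    by (rule monic_min_poly[of x]) blast
  obtain r where r: "f = m * r" using m(2)[OF assms(2)] by (elim dvdE)
  have "\<not> m dvd 1" using m(1) by (simp add: irreducible_def)
  then have "r dvd 1" using irreducibleD[OF assms(1) r] by blast
  then have "f dvd m" unfolding r by (metis dvd_mult_unit_iff' dvd_refl mult.commute)
  with m(2)[OF assms(3)] show ?thesis by (rule dvd_trans[rotated])
qed

lemma monic_irreducible_eqI:
  fixes f h :: "'a::field poly"
  assumes "irreducible f" "irreducible h" "ac_eval f x = 0" "ac_eval h x = 0"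
    "Polynomial.lead_coeff f = 1" "Polynomial.lead_coeff h = 1"
  shows "f = h"
proof -
  have "f dvd h" "h dvd f" using assms by (blast intro: irreducible_dvd_of_common_root)+
  then obtain r where r: "h = f * r" and le: "Polynomial.degree h \<le> Polynomial.degree f"
    using assms(1) dvd_imp_degree_le[of h f] by (metis dvdE not_irreducible_zero)
  have "f \<noteq> 0" "r \<noteq> 0" using assms(1,2) r by auto
  then have "Polynomial.degree r = 0" using le by (simp add: r degree_mult_eq)
  then obtain c where "r = [:c:]" by (rule degree_eq_zeroE)
  then have "Polynomial.lead_coeff h = Polynomial.lead_coeff f * c"
    using \<open>f \<noteq> 0\<close> \<open>r \<noteq> 0\<close> by (simp add: r)
  with assms(5,6) have "c = 1" by simp
  with r \<open>r = [:c:]\<close> show ?thesis by simp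
qed

text \<open>
  Let \<open>n\<close> be the period of \<open>x\<close> under the Frobenius.  The \<open>n\<close> conjugates of \<open>x\<close> are roots of \<open>f\<close>, and \<open>f\<close> divides
  the polynomial of degree \<open>n\<close> whose roots are these conjugates; so \<open>n\<close> is the degree of \<open>f\<close>.
\<close>

lemma irreducible_roots_conjugate:
  fixes f :: "'a::finite_field poly"
  assumes f: "irreducible f" and x: "ac_eval f x = 0" "x \<in> Mgrp N" "N > 0"
  shows "x \<in> Mgrp (Polynomial.degree f)" "Polynomial.degree f dvd N"
    "\<And>y. ac_eval f y = 0 \<Longrightarrow> \<exists>i. y = x ^ (CARD('a) ^ i)"
proof -
  let ?q = "CARD('a)"
  define n where "n = (LEAST n. n > 0 \<and> x ^ (?q ^ n) = x)"
  have "N > 0 \<and> x ^ (?q ^ N) = x" using x by (simp add: Mgrp_def)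
  then have n: "n > 0" "x ^ (?q ^ n) = x" unfolding n_def by (metis (mono_tags, lifting) LeastI)+
  have nleast: "n \<le> j" if "j > 0" "x ^ (?q ^ j) = x" for j
    unfolding n_def by (rule Least_le) (use that in simp)
  obtain g :: "'a poly" where g: "map_poly to_ac g = (\<Prod>i<n. [:- (x ^ (?q ^ i)), 1:])"
    by (rule conjugates_poly[OF n(2)])
  have groots: "ac_eval g y = 0 \<longleftrightarrow> (\<exists>i<n. y = x ^ (?q ^ i))" for y
    by (auto simp: ac_eval_def g poly_prod)
  have "ac_eval g x = 0" unfolding groots using n(1) by (intro exI[of _ 0]) simp
  then have fg: "f dvd g" by (rule irreducible_dvd_of_common_root[OF f x(1)])
  show "\<exists>i. y = x ^ (?q ^ i)" if "ac_eval f y = 0" for y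
  proof -
    from fg obtain r where "g = f * r" by (elim dvdE)
    with that have "ac_eval g y = 0" by (simp add: ac_eval_mult)
    then show ?thesis by (auto simp: groots)
  qed
  have per: "x ^ (?q ^ (i * n)) = x" for i
    by (induction i) (simp_all add: power_card_add n(2) add.commute)
  have inj: "inj_on (\<lambda>i. x ^ (?q ^ i)) {..<n}"
  proof (rule linorder_inj_onI)
    fix i j assume ij: "i < j" "i \<in> {..<n}" "j \<in> {..<n}"
    show "x ^ (?q ^ i) \<noteq> x ^ (?q ^ j)"
    proof
      assume eq: "x ^ (?q ^ i) = x ^ (?q ^ j)"
      have "x ^ (?q ^ j) = (x ^ (?q ^ (j - i))) ^ (?q ^ i)" using ij by (simp flip: power_card_add)
      with eq have "x = x ^ (?q ^ (j - i))" by (intro frobenius_inj[of x i]) simp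
      then show False using nleast[of "j - i"] ij by simp
    qed
  qed auto
  have f0: "f \<noteq> 0" using f by auto
  have degmap: "Polynomial.degree (map_poly to_ac h) = Polynomial.degree h" for h :: "'a poly"
    by (rule degree_map_poly) simp
  have "map_poly to_ac f \<noteq> 0" using f0 by (metis degmap map_poly_eq_0_iff to_ac_0 to_ac_eq_0_iff)
  then have fin: "finite {y. ac_eval f y = 0}" "card {y. ac_eval f y = 0} \<le> Polynomial.degree f"
    using poly_roots_finite card_poly_roots_bound unfolding ac_eval_def degmap[symmetric] by blast+
  have "(\<lambda>i. x ^ (?q ^ i)) ` {..<n} \<subseteq> {y. ac_eval f y = 0}"
    using x(1) by (auto simp: ac_eval_power_card_power)
  from card_mono[OF fin(1) this] have "n \<le> Polynomial.degree f"
    using fin(2) by (simp add: card_image[OF inj])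
  moreover have "Polynomial.degree g = n"
    unfolding degmap[symmetric] g by (subst degree_prod_eq_sum_degree) auto
  then have "Polynomial.degree f \<le> n" using dvd_imp_degree_le[OF fg] n(1) by fastforce
  ultimately have deg: "Polynomial.degree f = n" by simp
  show "x \<in> Mgrp (Polynomial.degree f)" using n x(2) by (simp add: deg Mgrp_def)
  have "x ^ (?q ^ (N mod n)) = x"
  proof -
    have "x = x ^ (?q ^ (N div n * n + N mod n))" using x(2) by (simp add: Mgrp_def)
    then show ?thesis by (simp only: power_card_add per)
  qed
  then have "N mod n = 0" using nleast[of "N mod n"] n(1) by (metis gr0I leD mod_less_divisor)
  then show "Polynomial.degree f dvd N" by (simp add: deg mod_eq_0_iff_dvd)
qed

lemma Phi_root_eval: "ac_eval (Rep_Phi f) (Phi_root f) = 0"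
proof -
  have f: "irreducible (Rep_Phi f)" using Rep_Phi[of f] by simp
  have "Polynomial.degree (map_poly to_ac (Rep_Phi f)) > 0"
    using f by (subst degree_map_poly) (auto simp: irreducible_def is_unit_iff_degree)
  then have "\<exists>x. poly (map_poly to_ac (Rep_Phi f)) x = 0" by (rule alg_closed_imp_poly_has_root)
  then show ?thesis unfolding Phi_root_def ac_eval_def by (rule someI_ex)
qed

lemma Phi_irreducible: "irreducible (Rep_Phi f)" and Phi_monic: "Polynomial.lead_coeff (Rep_Phi f) = 1"
  and Phi_neq_t: "Rep_Phi f \<noteq> [:0, 1:]"
  using Rep_Phi[of f] by simp_all

lemma Phi_deg_pos: "Phi_deg f > 0"
  using Phi_irreducible[of f] by (auto simp: Phi_deg_def irreducible_def is_unit_iff_degree)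

lemma Phi_eqI: "ac_eval (Rep_Phi f) x = 0 \<Longrightarrow> ac_eval (Rep_Phi h) x = 0 \<Longrightarrow> f = h"
  by (metis monic_irreducible_eqI Phi_irreducible Phi_monic Rep_Phi_inject)

text \<open>
  The Frobenius conjugates of the root are among the finitely many roots of \<open>f\<close>; by injectivity of the
  Frobenius the root is periodic, so it lies in some \<open>Mgrp N\<close>.
\<close>

lemma Phi_root_mem:
  fixes f :: "'a::finite_field Phi"
  shows "Phi_root f \<in> Mgrp (Phi_deg f)"
proof -
  let ?q = "CARD('a)"
  define x where "x = Phi_root f"
  define p where "p = Rep_Phi f"
  have p: "irreducible p" "ac_eval p x = 0" by (simp_all add: p_def x_def Phi_irreducible Phi_root_eval)
  have "x \<noteq> 0"
  proof
    assume "x = 0"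
    moreover have "irreducible [:0, 1 :: 'a:]" by (rule irreducible_linear_field_poly) simp
    ultimately have "p = [:0, 1:]"
      using p by (intro monic_irreducible_eqI[of _ _ 0]) (auto simp: p_def Phi_monic)
    with Phi_neq_t[of f] show False by (simp add: p_def)
  qed
  have "p \<noteq> 0" using p by auto
  then have "map_poly to_ac p \<noteq> 0" by (metis map_poly_eq_0_iff to_ac_0 to_ac_eq_0_iff)
  then have fin: "finite {y. ac_eval p y = 0}" unfolding ac_eval_def by (rule poly_roots_finite)
  have "range (\<lambda>i. x ^ (?q ^ i)) \<subseteq> {y. ac_eval p y = 0}"
    using p(2) by (auto simp: ac_eval_power_card_power)
  then have "\<not> inj (\<lambda>i. x ^ (?q ^ i))" using fin finite_imageD infinite_UNIV_nat finite_subset by blast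
  then obtain i j where ij: "i < j" "x ^ (?q ^ i) = x ^ (?q ^ j)"
    unfolding inj_def by (metis linorder_neqE_nat)
  have "x ^ (?q ^ j) = (x ^ (?q ^ (j - i))) ^ (?q ^ i)" using ij(1) by (simp flip: power_card_add)
  with ij(2) have "x = x ^ (?q ^ (j - i))" by (intro frobenius_inj[of x i]) simp
  then have "x \<in> Mgrp (j - i)" using \<open>x \<noteq> 0\<close> by (simp add: Mgrp_def)
  then have "x \<in> Mgrp (Polynomial.degree p)" using irreducible_roots_conjugate(1)[OF p] ij by simp
  then show ?thesis by (simp add: x_def p_def Phi_deg_def)
qed

lemma Phi_conjugate:
  fixes x :: "'a::finite_field alg_closure"
  assumes "x \<in> Mgrp N" "N > 0"
  shows "\<exists>f i. Phi_deg f dvd N \<and> Phi_root f = x ^ (CARD('a) ^ i)"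
proof -
  obtain m :: "'a poly" where m: "Polynomial.lead_coeff m = 1" "irreducible m" "ac_eval m x = 0"
    by (rule monic_min_poly[of x])
  have "m \<noteq> [:0, 1:]" using m(3) assms(1) by (auto simp: Mgrp_def)
  with m obtain f where f: "Rep_Phi f = m" by (metis (mono_tags, lifting) Abs_Phi_inverse mem_Collect_eq)
  then show ?thesis
    using irreducible_roots_conjugate(2,3)[OF m(2,3) assms] Phi_root_eval[of f]
    by (auto simp: Phi_deg_def)
qed

lemma Phi_root_f_one: "Phi_root (f_one :: 'a::finite_field Phi) = 1"
  using Phi_root_eval[of "f_one :: 'a Phi"] by (simp add: f_one.rep_eq)

lemma Phi_root_eq_1_iff: "Phi_root f = 1 \<longleftrightarrow> f = f_one"
  using Phi_eqI[of f 1 f_one] Phi_root_eval[of f] by (auto simp: Phi_root_f_one f_one.rep_eq)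

lemma Phi_deg_f_one: "Phi_deg f_one = 1"
  by (simp add: Phi_deg_def f_one.rep_eq)

section \<open>Frobenius orbits of characters\<close>

lemma Mnorm_eq_power:
  fixes x :: "'a::finite_field alg_closure"
  shows "Mnorm k m x = x ^ (\<Sum>i<k div m. CARD('a) ^ (m * i))"
  by (simp add: Mnorm_def power_sum)

lemma norm_exponent:
  fixes q :: nat
  assumes "m dvd k" "q > 0"
  shows "(q ^ m - 1) * (\<Sum>i<k div m. q ^ (m * i)) = q ^ k - 1"
proof -
  obtain p where p: "q ^ m = Suc p" using assms(2) by (metis gr0_implies_Suc zero_less_power)
  have "Suc (p * (\<Sum>i<r. Suc p ^ i)) = Suc p ^ r" for r
    by (induction r) (simp_all add: algebra_simps)
  then have 1: "Suc (p * (\<Sum>i<k div m. Suc p ^ i)) = Suc p ^ (k div m)" .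
  have "q ^ k = (q ^ m) ^ (k div m)" using assms(1) by (simp flip: power_mult)
  then have 2: "q ^ k = Suc p ^ (k div m)" by (simp only: p)
  have "(q ^ m - 1) * (\<Sum>i<k div m. q ^ (m * i)) = p * (\<Sum>i<k div m. Suc p ^ i)"
    by (simp only: power_mult p diff_Suc_1)
  also have "\<dots> = q ^ k - 1" using 1 2 by linarith
  finally show ?thesis .
qed

text \<open>
  The norm is a power map, and roots exist in the algebraic closure; by the relation between the
  exponents, every root of an element of \<open>Mgrp m\<close> lies in \<open>Mgrp k\<close>.
\<close>

lemma Mnorm_surj:
  fixes y :: "'a::finite_field alg_closure"
  assumes y: "y \<in> Mgrp m" and m: "m dvd k" "k > 0"
  shows "\<exists>x\<in>Mgrp k. Mnorm k m x = y"
proof -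
  let ?E = "\<Sum>i<k div m. CARD('a) ^ (m * i)"
  have m0: "m > 0" using m by (auto intro: gr0I)
  have E: "(CARD('a) ^ m - 1) * ?E = CARD('a) ^ k - 1" by (rule norm_exponent[OF m(1)]) simp
  moreover have "CARD('a) ^ k - 1 > 0" using card_power_gt_1[OF m(2), where 'a='a] by simp
  ultimately have "?E > 0" by (metis gr0I mult_0_right)
  then obtain x where x: "x ^ ?E = y" using nth_root_exists[of ?E y] by blast
  have "x ^ (CARD('a) ^ k - 1) = y ^ (CARD('a) ^ m - 1)"
    unfolding E[symmetric] x[symmetric] by (simp only: power_mult[symmetric] mult.commute)
  also have "\<dots> = 1" using y m0 by (simp add: Mgrp_iff)
  finally have "x \<in> Mgrp k" using m(2) by (simp add: Mgrp_iff)
  with x show ?thesis by (auto simp: Mnorm_eq_power)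
qed

lemma Mnorm_mult: "Mnorm k m (x * y) = Mnorm k m x * Mnorm k m y"
  by (simp add: Mnorm_def power_mult_distrib prod.distrib)

lemma Mnorm_self: "n > 0 \<Longrightarrow> Mnorm n n x = x"
  by (simp add: Mnorm_def)

text \<open>
  The embedding of the characters of \<open>Mgrp m\<close> into those of \<open>Mgrp k\<close>, extended by \<open>0\<close> outside \<open>Mgrp k\<close> as
  required of elements of \<open>Mchars k\<close>.
\<close>

definition Mchar_lift :: "nat \<Rightarrow> nat \<Rightarrow> ('a::finite_field alg_closure \<Rightarrow> complex) \<Rightarrow> 'a alg_closure \<Rightarrow> complex" where
  "Mchar_lift k m \<chi> x = (if x \<in> Mgrp k then \<chi> (Mnorm k m x) else 0)"

lemma Mchar_lift_mem: "\<chi> \<in> Mchars m \<Longrightarrow> m dvd k \<Longrightarrow> k > 0 \<Longrightarrow> Mchar_lift k m \<chi> \<in> Mchars k"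
  using Mnorm_in_Mgrp[of _ k m]
  by (auto simp: Mchars_def Mchar_lift_def Mgrp_mult Mnorm_mult)

lemma Mstar_of_eq_iff_rel:
  "Mstar_of m \<chi> = Mstar_of n \<psi> \<longleftrightarrow> Mstar_rel (m, \<chi>) (n, \<psi>)"
  if "m > 0" "n > 0" "\<chi> \<in> Mchars m" "\<psi> \<in> Mchars n"
proof -
  have r: "Mstar_rel (n, \<chi>) (n, \<chi>)" if "n > 0" "\<chi> \<in> Mchars n" for n and \<chi> :: "'a alg_closure \<Rightarrow> complex"
    using that by (auto simp: Mstar_rel_def)
  show ?thesis unfolding Mstar_of_def
    using Quotient3_rel[OF Quotient3_Mstar, of "(m, \<chi>)" "(n, \<psi>)"] r that by blast
qed

text \<open>
  Two characters of \<open>Mgrp n\<close> with the same pull-back along a norm agree because the norm is surjective.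
\<close>

lemma Mstar_of_inj:
  fixes \<chi> \<psi> :: "'a::finite_field alg_closure \<Rightarrow> complex"
  assumes "n > 0" "\<chi> \<in> Mchars n" "\<psi> \<in> Mchars n" "Mstar_of n \<chi> = Mstar_of n \<psi>"
  shows "\<chi> = \<psi>"
proof -
  obtain k where k: "k > 0" "n dvd k" "\<And>x. x \<in> Mgrp k \<Longrightarrow> \<chi> (Mnorm k n x) = \<psi> (Mnorm k n x)"
    using assms by (auto simp: Mstar_of_eq_iff_rel Mstar_rel_def)
  show ?thesis
  proof
    fix y
    show "\<chi> y = \<psi> y"
    proof (cases "y \<in> Mgrp n")
      case True
      then show ?thesis using Mnorm_surj[OF _ k(2,1), of y] k(3) by auto
    qed (use assms in \<open>simp add: Mchars_def\<close>)
  qed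
qed

lemma Mstar_of_lift:
  assumes "\<chi> \<in> Mchars m" "m dvd k" "k > 0"
  shows "Mstar_of k (Mchar_lift k m \<chi>) = Mstar_of m \<chi>"
proof -
  have "m > 0" using assms by (auto intro: gr0I)
  then show ?thesis
    using assms by (subst Mstar_of_eq_iff_rel)
      (auto simp: Mchar_lift_mem Mstar_rel_def Mchar_lift_def Mnorm_self intro!: exI[of _ k])
qed

lemma Mstar_exhaust:
  fixes u :: "'a::finite_field Mstar"
  obtains n \<chi> where "n > 0" "\<chi> \<in> Mchars n" "u = Mstar_of n \<chi>"
proof -
  obtain n \<chi> where r: "rep_Mstar u = (n, \<chi>)" by (cases "rep_Mstar u")
  have "Mstar_rel (rep_Mstar u) (rep_Mstar u)" by (rule Quotient3_rep_reflp[OF Quotient3_Mstar])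
  then have "n > 0" "\<chi> \<in> Mchars n" by (auto simp: r Mstar_rel_def)
  moreover have "u = Mstar_of n \<chi>"
    unfolding Mstar_of_def r[symmetric] by (rule Quotient3_abs_rep[OF Quotient3_Mstar, symmetric])
  ultimately show ?thesis by (rule that)
qed

lemma Mchars_char_power: "\<chi> \<in> Mchars n \<Longrightarrow> j > 0 \<Longrightarrow> (\<lambda>x. \<chi> x ^ j) \<in> Mchars n"
  by (auto simp: Mchars_def power_mult_distrib)

lemma Mstar_frob_of:
  fixes \<chi> :: "'a::finite_field alg_closure \<Rightarrow> complex"
  assumes "n > 0" "\<chi> \<in> Mchars n"
  shows "Mstar_frob (Mstar_of n \<chi>) = Mstar_of n (\<lambda>x. \<chi> x ^ CARD('a))"
proof -
  have "Mstar_rel (n, \<chi>) (n, \<chi>)" using assms by (auto simp: Mstar_rel_def)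
  then show ?thesis unfolding Mstar_of_def by (simp add: Mstar_frob.abs_eq)
qed

lemma Mstar_frob_funpow_of:
  fixes \<chi> :: "'a::finite_field alg_closure \<Rightarrow> complex"
  assumes "n > 0" "\<chi> \<in> Mchars n"
  shows "(Mstar_frob ^^ i) (Mstar_of n \<chi>) = Mstar_of n (\<lambda>x. \<chi> x ^ (CARD('a) ^ i))"
proof (induction i)
  case (Suc i)
  have "(\<lambda>x. \<chi> x ^ (CARD('a) ^ i)) \<in> Mchars n" by (rule Mchars_char_power) (use assms in auto)
  with Suc show ?case by (simp add: Mstar_frob_of assms mult.commute flip: power_mult)
qed simp

lemma Mchars_power_card_power:
  fixes \<chi> :: "'a::finite_field alg_closure \<Rightarrow> complex"
  assumes "\<chi> \<in> Mchars n"
  shows "\<chi> x ^ (CARD('a) ^ i) = \<chi> (x ^ (CARD('a) ^ i))"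
proof (cases "x \<in> Mgrp n")
  case True
  then show ?thesis using assms by (simp add: Mchars_power)
next
  case False
  have "x ^ (CARD('a) ^ i) \<notin> Mgrp n"
  proof
    assume m: "x ^ (CARD('a) ^ i) \<in> Mgrp n"
    then have "x \<noteq> 0" by (auto simp: Mgrp_def power_0_left)
    moreover have "(x ^ (CARD('a) ^ n)) ^ (CARD('a) ^ i) = x ^ (CARD('a) ^ i)"
      using m by (simp add: Mgrp_def mult.commute flip: power_mult)
    then have "x ^ (CARD('a) ^ n) = x" by (rule frobenius_inj)
    ultimately show False using False by (simp add: Mgrp_def)
  qed
  with False assms show ?thesis by (simp add: Mchars_def power_0_left)
qed

lemma Mchars_frobenius_period:
  fixes \<chi> :: "'a::finite_field alg_closure \<Rightarrow> complex"
  assumes "\<chi> \<in> Mchars n"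
  shows "\<chi> x ^ (CARD('a) ^ n) = \<chi> x"
proof (cases "x \<in> Mgrp n")
  case True
  then show ?thesis by (simp add: Mchars_power_card_power[OF assms]) (simp add: Mgrp_def)
next
  case False
  then show ?thesis using assms by (simp add: Mchars_def power_0_left)
qed

lemma orbit_of_periodic_point:
  assumes "(f ^^ n) s = s" "n > 0"
  shows "s \<in> orbit f s" "(f ^^ j) s = s \<longleftrightarrow> card (orbit f s) dvd j" "card (orbit f s) > 0"
    "orbit f s = (\<lambda>i. (f ^^ i) s) ` {..<card (orbit f s)}"
proof -
  show so: "s \<in> orbit f s" using assms unfolding orbit_altdef by (metis (mono_tags, lifting) mem_Collect_eq)
  define p where "p = funpow_dist1 f s s"
  have orb: "orbit f s = (\<lambda>i. (f ^^ i) s) ` {0..<p}"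
    unfolding p_def by (rule orbit_conv_funpow_dist1[OF so])
  have inj: "inj_on (\<lambda>i. (f ^^ i) s) {0..<p}" unfolding p_def by (rule inj_on_funpow_dist1[OF so])
  have cp: "card (orbit f s) = p" unfolding orb by (simp add: card_image[OF inj])
  have p0: "p > 0" by (simp add: p_def)
  have ps: "(f ^^ p) s = s" unfolding p_def by (rule funpow_dist1_prop[OF so])
  have mul: "(f ^^ (p * i)) s = s" for i
    by (induction i) (simp_all add: funpow_add ps)
  have md: "(f ^^ j) s = (f ^^ (j mod p)) s" for j
  proof -
    have "(f ^^ j) s = (f ^^ (j mod p + p * (j div p))) s" by simp
    then show ?thesis by (simp only: funpow_add o_apply mul)
  qed
  show "(f ^^ j) s = s \<longleftrightarrow> card (orbit f s) dvd j"
  proof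
    assume "(f ^^ j) s = s"
    then have "(f ^^ (j mod p)) s = (f ^^ 0) s" using md[of j] by simp
    then have "j mod p = 0" using inj_onD[OF inj, of "j mod p" 0] p0 by simp
    then show "card (orbit f s) dvd j" by (simp add: cp mod_eq_0_iff_dvd)
  next
    assume "card (orbit f s) dvd j"
    then show "(f ^^ j) s = s" using mul by (auto simp: cp elim!: dvdE)
  qed
  show "card (orbit f s) > 0" using p0 by (simp add: cp)
  show "orbit f s = (\<lambda>i. (f ^^ i) s) ` {..<card (orbit f s)}"
    unfolding cp using orb by (simp only: atLeast0LessThan)
qed

lemma Mstar_frob_period:
  fixes \<chi> :: "'a::finite_field alg_closure \<Rightarrow> complex"
  assumes "n > 0" "\<chi> \<in> Mchars n"
  shows "(Mstar_frob ^^ n) (Mstar_of n \<chi>) = Mstar_of n \<chi>"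
  by (simp add: Mstar_frob_funpow_of assms Mchars_frobenius_period)

lemma Rep_frob_orbit: "Rep_PhiStar (frob_orbit \<xi>) = orbit Mstar_frob \<xi>"
  unfolding frob_orbit_def by (rule Abs_PhiStar_inverse) blast

lemma PhiStar_size_frob_orbit: "PhiStar_size (frob_orbit \<xi>) = card (orbit Mstar_frob \<xi>)"
  by (simp add: PhiStar_size_def Rep_frob_orbit)

lemma PhiStar_size_dvd:
  assumes "n > 0" "\<chi> \<in> Mchars n"
  shows "PhiStar_size (frob_orbit (Mstar_of n \<chi>)) dvd n" "PhiStar_size (frob_orbit (Mstar_of n \<chi>)) > 0"
  unfolding PhiStar_size_frob_orbit
  using orbit_of_periodic_point(2,3)[OF Mstar_frob_period[OF assms] assms(1)] Mstar_frob_period[OF assms] by auto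

lemma frob_orbit_frob:
  fixes \<chi> :: "'a::finite_field alg_closure \<Rightarrow> complex"
  assumes n: "n > 0" "\<chi> \<in> Mchars n"
  shows "frob_orbit (Mstar_of n (\<lambda>x. \<chi> x ^ (CARD('a) ^ i))) = frob_orbit (Mstar_of n \<chi>)"
proof -
  let ?s = "Mstar_of n \<chi>"
  have s: "?s \<in> orbit Mstar_frob ?s" by (rule orbit_of_periodic_point(1)[OF Mstar_frob_period[OF n] n(1)])
  have mem: "(Mstar_frob ^^ i) ?s \<in> orbit Mstar_frob ?s"
  proof (cases "i = 0")
    case False
    then show ?thesis by (auto simp: orbit_altdef)
  qed (use s in simp)
  have "orbit Mstar_frob ((Mstar_frob ^^ i) ?s) = orbit Mstar_frob ?s"
    using orbit_trans[OF _ mem] orbit_trans[OF _ orbit_swap[OF s mem]] by blast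
  then show ?thesis by (simp add: frob_orbit_def Mstar_frob_funpow_of n)
qed

text \<open>
  If the orbit of a character \<open>\<chi>\<close> of \<open>Mgrp n\<close> has size \<open>d\<close>, then \<open>\<chi>\<close> is fixed by the \<open>d\<close>-th power of the
  Frobenius, so its value at a generator \<open>g\<close> of \<open>Mgrp n\<close> has order dividing \<open>q\<^sup>d - 1\<close>.  The norm of \<open>g\<close> generates
  \<open>Mgrp d\<close> and can therefore be given this value by a character of \<open>Mgrp d\<close>, whose lift is \<open>\<chi>\<close>.
\<close>

lemma PhiStar_of_char:
  fixes \<phi> :: "'a::finite_field PhiStar"
  shows "\<exists>\<psi>\<in>Mchars (PhiStar_size \<phi>). frob_orbit (Mstar_of (PhiStar_size \<phi>) \<psi>) = \<phi>"
    and PhiStar_size_pos: "PhiStar_size \<phi> > 0"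
proof -
  obtain s where "Rep_PhiStar \<phi> = orbit Mstar_frob s" using Rep_PhiStar[of \<phi>] by auto
  then have phi: "\<phi> = frob_orbit s" unfolding frob_orbit_def by (metis Rep_PhiStar_inverse)
  obtain n \<chi> where n: "n > 0" "\<chi> \<in> Mchars n" and s: "s = Mstar_of n \<chi>" by (rule Mstar_exhaust)
  define d where "d = PhiStar_size \<phi>"
  have d: "d dvd n" "d > 0" using PhiStar_size_dvd[OF n] by (simp_all add: d_def phi s)
  then show "PhiStar_size \<phi> > 0" by (simp add: d_def)
  have "(Mstar_frob ^^ d) s = s"
    unfolding s orbit_of_periodic_point(2)[OF Mstar_frob_period[OF n] n(1)]
    by (simp add: d_def phi s PhiStar_size_frob_orbit)
  then have "Mstar_of n (\<lambda>x. \<chi> x ^ (CARD('a) ^ d)) = Mstar_of n \<chi>"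
    by (simp add: s Mstar_frob_funpow_of n)
  moreover have "(\<lambda>x. \<chi> x ^ (CARD('a) ^ d)) \<in> Mchars n" by (rule Mchars_char_power) (use n in auto)
  ultimately have fixed: "(\<lambda>x. \<chi> x ^ (CARD('a) ^ d)) = \<chi>" by (intro Mstar_of_inj[OF n(1)] n(2))
  obtain g :: "'a alg_closure" where g: "Mgen n g" using Mgen_exists[OF n(1)] by blast
  then have gm: "g \<in> Mgrp n" by (simp add: Mgen_def)
  define h where "h = Mnorm n d g"
  have hg: "Mnorm n d (g ^ i) = h ^ i" for i
    by (simp add: h_def Mnorm_eq_power mult.commute flip: power_mult)
  have h: "Mgen d h"
    unfolding Mgen_def
  proof (intro conjI ballI)
    show "h \<in> Mgrp d" unfolding h_def by (rule Mnorm_in_Mgrp[OF gm d(1) n(1)])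
    fix y :: "'a alg_closure" assume "y \<in> Mgrp d"
    then obtain x where "x \<in> Mgrp n" "Mnorm n d x = y" using Mnorm_surj[OF _ d(1) n(1)] by blast
    then show "\<exists>i. y = h ^ i" using g hg unfolding Mgen_def by metis
  qed
  have g0: "\<chi> g \<noteq> 0" using n(2) gm by (simp add: Mchars_def)
  have "\<chi> g * \<chi> g ^ (CARD('a) ^ d - 1) = \<chi> g ^ (CARD('a) ^ d)"
    by (simp flip: power_Suc)
  also have "\<dots> = \<chi> g" using fixed by (rule fun_cong)
  finally have "\<chi> g ^ (CARD('a) ^ d - 1) = 1" using g0 by simp
  then obtain \<psi> where psi: "\<psi> \<in> Mchars d" "\<psi> h = \<chi> g" using Mchars_exists[OF h d(2)] by blast
  have "Mchar_lift n d \<psi> = \<chi>"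
    by (rule Mchars_eqI[OF Mchar_lift_mem[OF psi(1) d(1) n(1)] n(2) g])
      (simp add: Mchar_lift_def gm h_def[symmetric] psi(2))
  then have "Mstar_of d \<psi> = s" using Mstar_of_lift[OF psi(1) d(1) n(1)] by (simp add: s)
  then have "frob_orbit (Mstar_of d \<psi>) = \<phi>" by (simp only: phi)
  then show "\<exists>\<psi>\<in>Mchars (PhiStar_size \<phi>). frob_orbit (Mstar_of (PhiStar_size \<phi>) \<psi>) = \<phi>"
    using psi(1) unfolding d_def by blast
qed

lemma PhiStar_of_char_lift:
  fixes \<phi> :: "'a::finite_field PhiStar"
  assumes "PhiStar_size \<phi> dvd n" "n > 0"
  shows "\<exists>\<psi>\<in>Mchars n. frob_orbit (Mstar_of n \<psi>) = \<phi>"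
  using PhiStar_of_char(1)[of \<phi>] Mchar_lift_mem[OF _ assms] Mstar_of_lift[OF _ assms] by metis

text \<open>
  The characters of \<open>Mgrp n\<close> embed into \<open>M\<^sup>*\<close>, and if one point of an orbit lies in the image, so does the
  whole orbit.
\<close>

lemma card_PhiStar_fibre:
  fixes \<phi> :: "'a::finite_field PhiStar"
  assumes "PhiStar_size \<phi> dvd n" "n > 0"
  shows "card {\<xi> \<in> Mchars n. frob_orbit (Mstar_of n \<xi>) = \<phi>} = PhiStar_size \<phi>"
proof -
  let ?A = "{\<xi> \<in> Mchars n. frob_orbit (Mstar_of n \<xi>) = \<phi>}"
  obtain \<chi> where chi: "\<chi> \<in> Mchars n" "frob_orbit (Mstar_of n \<chi>) = \<phi>"
    using PhiStar_of_char_lift[OF assms] by blast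
  have rep: "Rep_PhiStar \<phi> = orbit Mstar_frob (Mstar_of n \<chi>)" unfolding chi(2)[symmetric] by (rule Rep_frob_orbit)
  have "inj_on (Mstar_of n) ?A" by (intro inj_onI) (auto intro: Mstar_of_inj[OF assms(2)])
  moreover have "Mstar_of n ` ?A = Rep_PhiStar \<phi>"
  proof (intro equalityI subsetI)
    fix u assume "u \<in> Mstar_of n ` ?A"
    then obtain \<xi> where xi: "\<xi> \<in> Mchars n" "frob_orbit (Mstar_of n \<xi>) = \<phi>" "u = Mstar_of n \<xi>" by blast
    have "Mstar_of n \<xi> \<in> orbit Mstar_frob (Mstar_of n \<xi>)"
      by (rule orbit_of_periodic_point(1)[OF Mstar_frob_period[OF assms(2) xi(1)] assms(2)])
    then show "u \<in> Rep_PhiStar \<phi>" unfolding xi(3) xi(2)[symmetric] Rep_frob_orbit .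
  next
    fix u assume "u \<in> Rep_PhiStar \<phi>"
    then obtain i where u: "u = (Mstar_frob ^^ i) (Mstar_of n \<chi>)"
      unfolding rep by (subst (asm) orbit_of_periodic_point(4)[OF Mstar_frob_period[OF assms(2) chi(1)] assms(2)]) blast
    show "u \<in> Mstar_of n ` ?A"
      unfolding u Mstar_frob_funpow_of[OF assms(2) chi(1)]
      using frob_orbit_frob[OF assms(2) chi(1), of i] chi Mchars_char_power[OF chi(1), of "CARD('a) ^ i"]
      by (intro imageI) simp
  qed
  ultimately have "card ?A = card (Rep_PhiStar \<phi>)" by (metis card_image)
  then show ?thesis by (simp add: PhiStar_size_def)
qed

section \<open>Derivations and substitutions of polynomial algebras\<close>

lemma const_0 [simp]: "const 0 = 0"
  and const_1 [simp]: "const 1 = 1"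
  and const_add: "const (a + b) = const a + const b"
  and const_mult: "const (a * b) = const a * const b"
  and const_uminus: "const (- a) = - const a"
  and const_of_nat: "const (of_nat n) = of_nat n"
  by (simp_all add: const_def single_add mult_single single_uminus)

lemma const_diff: "const (a - b) = const a - const b"
  by (simp only: diff_conv_add_uminus const_add const_uminus)

lemma const_sum: "const (\<Sum>i\<in>A. f i) = (\<Sum>i\<in>A. const (f i))"
  by (induction A rule: infinite_finite_induct) (simp_all add: const_add)

lemma const_power: "const (a ^ n) = const a ^ n"
  by (induction n) (simp_all add: const_mult)

lemma const_inverse_mult: "a \<noteq> 0 \<Longrightarrow> const (1 / a) * (const a * F) = F"
  by (simp add: const_mult[symmetric] mult.assoc[symmetric])

lemma cpoly_expansion:
  "F = (\<Sum>m\<in>Poly_Mapping.keys F. Poly_Mapping.single m (Poly_Mapping.lookup F m))"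
proof (rule poly_mapping_eqI)
  fix k
  show "Poly_Mapping.lookup F k = Poly_Mapping.lookup
      (\<Sum>m\<in>Poly_Mapping.keys F. Poly_Mapping.single m (Poly_Mapping.lookup F m)) k"
    by (simp add: lookup_sum lookup_single when_def in_keys_iff)
qed

lemma cpoly_monomial_induct [case_names single add]:
  assumes "\<And>m a. P (Poly_Mapping.single m a)" "\<And>F G. P F \<Longrightarrow> P G \<Longrightarrow> P (F + G)"
  shows "P (F :: 'i cpoly)"
proof -
  have "P (\<Sum>m\<in>A. Poly_Mapping.single m (Poly_Mapping.lookup F m))" if "finite A" for A
    using that
  proof induction
    case empty
    show ?case using assms(1)[of 0 0] by simp
  qed (simp add: assms)
  then show ?thesis by (subst cpoly_expansion) simp
qed

lemma cpoly_induct [case_names const add mult]: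
  assumes "\<And>c. P (const c)" "\<And>F G. P F \<Longrightarrow> P G \<Longrightarrow> P (F + G)" "\<And>i F. P F \<Longrightarrow> P (indet i * F)"
  shows "P (F :: 'i cpoly)"
proof (induction F rule: cpoly_monomial_induct)
  case (single m a)
  show ?case
  proof (induction m rule: update_induct)
    case const
    show ?case using assms(1)[of a] by (simp add: const_def)
  next
    case (update f k v)
    have *: "P (Poly_Mapping.single (f + Poly_Mapping.single k n) a)" for n
    proof (induction n)
      case 0
      show ?case using update by simp
    next
      case (Suc n)
      have "Poly_Mapping.single (f + Poly_Mapping.single k (Suc n)) a
          = indet k * Poly_Mapping.single (f + Poly_Mapping.single k n) a"
        by (simp add: indet_def mult_single single_add[symmetric] add.left_commute)
      then show ?case using Suc assms(3) by simp
    qed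
    have "Poly_Mapping.update k v f = f + Poly_Mapping.single k v"
      using update(1) by (intro poly_mapping_eqI) (auto simp: lookup_update lookup_add lookup_single when_def in_keys_iff)
    then show ?case using * by simp
  qed
qed (rule assms(2))

definition derivation :: "('i cpoly \<Rightarrow> 'i cpoly) \<Rightarrow> bool" where
  "derivation D \<longleftrightarrow> (\<forall>F G. D (F + G) = D F + D G) \<and> (\<forall>F G. D (F * G) = D F * G + F * D G)
     \<and> (\<forall>c. D (const c) = 0)"

lemma derivation_add: "derivation D \<Longrightarrow> D (F + G) = D F + D G"
  and derivation_mult: "derivation D \<Longrightarrow> D (F * G) = D F * G + F * D G"
  and derivation_const: "derivation D \<Longrightarrow> D (const c) = 0"
  by (simp_all add: derivation_def)

lemma derivation_0: "derivation D \<Longrightarrow> D 0 = 0"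
  using derivation_const[of D 0] by simp

lemma derivation_const_mult: "derivation D \<Longrightarrow> D (const c * F) = const c * D F"
  by (simp add: derivation_mult derivation_const)

lemma derivation_minus: "derivation D \<Longrightarrow> D (- F) = - D F"
  using derivation_const_mult[of D "-1" F] by (simp add: const_uminus)

lemma derivation_sum: "derivation D \<Longrightarrow> D (\<Sum>i\<in>A. f i) = (\<Sum>i\<in>A. D (f i))"
  by (induction A rule: infinite_finite_induct) (simp_all add: derivation_0 derivation_add)

lemma derivation_scaled_sum:
  assumes "\<And>i. i \<in> A \<Longrightarrow> derivation (D i)"
  shows "derivation (\<lambda>F. const c * (\<Sum>i\<in>A. D i F))"
proof -
  have "(\<Sum>i\<in>A. D i (F + G)) = (\<Sum>i\<in>A. D i F) + (\<Sum>i\<in>A. D i G)"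
    "(\<Sum>i\<in>A. D i (F * G)) = (\<Sum>i\<in>A. D i F) * G + F * (\<Sum>i\<in>A. D i G)"
    "(\<Sum>i\<in>A. D i (const b)) = 0" for F G b
    using assms by (simp_all add: derivation_add derivation_mult derivation_const sum.distrib
      sum_distrib_left sum_distrib_right)
  then show ?thesis by (simp add: derivation_def algebra_simps)
qed

lemma derivation_uminus: "derivation D \<Longrightarrow> derivation (\<lambda>F. - D F)"
  by (simp add: derivation_def algebra_simps)

text \<open>
  The commutator of two derivations is again a derivation, so it suffices to look at the indeterminates.
\<close>

lemma derivations_commute:
  assumes D: "derivation D" "derivation D'"
    and gen: "\<And>i. D (D' (indet i)) = D' (D (indet i))"
  shows "D (D' F) = D' (D F)"
proof (induction F rule: cpoly_induct)
  case (mult i F)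
  then show ?case by (simp add: D derivation_add derivation_mult gen add_ac)
qed (simp_all add: D derivation_const derivation_0 derivation_add)

lemma pderiv_at_superset:
  assumes "finite S" "Poly_Mapping.keys F \<subseteq> S"
  shows "pderiv_at i F = (\<Sum>m\<in>S. Poly_Mapping.single (m - Poly_Mapping.single i 1)
       (of_nat (Poly_Mapping.lookup m i) * Poly_Mapping.lookup F m))"
  unfolding pderiv_at_def by (rule sum.mono_neutral_left) (use assms in \<open>auto simp: in_keys_iff\<close>)

lemma pderiv_at_add: "pderiv_at i (F + G) = pderiv_at i F + pderiv_at i G"
proof -
  let ?S = "Poly_Mapping.keys F \<union> Poly_Mapping.keys G"
  have "finite ?S" "Poly_Mapping.keys (F + G) \<subseteq> ?S" using keys_add[of F G] by auto
  then show ?thesis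
    by (simp add: pderiv_at_superset[of ?S] lookup_add ring_distribs single_add sum.distrib)
qed

lemma pderiv_at_single: "pderiv_at i (Poly_Mapping.single m a)
    = Poly_Mapping.single (m - Poly_Mapping.single i 1) (of_nat (Poly_Mapping.lookup m i) * a)"
  by (subst pderiv_at_superset[of "{m}"]) auto

text \<open>
  Subtraction of exponents is truncated; it is harmless because a vanishing exponent makes the
  coefficient vanish.
\<close>

lemma pderiv_at_mult_single:
  "pderiv_at i (Poly_Mapping.single m a * Poly_Mapping.single n b)
    = pderiv_at i (Poly_Mapping.single m a) * Poly_Mapping.single n b
      + Poly_Mapping.single m a * pderiv_at i (Poly_Mapping.single n b)"
proof -
  let ?e = "Poly_Mapping.single i (1::nat)"
  have 1: "Poly_Mapping.single (m - ?e + n) (of_nat (Poly_Mapping.lookup m i) * a * b)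
      = Poly_Mapping.single (m + n - ?e) (of_nat (Poly_Mapping.lookup m i) * a * b)"
    (is "Poly_Mapping.single _ ?c = _")
  proof (cases "Poly_Mapping.lookup m i = 0")
    case False
    then have "m - ?e + n = m + n - ?e"
      by (intro poly_mapping_eqI) (auto simp: lookup_add lookup_minus lookup_single when_def)
    then show ?thesis by simp
  qed simp
  have 2: "Poly_Mapping.single (m + (n - ?e)) (a * (of_nat (Poly_Mapping.lookup n i) * b))
      = Poly_Mapping.single (m + n - ?e) (a * (of_nat (Poly_Mapping.lookup n i) * b))"
  proof (cases "Poly_Mapping.lookup n i = 0")
    case False
    then have "m + (n - ?e) = m + n - ?e"
      by (intro poly_mapping_eqI) (auto simp: lookup_add lookup_minus lookup_single when_def)
    then show ?thesis by simp
  qed simp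
  show ?thesis
    unfolding pderiv_at_single mult_single 1 2 single_add[symmetric]
    by (simp add: lookup_add algebra_simps)
qed

lemma derivation_pderiv_at: "derivation (pderiv_at i)"
  unfolding derivation_def
proof (intro conjI allI)
  show "pderiv_at i (F * G) = pderiv_at i F * G + F * pderiv_at i G" for F G
  proof (induction F rule: cpoly_monomial_induct)
    case (single m a)
    show ?case
    proof (induction G rule: cpoly_monomial_induct)
      case (single n b)
      show ?case by (rule pderiv_at_mult_single)
    next
      case (add F G)
      then show ?case by (simp add: distrib_left pderiv_at_add add_ac)
    qed
  next
    case (add F G)
    then show ?case by (simp add: distrib_right pderiv_at_add add_ac)
  qed
qed (simp_all add: pderiv_at_add const_def pderiv_at_single)

lemma pderiv_at_indet: "pderiv_at i (indet j) = (if i = j then 1 else 0)"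
  by (simp add: indet_def pderiv_at_single lookup_single when_def)

lemma substitute_superset:
  assumes "finite S" "Poly_Mapping.keys F \<subseteq> S"
  shows "substitute g F = (\<Sum>m\<in>S. const (Poly_Mapping.lookup F m) *
     (\<Prod>i\<in>Poly_Mapping.keys m. g i ^ Poly_Mapping.lookup m i))"
  unfolding substitute_def by (rule sum.mono_neutral_left) (use assms in \<open>auto simp: in_keys_iff\<close>)

lemma substitute_add: "substitute g (F + G) = substitute g F + substitute g G"
proof -
  let ?S = "Poly_Mapping.keys F \<union> Poly_Mapping.keys G"
  have "finite ?S" "Poly_Mapping.keys (F + G) \<subseteq> ?S" using keys_add[of F G] by auto
  then show ?thesis
    by (simp add: substitute_superset[of ?S] lookup_add ring_distribs const_add sum.distrib)
qed

lemma substitute_single: "substitute g (Poly_Mapping.single m a)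
    = const a * (\<Prod>i\<in>Poly_Mapping.keys m. g i ^ Poly_Mapping.lookup m i)"
  by (subst substitute_superset[of "{m}"]) auto

lemma substitute_const: "substitute g (const c) = const c"
  unfolding const_def[of c] substitute_single by (simp add: const_def)

lemma substitute_indet: "substitute g (indet i) = g i"
  by (simp add: indet_def substitute_single)

lemma substitute_mult: "substitute g (F * G) = substitute g F * substitute g G"
proof (induction F rule: cpoly_monomial_induct)
  case (single m a)
  show ?case
  proof (induction G rule: cpoly_monomial_induct)
    case (single n b)
    let ?S = "Poly_Mapping.keys m \<union> Poly_Mapping.keys n"
    have ext: "(\<Prod>i\<in>Poly_Mapping.keys k. g i ^ Poly_Mapping.lookup k i) = (\<Prod>i\<in>?S. g i ^ Poly_Mapping.lookup k i)"
      if "Poly_Mapping.keys k \<subseteq> ?S" for k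
      using that by (intro prod.mono_neutral_left) (auto simp: in_keys_iff)
    have "(\<Prod>i\<in>Poly_Mapping.keys (m + n). g i ^ Poly_Mapping.lookup (m + n) i)
        = (\<Prod>i\<in>?S. g i ^ Poly_Mapping.lookup m i) * (\<Prod>i\<in>?S. g i ^ Poly_Mapping.lookup n i)"
      by (subst ext[OF keys_add]) (simp add: lookup_add power_add prod.distrib)
    also have "\<dots> = (\<Prod>i\<in>Poly_Mapping.keys m. g i ^ Poly_Mapping.lookup m i) *
        (\<Prod>i\<in>Poly_Mapping.keys n. g i ^ Poly_Mapping.lookup n i)"
      by (subst (1 2) ext) auto
    finally show ?case by (simp add: mult_single substitute_single const_mult mult_ac)
  next
    case (add F G)
    then show ?case by (simp add: distrib_left substitute_add)
  qed
next
  case (add F G)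
  then show ?case by (simp add: distrib_right substitute_add)
qed

section \<open>Exponentials of multiplications and of derivations\<close>

lemma op_pow_mult:
  fixes c :: "nat \<Rightarrow> 'i cpoly"
  shows "op_pow (\<lambda>m F. c m * F) k j F
    = fps_nth (Abs_fps (\<lambda>m. if m = 0 then 0 else c m) ^ k) j * F"
proof (induction k arbitrary: j)
  case (Suc k)
  let ?P = "Abs_fps (\<lambda>m. if m = 0 then 0 else c m)"
  have "fps_nth (?P ^ Suc k) j = (\<Sum>n=0..j. fps_nth ?P n * fps_nth (?P ^ k) (j - n))"
    by (simp only: power_Suc fps_mult_nth)
  also have "\<dots> = (\<Sum>n=1..j. c n * fps_nth (?P ^ k) (j - n))"
    by (rule sum.mono_neutral_cong_right) auto
  finally show ?case by (simp add: Suc sum_distrib_right mult.assoc)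
qed simp

lemma op_exp_mult: "op_exp (\<lambda>m F. c m * F) j F = op_exp (\<lambda>m F. c m * F) j 1 * F"
  by (simp add: op_exp_def op_pow_mult sum_distrib_right mult.assoc)

lemma op_exp_0: "op_exp D 0 F = F"
  by (simp add: op_exp_def)

text \<open>
  With \<open>E = exp P\<close> and \<open>P = \<Sum> c\<^sub>m z\<^sup>m\<close> this is the equation \<open>z E' = (z P') E\<close>.  It determines \<open>E\<close> from \<open>P\<close>
  and is the only property of the creation exponentials that the commutation relations use.
\<close>

lemma op_exp_mult_newton:
  fixes c :: "nat \<Rightarrow> 'i cpoly"
  defines "e \<equiv> \<lambda>j. op_exp (\<lambda>m F. c m * F) j 1"
  shows "of_nat j * e j = (\<Sum>r=1..j. of_nat r * c r * e (j - r))"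
proof -
  let ?P = "Abs_fps (\<lambda>m. if m = 0 then 0 else c m)"
  define u where "u k i = const (1 / fact k) * fps_nth (?P ^ k) i" for k i
  have small: "fps_nth (?P ^ k) i = 0" if "i < k" for k i
    using that by (intro startsby_zero_power_prefix[rule_format]) auto
  have e: "e i = (\<Sum>k\<le>n. u k i)" if "i \<le> n" for i n
  proof -
    have "e i = (\<Sum>k\<le>i. u k i)" by (simp add: e_def op_exp_def op_pow_mult u_def)
    also have "\<dots> = (\<Sum>k\<le>n. u k i)"
      using that by (intro sum.mono_neutral_left) (auto simp: u_def small)
    finally show ?thesis .
  qed
  have step: "of_nat i * u (Suc k) i = (\<Sum>r=1..i. of_nat r * c r * u k (i - r))" for i k
  proof (cases i)
    case (Suc l)
    have "of_nat i * fps_nth (?P ^ Suc k) i = fps_nth (fps_deriv (?P ^ Suc k)) l"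
      by (simp only: Suc fps_deriv_nth Suc_eq_plus1)
    also have "fps_deriv (?P ^ Suc k) = of_nat (Suc k) * (fps_deriv ?P * ?P ^ k)"
      by (simp only: fps_deriv_power diff_Suc_1 fps_of_nat mult.assoc)
    also have "fps_nth (of_nat (Suc k) * (fps_deriv ?P * ?P ^ k)) l
        = of_nat (Suc k) * (\<Sum>r=0..l. fps_nth (fps_deriv ?P) r * fps_nth (?P ^ k) (l - r))"
      by (simp only: fps_of_nat[symmetric] fps_mult_left_const_nth) (simp only: fps_mult_nth)
    also have "(\<Sum>r=0..l. fps_nth (fps_deriv ?P) r * fps_nth (?P ^ k) (l - r))
        = (\<Sum>r=1..i. of_nat r * c r * fps_nth (?P ^ k) (i - r))"
      by (rule sum.reindex_bij_witness[of _ "\<lambda>r. r - 1" Suc]) (auto simp: Suc)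
    finally have 1: "of_nat i * fps_nth (?P ^ Suc k) i
        = of_nat (Suc k) * (\<Sum>r=1..i. of_nat r * c r * fps_nth (?P ^ k) (i - r))" .
    have 2: "const (1 / fact (Suc k)) * of_nat (Suc k) = const (1 / fact k)"
      by (simp only: const_of_nat[symmetric] const_mult[symmetric]) (simp add: fact_Suc del: of_nat_Suc)
    have "of_nat i * u (Suc k) i = const (1 / fact (Suc k)) * (of_nat i * fps_nth (?P ^ Suc k) i)"
      by (simp only: u_def mult.left_commute)
    also have "\<dots> = const (1 / fact k) * (\<Sum>r=1..i. of_nat r * c r * fps_nth (?P ^ k) (i - r))"
      by (simp only: 1 mult.assoc[symmetric] 2)
    also have "\<dots> = (\<Sum>r=1..i. of_nat r * c r * u k (i - r))"
      by (simp only: u_def sum_distrib_left mult.left_commute)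
    finally show ?thesis .
  qed simp
  have "of_nat j * e j = of_nat j * (\<Sum>k\<le>Suc j. u k j)" by (subst e[of j "Suc j"]) simp_all
  also have "\<dots> = of_nat j * u 0 j + (\<Sum>k\<le>j. of_nat j * u (Suc k) j)"
    by (simp only: sum.atMost_Suc_shift distrib_left sum_distrib_left)
  also have "of_nat j * u 0 j = 0" by (cases j) (simp_all add: u_def)
  also have "(\<Sum>k\<le>j. of_nat j * u (Suc k) j) = (\<Sum>r=1..j. of_nat r * c r * (\<Sum>k\<le>j. u k (j - r)))"
    by (simp only: step sum_distrib_left) (rule sum.swap)
  also have "\<dots> = (\<Sum>r=1..j. of_nat r * c r * e (j - r))"
    by (intro sum.cong refl) (simp add: e[symmetric])
  finally show ?thesis by simp
qed

text \<open>
  The operator \<open>\<Sum>n\<ge>1. D n z\<^sup>n\<close> on power series in \<open>z\<close>; its iterates encode \<open>op_pow\<close>, and it is itself a derivation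
  if all \<open>D n\<close> are.
\<close>

definition op_fps :: "(nat \<Rightarrow> 'i cpoly \<Rightarrow> 'i cpoly) \<Rightarrow> 'i cpoly fps \<Rightarrow> 'i cpoly fps" where
  "op_fps D f = Abs_fps (\<lambda>j. \<Sum>n=1..j. D n (fps_nth f (j - n)))"

lemma op_pow_fps: "op_pow D k j F = fps_nth ((op_fps D ^^ k) (fps_const F)) j"
  by (induction k arbitrary: j) (simp_all add: op_fps_def)

text \<open>
  The coefficient at \<open>j\<close> depends only on \<open>D 1, \<dots>, D j\<close>, and the finite sum of the derivations
  \<open>z\<^sup>n (D n)\<close> satisfies the product rule.
\<close>

lemma op_fps_mult:
  assumes D: "\<And>n. n \<ge> 1 \<Longrightarrow> derivation (D n)"
  shows "op_fps D (f * g) = op_fps D f * g + f * op_fps D g"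
proof (rule fps_ext)
  fix j
  define M where "M n h = fps_X ^ n * Abs_fps (\<lambda>i. D n (fps_nth h i))" for n h
  have M_nth: "fps_nth (M n h) i = (if i < n then 0 else D n (fps_nth h (i - n)))" for n h i
    by (simp add: M_def fps_X_power_mult_nth)
  have "Abs_fps (\<lambda>i. D n (fps_nth (f * g) i))
      = Abs_fps (\<lambda>i. D n (fps_nth f i)) * g + f * Abs_fps (\<lambda>i. D n (fps_nth g i))" if "n \<ge> 1" for n
    by (rule fps_ext) (simp add: fps_mult_nth derivation_sum[OF D[OF that]]
      derivation_mult[OF D[OF that]] sum.distrib)
  then have M_mult: "M n (f * g) = M n f * g + f * M n g" if "n \<ge> 1" for n
    using that by (simp add: M_def algebra_simps)
  have nth: "fps_nth (op_fps D h) i = fps_nth (\<Sum>n=1..j. M n h) i" if "i \<le> j" for h i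
  proof -
    have "fps_nth (\<Sum>n=1..j. M n h) i = (\<Sum>n=1..j. if i < n then 0 else D n (fps_nth h (i - n)))"
      by (simp add: fps_sum_nth M_nth)
    also have "\<dots> = (\<Sum>n=1..i. D n (fps_nth h (i - n)))"
      using that by (intro sum.mono_neutral_cong_right) auto
    finally show ?thesis by (simp add: op_fps_def)
  qed
  have "fps_nth (op_fps D (f * g)) j = fps_nth ((\<Sum>n=1..j. M n f) * g + f * (\<Sum>n=1..j. M n g)) j"
    by (simp add: nth M_mult sum.distrib sum_distrib_left sum_distrib_right)
  also have "\<dots> = fps_nth (op_fps D f * g + f * op_fps D g) j"
    by (simp add: fps_mult_nth nth)
  finally show "fps_nth (op_fps D (f * g)) j = fps_nth (op_fps D f * g + f * op_fps D g) j" .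
qed

lemma op_fps_add:
  assumes D: "\<And>n. n \<ge> 1 \<Longrightarrow> derivation (D n)"
  shows "op_fps D (f + g) = op_fps D f + op_fps D g"
  by (rule fps_ext) (simp add: op_fps_def derivation_add[OF D] sum.distrib)

lemma op_fps_0:
  assumes D: "\<And>n. n \<ge> 1 \<Longrightarrow> derivation (D n)"
  shows "op_fps D 0 = 0"
  by (rule fps_ext) (simp add: op_fps_def derivation_0[OF D])

lemma op_fps_sum:
  assumes D: "\<And>n. n \<ge> 1 \<Longrightarrow> derivation (D n)"
  shows "op_fps D (\<Sum>i\<in>A. f i) = (\<Sum>i\<in>A. op_fps D (f i))"
  by (induction A rule: infinite_finite_induct) (simp_all add: op_fps_0[OF D] op_fps_add[OF D])

lemma op_fps_scale:
  assumes D: "\<And>n. n \<ge> 1 \<Longrightarrow> derivation (D n)"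
  shows "op_fps D (fps_const (const c) * f) = fps_const (const c) * op_fps D f"
  by (rule fps_ext) (simp add: op_fps_def derivation_const_mult[OF D] sum_distrib_left)

lemma op_fps_funpow_small:
  assumes D: "\<And>n. n \<ge> 1 \<Longrightarrow> derivation (D n)" and "j < k"
  shows "fps_nth ((op_fps D ^^ k) f) j = 0"
  using \<open>j < k\<close>
proof (induction k arbitrary: j)
  case (Suc k)
  then show ?case by (auto simp: op_fps_def derivation_0[OF D] intro!: sum.neutral)
qed simp

definition op_exp_fps :: "(nat \<Rightarrow> 'i cpoly \<Rightarrow> 'i cpoly) \<Rightarrow> 'i cpoly \<Rightarrow> 'i cpoly fps" where
  "op_exp_fps D F = Abs_fps (\<lambda>j. op_exp D j F)"

lemma op_exp_fps_nth [simp]: "fps_nth (op_exp_fps D F) j = op_exp D j F"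
  by (simp add: op_exp_fps_def)

lemma op_exp_fps_add:
  assumes D: "\<And>n. n \<ge> 1 \<Longrightarrow> derivation (D n)"
  shows "op_exp_fps D (F + G) = op_exp_fps D F + op_exp_fps D G"
proof (rule fps_ext)
  have "(op_fps D ^^ k) (f + g) = (op_fps D ^^ k) f + (op_fps D ^^ k) g" for k f g
    by (induction k) (simp_all add: op_fps_add[OF D])
  then show "fps_nth (op_exp_fps D (F + G)) j = fps_nth (op_exp_fps D F + op_exp_fps D G) j" for j
    by (simp add: op_exp_def op_pow_fps fps_const_add[symmetric] distrib_left sum.distrib del: fps_const_add)
qed

lemma op_exp_fps_const:
  assumes D: "\<And>n. n \<ge> 1 \<Longrightarrow> derivation (D n)"
  shows "op_exp_fps D (const c) = fps_const (const c)"
proof (rule fps_ext)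
  fix j
  have 0: "op_fps D (fps_const (const c)) = 0"
    by (rule fps_ext) (auto simp: op_fps_def derivation_0[OF D] derivation_const[OF D] intro!: sum.neutral)
  have "(op_fps D ^^ Suc k) (fps_const (const c)) = 0" for k
    by (induction k) (simp_all add: 0 op_fps_0[OF D])
  then have "op_pow D k j (const c) = (if k = 0 then op_pow D 0 j (const c) else 0)" for k
    by (cases k) (simp_all only: op_pow_fps fps_zero_nth if_True if_False nat.distinct simp_thms)
  then have "op_exp D j (const c) = (\<Sum>k\<le>j. if k = 0 then op_pow D 0 j (const c) else 0)"
    unfolding op_exp_def by (intro sum.cong refl) (metis const_1 div_by_1 fact_0 mult_1 mult_zero_right)
  then show "fps_nth (op_exp_fps D (const c)) j = fps_nth (fps_const (const c)) j"
    by simp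
qed

text \<open>
  The exponential of a derivation is a ring homomorphism.  For the divided powers
  \<open>u k = \<Delta>\<^sup>k / k!\<close> of \<open>\<Delta> = op_fps D\<close> the Leibniz rule takes the form of a convolution without binomial
  coefficients, which follows by induction from \<open>\<Delta> (u k) = (k + 1) u (k + 1)\<close>.
\<close>

lemma op_exp_fps_mult:
  assumes D: "\<And>n. n \<ge> 1 \<Longrightarrow> derivation (D n)"
  shows "op_exp_fps D (F * G) = op_exp_fps D F * op_exp_fps D G"
proof (rule fps_ext)
  fix j
  define u where "u F k = fps_const (const (1 / fact k)) * (op_fps D ^^ k) (fps_const F)" for F k
  have u_Suc: "op_fps D (u F k) = of_nat (Suc k) * u F (Suc k)" for F k
  proof -
    have "const (1 / fact k) = (of_nat (Suc k) * const (1 / fact (Suc k)) :: 'a cpoly)"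
      by (simp only: const_of_nat[symmetric] const_mult[symmetric]) (simp add: fact_Suc del: of_nat_Suc)
    then have 1: "fps_const (const (1 / fact k)) = of_nat (Suc k) * fps_const (const (1 / fact (Suc k)) :: 'a cpoly)"
      by (simp only: fps_of_nat[symmetric] fps_const_mult)
    have "op_fps D (u F k) = fps_const (const (1 / fact k)) * op_fps D ((op_fps D ^^ k) (fps_const F))"
      unfolding u_def by (rule op_fps_scale[OF D])
    then show ?thesis unfolding 1 by (simp only: u_def mult.assoc funpow.simps o_apply)
  qed
  have leibniz: "u (F * G) k = (\<Sum>a\<le>k. u F a * u G (k - a))" for k
  proof (induction k)
    case (Suc k)
    let ?S = "\<Sum>a\<le>Suc k. u F a * u G (Suc k - a)"
    have "of_nat (Suc k) * u (F * G) (Suc k) = op_fps D (\<Sum>a\<le>k. u F a * u G (k - a))"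
      by (simp only: u_Suc[symmetric] Suc)
    also have "\<dots> = (\<Sum>a\<le>k. of_nat (Suc a) * u F (Suc a) * u G (k - a))
        + (\<Sum>a\<le>k. u F a * (of_nat (Suc (k - a)) * u G (Suc (k - a))))"
      by (simp only: op_fps_sum[OF D] op_fps_mult[OF D] u_Suc sum.distrib)
    also have "(\<Sum>a\<le>k. of_nat (Suc a) * u F (Suc a) * u G (k - a))
        = (\<Sum>a\<le>Suc k. of_nat a * (u F a * u G (Suc k - a)))"
      by (subst sum.atMost_Suc_shift) (simp add: mult.assoc)
    also have "(\<Sum>a\<le>k. u F a * (of_nat (Suc (k - a)) * u G (Suc (k - a))))
        = (\<Sum>a\<le>Suc k. of_nat (Suc k - a) * (u F a * u G (Suc k - a)))"
      by (simp add: Suc_diff_le mult.left_commute del: of_nat_Suc of_nat_diff)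
    also have "(\<Sum>a\<le>Suc k. of_nat a * (u F a * u G (Suc k - a)))
        + (\<Sum>a\<le>Suc k. of_nat (Suc k - a) * (u F a * u G (Suc k - a)))
        = (\<Sum>a\<le>Suc k. (of_nat a + of_nat (Suc k - a)) * (u F a * u G (Suc k - a)))"
      by (simp only: distrib_right sum.distrib)
    also have "\<dots> = (\<Sum>a\<le>Suc k. of_nat (Suc k) * (u F a * u G (Suc k - a)))"
      by (intro sum.cong refl) (simp only: of_nat_add[symmetric] atMost_iff le_add_diff_inverse)
    also have "\<dots> = of_nat (Suc k) * ?S" by (simp only: sum_distrib_left)
    finally have eq: "of_nat (Suc k) * u (F * G) (Suc k) = of_nat (Suc k) * ?S" .
    have inv: "fps_const (const (1 / of_nat (Suc k))) * (of_nat (Suc k) * f) = f" for f :: "'a cpoly fps"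
      by (simp add: mult.assoc[symmetric] fps_of_nat[symmetric] const_of_nat[symmetric] const_mult[symmetric]
        del: of_nat_Suc)
    show ?case using arg_cong[OF eq, of "\<lambda>f. fps_const (const (1 / of_nat (Suc k))) * f"] by (simp only: inv)
  qed (simp add: u_def)
  have small: "fps_nth (u F k) i = 0" if "i < k" for F k i
    using op_fps_funpow_small[OF D that] by (simp add: u_def)
  \<comment> \<open>Since \<open>u F k\<close> has no terms below degree \<open>k\<close>, all sums over \<open>k\<close> may be extended to the common range \<open>k \<le> j\<close>.\<close>
  have exp: "op_exp D i F = (\<Sum>k\<le>j. fps_nth (u F k) i)" if "i \<le> j" for F i
  proof -
    have "op_exp D i F = (\<Sum>k\<le>i. fps_nth (u F k) i)" by (simp add: op_exp_def op_pow_fps u_def)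
    also have "\<dots> = (\<Sum>k\<le>j. fps_nth (u F k) i)"
      using that by (intro sum.mono_neutral_left) (auto simp: small)
    finally show ?thesis .
  qed
  have "fps_nth (op_exp_fps D F * op_exp_fps D G) j
      = (\<Sum>i=0..j. (\<Sum>a\<le>j. fps_nth (u F a) i) * (\<Sum>b\<le>j. fps_nth (u G b) (j - i)))"
    by (simp add: fps_mult_nth exp)
  also have "\<dots> = (\<Sum>i=0..j. \<Sum>a\<le>j. \<Sum>b\<le>j. fps_nth (u F a) i * fps_nth (u G b) (j - i))"
    by (simp add: sum_product)
  also have "\<dots> = (\<Sum>a\<le>j. \<Sum>i=0..j. \<Sum>b\<le>j. fps_nth (u F a) i * fps_nth (u G b) (j - i))"
    by (rule sum.swap)
  also have "\<dots> = (\<Sum>a\<le>j. \<Sum>b\<le>j. \<Sum>i=0..j. fps_nth (u F a) i * fps_nth (u G b) (j - i))"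
    by (rule sum.cong[OF refl], rule sum.swap)
  also have "\<dots> = (\<Sum>a\<le>j. \<Sum>b\<le>j. fps_nth (u F a * u G b) j)"
    by (simp only: fps_mult_nth)
  also have "\<dots> = (\<Sum>(a, b)\<in>{..j} \<times> {..j}. fps_nth (u F a * u G b) j)"
    by (rule sum.cartesian_product)
  also have "\<dots> = (\<Sum>(a, b)\<in>{(a, b). a + b \<le> j}. fps_nth (u F a * u G b) j)"
  proof (rule sum.mono_neutral_right)
    show "\<forall>p\<in>{..j} \<times> {..j} - {(a, b). a + b \<le> j}. (case p of (a, b) \<Rightarrow> fps_nth (u F a * u G b) j) = 0"
    proof
      fix p assume "p \<in> {..j} \<times> {..j} - {(a, b). a + b \<le> j}"
      then obtain a b where p: "p = (a, b)" and ab: "\<not> a + b \<le> j" by auto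
      have "fps_nth (u F a) i * fps_nth (u G b) (j - i) = 0" if "i \<le> j" for i
        using ab that by (cases "i < a") (simp_all add: small)
      then show "(case p of (a, b) \<Rightarrow> fps_nth (u F a * u G b) j) = 0" by (simp add: p fps_mult_nth)
    qed
  qed auto
  also have "\<dots> = (\<Sum>k\<le>j. \<Sum>a\<le>k. fps_nth (u F a * u G (k - a)) j)"
    by (rule sum.triangle_reindex_eq)
  also have "\<dots> = (\<Sum>k\<le>j. fps_nth (u (F * G) k) j)" by (simp add: leibniz fps_sum_nth)
  also have "\<dots> = fps_nth (op_exp_fps D (F * G)) j" by (simp add: exp)
  finally show "fps_nth (op_exp_fps D (F * G)) j = fps_nth (op_exp_fps D F * op_exp_fps D G) j" ..
qed

lemma op_exp_fps_linear:
  assumes D: "\<And>n. n \<ge> 1 \<Longrightarrow> derivation (D n)"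
    and lin: "\<And>n m. n \<ge> 1 \<Longrightarrow> m \<ge> 1 \<Longrightarrow> D n (D m F) = 0"
  shows "op_exp_fps D F = fps_const F + Abs_fps (\<lambda>j. if j = 0 then 0 else D j F)"
proof (rule fps_ext)
  fix j
  have 1: "op_pow D 1 i F = (if i = 0 then 0 else D i F)" for i
  proof -
    have "op_pow D 1 i F = (\<Sum>n=1..i. D n (if i - n = 0 then F else 0))" by simp
    also have "\<dots> = (\<Sum>n=1..i. if n = i then D n F else 0)"
      by (intro sum.cong refl) (auto simp: derivation_0[OF D])
    also have "\<dots> = (if i = 0 then 0 else D i F)" by simp
    finally show ?thesis .
  qed
  have 2: "op_pow D (Suc (Suc k)) i F = 0" for i k
  proof (induction k arbitrary: i)
    case 0
    have "op_pow D (Suc 1) i F = (\<Sum>n=1..i. D n (if i - n = 0 then 0 else D (i - n) F))"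
      by (simp only: op_pow.simps 1)
    also have "\<dots> = 0"
    proof (intro sum.neutral ballI)
      fix n assume "n \<in> {1..i}"
      then show "D n (if i - n = 0 then 0 else D (i - n) F) = 0"
        using lin[of n "i - n"] derivation_0[OF D, of n] by (cases "i - n = 0") auto
    qed
    finally show ?case by simp
  next
    case (Suc k)
    show ?case by (subst op_pow.simps) (simp add: Suc derivation_0[OF D] del: op_pow.simps)
  qed
  show "fps_nth (op_exp_fps D F) j = fps_nth (fps_const F + Abs_fps (\<lambda>j. if j = 0 then 0 else D j F)) j"
  proof (cases j)
    case (Suc l)
    have "op_exp D j F = const (1 / fact 0) * op_pow D 0 j F + (const (1 / fact (Suc 0)) * op_pow D (Suc 0) j F
        + (\<Sum>k<l. const (1 / fact (Suc (Suc k))) * op_pow D (Suc (Suc k)) j F))"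
      unfolding op_exp_def Suc lessThan_Suc_atMost[symmetric] sum.lessThan_Suc_shift by (simp only: o_def)
    also have "\<dots> = D j F" using 1[of j] Suc by (simp add: 2 del: op_pow.simps(2))
    finally show ?thesis using Suc by simp
  qed (simp add: op_exp_0)
qed

lemma op_pow_commute:
  assumes D: "\<And>n. n \<ge> 1 \<Longrightarrow> derivation (D n)"
    and C: "\<And>F G. C (F + G) = C F + C G" "C 0 = 0" "\<And>n F. n \<ge> 1 \<Longrightarrow> C (D n F) = D n (C F)"
  shows "C (op_pow D k j F) = op_pow D k j (C F)"
proof (induction k arbitrary: j)
  case (Suc k)
  have sum: "C (\<Sum>i\<in>A. f i) = (\<Sum>i\<in>A. C (f i))" for A :: "nat set" and f
    by (induction A rule: infinite_finite_induct) (simp_all add: C)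
  show ?case by (simp add: sum C Suc)
qed (simp add: C)

lemma op_exp_commute:
  assumes D: "\<And>n. n \<ge> 1 \<Longrightarrow> derivation (D n)"
    and C: "\<And>F G. C (F + G) = C F + C G" "\<And>c F. C (const c * F) = const c * C F"
      "\<And>n F. n \<ge> 1 \<Longrightarrow> C (D n F) = D n (C F)"
  shows "C (op_exp D j F) = op_exp D j (C F)"
proof -
  have C0: "C 0 = 0" using C(2)[of 0 0] by simp
  have sum: "C (\<Sum>i\<in>A. f i) = (\<Sum>i\<in>A. C (f i))" for A :: "nat set" and f
    by (induction A rule: infinite_finite_induct) (simp_all add: C C0)
  show ?thesis by (simp add: op_exp_def sum C(2) op_pow_commute[of D C, OF D C(1) C0 C(3)])
qed

lemma fps_cpoly_of_nat_cancel:
  fixes f g :: "'i cpoly fps"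
  assumes "of_nat (Suc k) * f = of_nat (Suc k) * g"
  shows "f = g"
proof -
  have inv: "fps_const (const (1 / of_nat (Suc k))) * (of_nat (Suc k) * f) = f" for f :: "'i cpoly fps"
    by (simp add: mult.assoc[symmetric] fps_of_nat[symmetric] const_of_nat[symmetric] const_mult[symmetric]
      del: of_nat_Suc)
  show ?thesis
    using arg_cong[OF assms, of "\<lambda>f. fps_const (const (1 / of_nat (Suc k))) * f"] by (simp only: inv)
qed

lemma op_exp_fps_sum:
  assumes D: "\<And>n. n \<ge> 1 \<Longrightarrow> derivation (D n)"
  shows "op_exp_fps D (\<Sum>i\<in>A. f i) = (\<Sum>i\<in>A. op_exp_fps D (f i))"
proof -
  have "op_exp_fps D 0 = 0" using op_exp_fps_const[where D = D and c = 0, OF D] by simp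
  then show ?thesis
    by (induction A rule: infinite_finite_induct) (simp_all add: op_exp_fps_add[OF D])
qed

lemma fps_const_sum_hom: "fps_const (\<Sum>i\<in>A. f i) = (\<Sum>i\<in>A. fps_const (f i))"
  for f :: "'b \<Rightarrow> 'c::ring_1"
  by (rule fps_ext) (simp add: fps_sum_nth)

text \<open>
  How \<open>T = exp D\<close> acts on a creation exponential.  Suppose \<open>E = \<Sum> e j z\<^sup>j\<close> and \<open>B = \<Sum> b r z\<^sup>r\<close> satisfy
  \<open>z E' = B E\<close> and \<open>T\<close> changes \<open>B\<close> by the logarithmic derivative \<open>- d v z\<^sup>d / (1 - v z\<^sup>d)\<close> of \<open>1 - v z\<^sup>d\<close>.  Then
  \<open>T E\<close> and \<open>(1 - v z\<^sup>d) E\<close> satisfy the same differential equation, so they are equal.  The proof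
  compares coefficients.
\<close>

lemma op_exp_fps_newton:
  fixes e b :: "nat \<Rightarrow> 'i cpoly" and v :: "'i cpoly fps"
  assumes D: "\<And>n. n \<ge> 1 \<Longrightarrow> derivation (D n)"
    and e: "e 0 = 1" "\<And>j. of_nat j * e j = (\<Sum>r=1..j. b r * e (j - r))"
    and d: "d > 0"
    and b: "\<And>r. r \<ge> 1 \<Longrightarrow> op_exp_fps D (b r)
      = fps_const (b r) - (if d dvd r then of_nat d * v ^ (r div d) else 0)"
  shows "op_exp_fps D (e j) = fps_const (e j) - (if d \<le> j then v * fps_const (e (j - d)) else 0)"
proof (induction j rule: less_induct)
  case (less j)
  define \<beta> where "\<beta> r = (if d dvd r then of_nat d * v ^ (r div d) else 0)" for r
  define w where "w i = (if d \<le> i then v * fps_const (e (i - d)) else 0)" for i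
  have \<beta>_shift: "\<beta> (r + d) = v * \<beta> r" for r
    using d by (simp add: \<beta>_def algebra_simps)
  have \<beta>_small: "\<beta> r = 0" if "0 < r" "r < d" for r
    using that by (auto simp: \<beta>_def dest: dvd_imp_le)
  have \<beta>_d: "\<beta> d = of_nat d * v" using d by (simp add: \<beta>_def)
  show ?case
  proof (cases j)
    case 0
    then show ?thesis using d op_exp_fps_const[where D = D and c = 1, OF D] by (simp add: e)
  next
    case (Suc l)
    have ofn: "op_exp_fps D (of_nat n) = of_nat n" for n
      using op_exp_fps_const[where D = D and c = "of_nat n", OF D] by (simp add: const_of_nat fps_of_nat)
    have const_e: "(\<Sum>r=1..i. fps_const (b r) * fps_const (e (i - r))) = of_nat i * fps_const (e i)" for i
    proof -
      have "(\<Sum>r=1..i. fps_const (b r) * fps_const (e (i - r))) = fps_const (\<Sum>r=1..i. b r * e (i - r))"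
        by (simp add: fps_const_sum_hom)
      also have "\<dots> = fps_const (of_nat i * e i)" by (simp only: e(2))
      also have "\<dots> = of_nat i * fps_const (e i)" by (simp only: fps_of_nat[symmetric] fps_const_mult)
      finally show ?thesis .
    qed
    have "of_nat j * op_exp_fps D (e j) = op_exp_fps D (of_nat j * e j)"
      by (simp only: op_exp_fps_mult[OF D] ofn)
    also have "\<dots> = (\<Sum>r=1..j. op_exp_fps D (b r) * op_exp_fps D (e (j - r)))"
      by (simp only: e(2) op_exp_fps_sum[OF D] op_exp_fps_mult[OF D])
    also have "\<dots> = (\<Sum>r=1..j. (fps_const (b r) - \<beta> r) * (fps_const (e (j - r)) - w (j - r)))"
      using Suc by (intro sum.cong refl) (simp add: b less \<beta>_def w_def)
    also have "\<dots> = (\<Sum>r=1..j. fps_const (b r) * fps_const (e (j - r)))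
        - (\<Sum>r=1..j. fps_const (b r) * w (j - r))
        - ((\<Sum>r=1..j. \<beta> r * fps_const (e (j - r))) - (\<Sum>r=1..j. \<beta> r * w (j - r)))"
      unfolding sum_subtractf[symmetric] by (intro sum.cong refl) (simp only: algebra_simps)
    also have "\<dots> = of_nat j * (fps_const (e j) - w j)"
    proof (cases "d \<le> j")
      case True
      have range: "(\<Sum>r=1..j. f r * w (j - r)) = (\<Sum>r=1..j - d. f r * (v * fps_const (e (j - d - r))))" for f
      proof (rule sum.mono_neutral_cong_right)
        show "\<forall>r\<in>{1..j} - {1..j - d}. f r * w (j - r) = 0" using True by (auto simp: w_def)
        fix r assume "r \<in> {1..j - d}"
        then have "d \<le> j - r" "j - r - d = j - d - r" using True by auto
        then show "f r * w (j - r) = f r * (v * fps_const (e (j - d - r)))" by (simp only: w_def if_True)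
      qed auto
      have S2: "(\<Sum>r=1..j. fps_const (b r) * w (j - r)) = of_nat (j - d) * w j"
        unfolding range using const_e[of "j - d"] True
        by (simp only: mult.left_commute[of _ v] sum_distrib_left[symmetric] w_def if_True)
      \<comment> \<open>As \<open>\<beta>\<close> is geometric with step \<open>d\<close>, the two \<open>\<beta>\<close>-sums cancel except for the terms with \<open>r \<le> d\<close>.\<close>
      have "(\<Sum>r=1..j. \<beta> r * w (j - r)) = (\<Sum>r=1..j - d. \<beta> (r + d) * fps_const (e (j - (r + d))))"
        unfolding range by (intro sum.cong refl) (simp add: \<beta>_shift mult_ac add.commute)
      also have "\<dots> = (\<Sum>r=Suc d..j. \<beta> r * fps_const (e (j - r)))"
        by (rule sum.reindex_bij_witness[of _ "\<lambda>r. r - d" "\<lambda>r. r + d"]) (use True in auto)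
      finally have S4: "(\<Sum>r=1..j. \<beta> r * w (j - r)) = (\<Sum>r=Suc d..j. \<beta> r * fps_const (e (j - r)))" .
      have "(\<Sum>r=1..j. \<beta> r * fps_const (e (j - r)))
          = (\<Sum>r=1..d. \<beta> r * fps_const (e (j - r))) + (\<Sum>r=Suc d..j. \<beta> r * fps_const (e (j - r)))"
        using True d by (subst sum.union_disjoint[symmetric]) (auto intro!: sum.cong)
      also have "(\<Sum>r=1..d. \<beta> r * fps_const (e (j - r))) = (\<Sum>r\<in>{d}. \<beta> r * fps_const (e (j - r)))"
        using d by (intro sum.mono_neutral_right) (auto simp: \<beta>_small)
      also have "\<dots> = of_nat d * w j" using True by (simp add: \<beta>_d w_def mult.assoc)
      finally have S3: "(\<Sum>r=1..j. \<beta> r * fps_const (e (j - r))) - (\<Sum>r=1..j. \<beta> r * w (j - r)) = of_nat d * w j"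
        by (simp only: S4 add_diff_cancel_right')
      have "of_nat j = (of_nat (j - d) + of_nat d :: 'i cpoly fps)" using True by (simp flip: of_nat_add)
      then show ?thesis unfolding S2 S3 const_e by (simp only: algebra_simps)
    next
      case False
      then have "w (j - r) = 0" for r by (simp add: w_def)
      moreover have "(\<Sum>r=1..j. \<beta> r * fps_const (e (j - r))) = 0"
        using False by (intro sum.neutral) (auto simp: \<beta>_small)
      ultimately show ?thesis unfolding const_e using \<open>w (j - 0) = 0\<close> by simp
    qed
    finally have "of_nat (Suc l) * op_exp_fps D (e j) = of_nat (Suc l) * (fps_const (e j) - w j)"
      by (simp only: Suc)
    then show ?thesis by (simp only: w_def fps_cpoly_of_nat_cancel)
  qed
qed

text \<open>
  Coefficients at negative indices are zero.  Indexing by integers makes the shifts in the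
  commutation relations total, without side conditions on the indices.
\<close>

definition int_ext :: "(nat \<Rightarrow> 'b) \<Rightarrow> int \<Rightarrow> 'b::zero" where
  "int_ext e m = (if m < 0 then 0 else e (nat m))"

definition op_exp_int :: "(nat \<Rightarrow> 'i cpoly \<Rightarrow> 'i cpoly) \<Rightarrow> int \<Rightarrow> 'i cpoly \<Rightarrow> 'i cpoly" where
  "op_exp_int D a F = (if a < 0 then 0 else op_exp D (nat a) F)"

lemma op_exp_int_newton:
  fixes e b :: "nat \<Rightarrow> 'i cpoly"
  assumes D: "\<And>n. n \<ge> 1 \<Longrightarrow> derivation (D n)"
    and e: "e 0 = 1" "\<And>j. of_nat j * e j = (\<Sum>r=1..j. b r * e (j - r))"
    and d: "d > 0"
    and b: "\<And>r. r \<ge> 1 \<Longrightarrow> op_exp_fps D (b r) = fps_const (b r)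
      - (if d dvd r then of_nat d * (fps_const (const c) * fps_X ^ s) ^ (r div d) else 0)"
  shows "op_exp_int D a (int_ext e m * F)
    = int_ext e m * op_exp_int D a F - const c * int_ext e (m - int d) * op_exp_int D (a - int s) F"
proof (cases "m < 0 \<or> a < 0")
  case True
  have "op_exp_fps D 0 = 0" using op_exp_fps_const[where D = D and c = 0, OF D] by simp
  then have "op_exp D n 0 = 0" for n unfolding op_exp_fps_nth[symmetric] by (simp only: fps_zero_nth)
  with True show ?thesis by (auto simp: int_ext_def op_exp_int_def)
next
  case False
  then obtain m' a' where m: "m = int m'" and a: "a = int a'" by (metis nonneg_int_cases not_less)
  have mult: "op_exp_fps D (e m' * F) = op_exp_fps D (e m') * op_exp_fps D F"
    by (rule op_exp_fps_mult) (rule D)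
  have newton: "op_exp_fps D (e m') = fps_const (e m')
      - (if d \<le> m' then fps_const (const c) * fps_X ^ s * fps_const (e (m' - d)) else 0)"
    by (rule op_exp_fps_newton) (fact D e d b)+
  have "op_exp_fps D (e m' * F) = fps_const (e m') * op_exp_fps D F
      - (if d \<le> m' then fps_X ^ s * (fps_const (const c * e (m' - d)) * op_exp_fps D F) else 0)"
    unfolding mult newton by (simp add: algebra_simps flip: fps_const_mult)
  then have "op_exp D a' (e m' * F) = e m' * op_exp D a' F
      - (if d \<le> m' then if a' < s then 0 else const c * e (m' - d) * op_exp D (a' - s) F else 0)"
    unfolding op_exp_fps_nth[symmetric] by (simp add: fps_X_power_mult_nth)
  moreover have "op_exp_int D (int a' - int s) F = (if a' < s then 0 else op_exp D (a' - s) F)"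
    by (auto simp: op_exp_int_def nat_diff_distrib)
  moreover have "int_ext e (int m' - int d) = (if d \<le> m' then e (m' - d) else 0)"
    by (auto simp: int_ext_def nat_diff_distrib)
  ultimately show ?thesis by (simp add: m a int_ext_def[of e "int m'"] op_exp_int_def[of D "int a'"])
qed

section \<open>Exchanging two vertex operators\<close>

text \<open>
  The coefficient of \<open>z\<^sup>n\<close> in the product of the creation series \<open>\<Sum> H i z\<^sup>i\<close> and the annihilation series
  \<open>\<Sum> T b z\<^sup>-\<^sup>b\<close>.
\<close>

definition normal_op :: "(int \<Rightarrow> 'i cpoly) \<Rightarrow> (int \<Rightarrow> 'i cpoly \<Rightarrow> 'i cpoly) \<Rightarrow> int \<Rightarrow> 'i cpoly \<Rightarrow> 'i cpoly" where
  "normal_op H T n F = Sum_any (\<lambda>b. H (n + b) * T b F)"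

text \<open>
  The properties of an annihilation exponential \<open>\<Sum> T b z\<^sup>-\<^sup>b\<close> that make its products with creation series
  well defined.  Local finiteness ensures that \<open>normal_op\<close> is given by finite sums.
\<close>

locale annihilation =
  fixes T :: "int \<Rightarrow> 'i cpoly \<Rightarrow> 'i cpoly"
  assumes add: "T b (F + G) = T b F + T b G"
    and scale: "T b (const c * F) = const c * T b F"
    and neg: "b < 0 \<Longrightarrow> T b F = 0"
    and locally_finite: "\<exists>B. \<forall>b>B. T b F = 0"
    and one: "T b 1 = (if b = 0 then 1 else 0)"
begin

lemma zero: "T b 0 = 0"
  using scale[of b 0 0] by simp

lemma sum: "T b (\<Sum>i\<in>A. f i) = (\<Sum>i\<in>A. T b (f i))"
  by (induction A rule: infinite_finite_induct) (simp_all add: zero add)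

lemma normal_op_eq:
  assumes "\<And>b. b > B \<Longrightarrow> T b F = 0"
  shows "normal_op H T n F = (\<Sum>b\<in>{0..B}. H (n + b) * T b F)"
  unfolding normal_op_def
proof (rule Sum_any.expand_superset)
  show "{b. H (n + b) * T b F \<noteq> 0} \<subseteq> {0..B}"
  proof
    fix b assume "b \<in> {b. H (n + b) * T b F \<noteq> 0}"
    then have "T b F \<noteq> 0" by auto
    then show "b \<in> {0..B}" using assms neg by (metis atLeastAtMost_iff not_less)
  qed
qed simp

lemma normal_op_add: "normal_op H T n (F + G) = normal_op H T n F + normal_op H T n G"
proof -
  obtain B1 B2 where "\<forall>b>B1. T b F = 0" "\<forall>b>B2. T b G = 0" using locally_finite by meson
  then have B: "T b F = 0" "T b G = 0" "T b (F + G) = 0" if "b > max B1 B2" for b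
    using that by (auto simp: add)
  show ?thesis
    by (simp only: normal_op_eq[OF B(1)] normal_op_eq[OF B(2)] normal_op_eq[OF B(3)]
      add distrib_left sum.distrib)
qed

lemma normal_op_scale: "normal_op H T n (const c * F) = const c * normal_op H T n F"
proof -
  obtain B where "\<forall>b>B. T b F = 0" using locally_finite by meson
  then have B: "T b F = 0" "T b (const c * F) = 0" if "b > B" for b
    using that by (auto simp: scale)
  show ?thesis
    by (simp only: normal_op_eq[OF B(1)] normal_op_eq[OF B(2)] scale sum_distrib_left mult.left_commute)
qed

lemma normal_op_0: "normal_op H T n 0 = 0"
  using normal_op_scale[of H n 0 0] by simp

lemma normal_op_sum: "normal_op H T n (\<Sum>i\<in>A. f i) = (\<Sum>i\<in>A. normal_op H T n (f i))"
  by (induction A rule: infinite_finite_induct) (simp_all add: normal_op_0 normal_op_add)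

lemma normal_op_one: "normal_op H T n 1 = H n"
proof -
  have "normal_op H T n 1 = (\<Sum>b\<in>{0..0}. H (n + b) * T b 1)" by (rule normal_op_eq) (simp add: one)
  then show ?thesis by (simp add: one)
qed

text \<open>
  The order in \<open>z\<^sup>-\<^sup>1\<close> to which the annihilation exponential acts on \<open>F\<close>.  It controls the vanishing of
  \<open>normal_op\<close> at small indices.
\<close>

definition deg_le :: "int \<Rightarrow> 'i cpoly \<Rightarrow> bool" where
  "deg_le B F \<longleftrightarrow> (\<forall>b>B. T b F = 0)"

lemma deg_le_one: "deg_le 0 1"
  by (simp add: deg_le_def one)

lemma deg_le_mono: "deg_le B F \<Longrightarrow> B \<le> B' \<Longrightarrow> deg_le B' F"
  by (simp add: deg_le_def)

lemma normal_op_eq_0: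
  assumes "deg_le B F" "\<And>m. m < 0 \<Longrightarrow> H m = 0" "n < - B"
  shows "normal_op H T n F = 0"
proof -
  have "normal_op H T n F = (\<Sum>b\<in>{0..B}. H (n + b) * T b F)"
    by (rule normal_op_eq) (use assms(1) in \<open>auto simp: deg_le_def\<close>)
  also have "\<dots> = 0" by (rule sum.neutral) (use assms(2,3) in auto)
  finally show ?thesis .
qed

end

text \<open>
  Two series \<open>Q(z) = E(z) U(z)\<close> and \<open>S(w) = H(w) T(w)\<close>, where \<open>E\<close>, \<open>H\<close> are creation and \<open>U\<close>, \<open>T\<close> annihilation
  series.  The assumptions \<open>U_H\<close> and \<open>T_E\<close> say that moving \<open>U(z)\<close> past \<open>H(w)\<close> produces the factor \<open>1 - u\<close> with
  \<open>u = \<epsilon> w z\<^sup>-\<^sup>d\<close>, and moving \<open>T(w)\<close> past \<open>E(z)\<close> the factor \<open>1 - x\<^sup>-\<^sup>1 u\<^sup>-\<^sup>1\<close>; \<open>T_H\<close> is the factor \<open>1 - w'/w\<close>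
  between two copies of \<open>S\<close>.  In the application \<open>\<epsilon> = (-1)\<^sup>d\<close> and \<open>x = q\<^sup>d\<close>.
\<close>

locale vertex_pair = U: annihilation U + T: annihilation T
  for U T :: "int \<Rightarrow> 'i cpoly \<Rightarrow> 'i cpoly" +
  fixes E H :: "int \<Rightarrow> 'i cpoly" and \<epsilon> x :: complex and d :: nat
  assumes commute: "U a (T b F) = T b (U a F)"
    and T_commute: "T a (T b F) = T b (T a F)"
    and U_H: "U a (H m * F) = H m * U a F - const \<epsilon> * H (m - 1) * U (a - int d) F"
    and T_E: "T b (E m * F) = E m * T b F - const (\<epsilon> / x) * E (m - int d) * T (b - 1) F"
    and T_H: "T b (H m * F) = H m * T b F - H (m - 1) * T (b - 1) F"
    and H_neg: "m < 0 \<Longrightarrow> H m = 0"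
    and sign: "\<epsilon> * \<epsilon> = 1" and x: "x \<noteq> 0" "x \<noteq> 1"
begin

abbreviation S :: "int \<Rightarrow> 'i cpoly \<Rightarrow> 'i cpoly" where
  "S n \<equiv> normal_op H T n"

abbreviation Q :: "int \<Rightarrow> 'i cpoly \<Rightarrow> 'i cpoly" where
  "Q k \<equiv> normal_op E U (- k)"

text \<open>
  Both products are expressed by the coefficients \<open>N k n\<close> of the normally ordered product
  \<open>E(z) H(w) U(z) T(w)\<close>, by moving annihilation operators to the right.  For fixed \<open>F\<close> all sums are finite,
  over a range outside of which \<open>U\<^sub>a T\<^sub>b F\<close> vanishes.
\<close>

lemma normal_ordering:
  "\<exists>N. \<forall>k n. Q k (S n F) = N k n - const \<epsilon> * N (k - int d) (n - 1)
    \<and> S n (Q k F) = N k n - const (\<epsilon> / x) * N (k + int d) (n + 1)"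
proof -
  obtain B0 where B0: "\<And>b. b > B0 \<Longrightarrow> T b F = 0" using T.locally_finite by meson
  define B where "B = max 0 B0"
  have "\<exists>A. \<forall>a>A. U a (T b F) = 0" for b by (rule U.locally_finite)
  then obtain A0 where A0: "\<And>b a. a > A0 b \<Longrightarrow> U a (T b F) = 0" by metis
  \<comment> \<open>Only the finitely many vectors \<open>T b F\<close> with \<open>0 \<le> b \<le> B\<close> matter, so one bound \<open>A\<close> serves for all of them.\<close>
  define A where "A = Max (insert 0 (A0 ` {0..B}))"
  define W where "W a b = U a (T b F)" for a b
  have T_big: "T b F = 0" if "b > B" for b using that by (intro B0) (simp add: B_def)
  have W0: "W a b = 0" if "a < 0 \<or> a > A \<or> b < 0 \<or> b > B" for a b
  proof (cases "b < 0 \<or> b > B \<or> a < 0")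
    case True
    then show ?thesis using T_big T.neg U.neg by (auto simp: W_def U.zero)
  next
    case False
    then have "A0 b \<le> A" unfolding A_def by (intro Max_ge) auto
    with False that show ?thesis unfolding W_def by (intro A0) auto
  qed
  define N where "N k n = (\<Sum>a\<in>{0..A}. \<Sum>b\<in>{0..B}. E (a - k) * (H (n + b) * W a b))" for k n
  have "Q k (S n F) = N k n - const \<epsilon> * N (k - int d) (n - 1)" for k n
  proof -
    have S_F: "S n F = (\<Sum>b\<in>{0..B}. H (n + b) * T b F)" by (rule T.normal_op_eq) (rule T_big)
    have U_S: "U a (S n F) = (\<Sum>b\<in>{0..B}. H (n + b) * W a b - const \<epsilon> * (H (n - 1 + b) * W (a - int d) b))" for a
      unfolding S_F U.sum by (intro sum.cong refl) (simp only: U_H W_def, simp add: algebra_simps)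
    have "Q k (S n F) = (\<Sum>a\<in>{0..A + int d}. E (- k + a) * U a (S n F))"
    proof (rule U.normal_op_eq)
      fix a assume "a > A + int d"
      then show "U a (S n F) = 0" unfolding U_S by (intro sum.neutral ballI) (simp add: W0)
    qed
    also have "\<dots> = (\<Sum>a\<in>{0..A + int d}. \<Sum>b\<in>{0..B}. E (a - k) * (H (n + b) * W a b))
        - const \<epsilon> * (\<Sum>a\<in>{0..A + int d}. \<Sum>b\<in>{0..B}. E (a - k) * (H (n - 1 + b) * W (a - int d) b))"
      unfolding U_S sum_distrib_left sum_subtractf[symmetric]
      by (intro sum.cong refl) (simp add: algebra_simps)
    also have "(\<Sum>a\<in>{0..A + int d}. \<Sum>b\<in>{0..B}. E (a - k) * (H (n + b) * W a b)) = N k n"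
      unfolding N_def by (rule sum.mono_neutral_right) (auto simp: W0)
    also have "(\<Sum>a\<in>{0..A + int d}. \<Sum>b\<in>{0..B}. E (a - k) * (H (n - 1 + b) * W (a - int d) b))
        = (\<Sum>a\<in>{int d..A + int d}. \<Sum>b\<in>{0..B}. E (a - k) * (H (n - 1 + b) * W (a - int d) b))"
      by (rule sum.mono_neutral_right) (auto simp: W0)
    also have "\<dots> = N (k - int d) (n - 1)"
      unfolding N_def
      by (rule sum.reindex_bij_witness[of _ "\<lambda>a. a + int d" "\<lambda>a. a - int d"]) (auto simp: algebra_simps)
    finally show ?thesis .
  qed
  moreover have "S n (Q k F) = N k n - const (\<epsilon> / x) * N (k + int d) (n + 1)" for k n
  proof -
    have W': "T b (U a F) = W a b" for a b by (simp add: W_def commute)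
    obtain A1 where A1: "\<And>a. a > A1 \<Longrightarrow> U a F = 0" using U.locally_finite by meson
    \<comment> \<open>The bound for \<open>U\<close> on \<open>F\<close> itself; the terms beyond \<open>A\<close> drop out once \<open>T\<close> has been moved to the right.\<close>
    define A' where "A' = max A A1"
    have Q_F: "Q k F = (\<Sum>a\<in>{0..A'}. E (- k + a) * U a F)"
      by (rule U.normal_op_eq) (rule A1, simp add: A'_def)
    have T_Q: "T b (Q k F) = (\<Sum>a\<in>{0..A'}. E (a - k) * W a b - const (\<epsilon> / x) * (E (a - (k + int d)) * W a (b - 1)))" for b
      unfolding Q_F T.sum by (intro sum.cong refl) (simp only: T_E W', simp add: algebra_simps)
    have "S n (Q k F) = (\<Sum>b\<in>{0..B + 1}. H (n + b) * T b (Q k F))"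
    proof (rule T.normal_op_eq)
      fix b assume "b > B + 1"
      then show "T b (Q k F) = 0" unfolding T_Q by (intro sum.neutral ballI) (simp add: W0)
    qed
    also have "\<dots> = (\<Sum>b\<in>{0..B + 1}. \<Sum>a\<in>{0..A'}. E (a - k) * (H (n + b) * W a b))
        - const (\<epsilon> / x) * (\<Sum>b\<in>{0..B + 1}. \<Sum>a\<in>{0..A'}. E (a - (k + int d)) * (H (n + b) * W a (b - 1)))"
      unfolding T_Q sum_distrib_left sum_subtractf[symmetric]
      by (intro sum.cong refl) (simp add: algebra_simps)
    also have "(\<Sum>b\<in>{0..B + 1}. \<Sum>a\<in>{0..A'}. E (a - k) * (H (n + b) * W a b))
        = (\<Sum>a\<in>{0..A'}. \<Sum>b\<in>{0..B + 1}. E (a - k) * (H (n + b) * W a b))" by (rule sum.swap)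
    also have "\<dots> = (\<Sum>a\<in>{0..A'}. \<Sum>b\<in>{0..B}. E (a - k) * (H (n + b) * W a b))"
      by (intro sum.cong refl sum.mono_neutral_right) (auto simp: W0)
    also have "\<dots> = N k n"
      unfolding N_def by (rule sum.mono_neutral_right) (auto simp: W0 A'_def)
    also have "(\<Sum>b\<in>{0..B + 1}. \<Sum>a\<in>{0..A'}. E (a - (k + int d)) * (H (n + b) * W a (b - 1)))
        = (\<Sum>a\<in>{0..A'}. \<Sum>b\<in>{0..B + 1}. E (a - (k + int d)) * (H (n + b) * W a (b - 1)))" by (rule sum.swap)
    also have "\<dots> = (\<Sum>a\<in>{0..A}. \<Sum>b\<in>{0..B + 1}. E (a - (k + int d)) * (H (n + b) * W a (b - 1)))"
      by (rule sum.mono_neutral_right) (auto simp: W0 A'_def)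
    also have "\<dots> = (\<Sum>a\<in>{0..A}. \<Sum>b\<in>{1..B + 1}. E (a - (k + int d)) * (H (n + b) * W a (b - 1)))"
      by (intro sum.cong refl sum.mono_neutral_right) (auto simp: W0)
    also have "\<dots> = N (k + int d) (n + 1)"
      unfolding N_def
    proof (rule sum.cong[OF refl])
      fix a
      show "(\<Sum>b\<in>{1..B + 1}. E (a - (k + int d)) * (H (n + b) * W a (b - 1)))
          = (\<Sum>b\<in>{0..B}. E (a - (k + int d)) * (H (n + 1 + b) * W a b))"
        by (rule sum.reindex_bij_witness[of _ "\<lambda>b. b + 1" "\<lambda>b. b - 1"]) (auto simp: algebra_simps)
    qed
    finally show ?thesis .
  qed
  ultimately show ?thesis by blast
qed

text \<open>
  Along the line \<open>(k - i d, n - i)\<close> let \<open>N i\<close> be the normally ordered coefficients.  Then \<open>Q S\<close> is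
  \<open>N i - \<epsilon> N (i + 1)\<close> and \<open>S Q\<close> is \<open>N i - (\<epsilon> / x) N (i - 1)\<close>.  The sum on the right therefore telescopes to
  \<open>N 0 - \<epsilon> N 1\<close> up to a multiple of \<open>N I\<close>.  The two vanishing hypotheses give two proportionality relations
  between \<open>N I\<close> and \<open>N (I + 1)\<close>, which are incompatible unless \<open>N I = 0\<close>.
\<close>

lemma exchange:
  fixes I :: nat
  assumes I: "I \<ge> 1" and Q0: "Q (k - int (I * d)) (S (n - int I) F) = 0"
    and S0: "S (n - int (Suc I)) (Q (k - int (Suc I * d)) F) = 0"
  shows "Q k (S n F) = (\<Sum>i=1..I. const (A_coeff x i * \<epsilon> ^ i) * S (n - int i) (Q (k - int (i * d)) F))"
proof -
  obtain N0 where N0: "\<And>k n. Q k (S n F) = N0 k n - const \<epsilon> * N0 (k - int d) (n - 1)"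
      "\<And>k n. S n (Q k F) = N0 k n - const (\<epsilon> / x) * N0 (k + int d) (n + 1)"
    using normal_ordering[of F] by blast
  define N where "N i = N0 (k - int (i * d)) (n - int i)" for i
  have a: "Q (k - int (i * d)) (S (n - int i) F) = N i - const \<epsilon> * N (Suc i)" for i
    unfolding N0 N_def by (simp add: algebra_simps)
  have b: "S (n - int (Suc i)) (Q (k - int (Suc i * d)) F) = N (Suc i) - const (\<epsilon> / x) * N i" for i
    unfolding N0 N_def by (simp add: algebra_simps)
  have e2: "const \<epsilon> * const \<epsilon> = 1" by (simp add: sign flip: const_mult)
  have xx: "const x * const (1 / x) = 1" using x(1) by (simp flip: const_mult)
  have ex: "const (\<epsilon> / x) = const \<epsilon> * const (1 / x)" by (simp flip: const_mult)
  have "N I = const \<epsilon> * N (Suc I)" using a[of I] Q0 by simp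
  also have "N (Suc I) = const (\<epsilon> / x) * N I" using b[of I] S0 by simp
  finally have "N I = const (1 / x) * N I" by (simp add: sign flip: const_mult mult.assoc)
  then have "const (1 - 1 / x) * N I = 0"
    by (metis (no_types, opaque_lifting) add_diff_cancel_right' const_1 const_add diff_add_cancel diff_self left_diff_distrib mult_1)
  then have "const (1 / (1 - 1 / x)) * (const (1 - 1 / x) * N I) = 0" by simp
  then have NI: "N I = 0" using x by (simp add: mult.assoc[symmetric] const_mult[symmetric])
  have "(\<Sum>i=1..j. const (A_coeff x i * \<epsilon> ^ i) * S (n - int i) (Q (k - int (i * d)) F))
      = N 0 - const \<epsilon> * N 1 + const \<epsilon> ^ j * const x ^ j * (const (1 / x) - 1) * N j" if "j \<ge> 1" for j
    using that
  proof (induction j rule: nat_induct_at_least)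
    case base
    have "(\<Sum>i=1..1. const (A_coeff x i * \<epsilon> ^ i) * S (n - int i) (Q (k - int (i * d)) F))
        = const (- x * \<epsilon>) * (N 1 - const (\<epsilon> / x) * N 0)"
      using b[of 0] by (simp add: A_coeff_def)
    also have "\<dots> = N 0 - const \<epsilon> * N 1 + const \<epsilon> ^ 1 * const x ^ 1 * (const (1 / x) - 1) * N 1"
    proof -
      have neg: "const (- x * \<epsilon>) = - (const x * const \<epsilon>)" by (simp add: const_mult const_uminus)
      have "const (- x * \<epsilon>) * (N 1 - const (\<epsilon> / x) * N 0)
          = (const \<epsilon> * const \<epsilon>) * (const x * const (1 / x)) * N 0 - const x * const \<epsilon> * N 1"
        unfolding neg ex by (simp add: algebra_simps)
      moreover have "const \<epsilon> ^ 1 * const x ^ 1 * (const (1 / x) - 1) * N 1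
          = const \<epsilon> * (const x * const (1 / x)) * N 1 - const x * const \<epsilon> * N 1"
        by (simp add: algebra_simps)
      ultimately show ?thesis by (simp add: e2 xx)
    qed
    finally show ?case .
  next
    case (Suc j)
    define f where "f i = const (A_coeff x i * \<epsilon> ^ i) * S (n - int i) (Q (k - int (i * d)) F)" for i
    have A: "const (A_coeff x (Suc j) * \<epsilon> ^ Suc j) = const x ^ Suc j * (const (1 / x) - 1) * const \<epsilon> ^ Suc j"
    proof -
      show ?thesis using Suc.hyps by (simp add: A_coeff_def const_mult const_power const_diff)
    qed
    have "(\<Sum>i=1..Suc j. f i) = (\<Sum>i=1..j. f i) + f (Suc j)" by simp
    also have "f (Suc j) = const x ^ Suc j * (const (1 / x) - 1) * const \<epsilon> ^ Suc j * (N (Suc j) - const (\<epsilon> / x) * N j)"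
      unfolding f_def A b ..
    also have "\<dots> = const \<epsilon> ^ Suc j * const x ^ Suc j * (const (1 / x) - 1) * N (Suc j)
        - (const \<epsilon> * const \<epsilon>) * (const x * const (1 / x)) * (const \<epsilon> ^ j * const x ^ j * (const (1 / x) - 1) * N j)"
      unfolding ex by (simp only: power_Suc) (simp only: algebra_simps)
    finally show ?case using Suc.IH unfolding f_def[symmetric] by (simp add: e2 xx)
  qed
  from this[OF I] show ?thesis using a[of 0] by (simp add: NI)
qed

lemma deg_le_S: "T.deg_le B F \<Longrightarrow> T.deg_le (B + 1) (S n F)"
proof -
  assume F: "T.deg_le B F"
  have "S n F = (\<Sum>b\<in>{0..B}. H (n + b) * T b F)"
    by (rule T.normal_op_eq) (use F in \<open>auto simp: T.deg_le_def\<close>)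
  moreover have TT: "T j (T b F) = 0" if "j > B" for j b
    using F that by (subst T_commute) (simp add: T.deg_le_def T.zero)
  ultimately show ?thesis
    unfolding T.deg_le_def by (auto simp: T.sum T_H TT intro!: sum.neutral)
qed

lemma deg_le_E: "T.deg_le 1 (E m)"
  using T_E[of _ m 1] by (simp add: T.deg_le_def T.one)

lemma deg_le_S_seq: "T.deg_le B F \<Longrightarrow> T.deg_le (B + int (length \<alpha>)) (foldr S \<alpha> F)"
proof (induction \<alpha>)
  case (Cons n \<alpha>)
  then show ?case using deg_le_S[of "B + int (length \<alpha>)"] by (simp add: add_ac)
qed simp

lemma deg_le_lincomb: "(\<And>i. i \<in> A \<Longrightarrow> T.deg_le B (f i)) \<Longrightarrow> T.deg_le B (\<Sum>i\<in>A. const (g i) * f i)"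
  unfolding T.deg_le_def by (auto simp: T.sum T.scale intro!: sum.neutral)

text \<open>
  Apply \<open>exchange\<close> to the leftmost factor with \<open>I\<close> the first entry of the underlined partition.  With
  \<open>l\<close> the number of the remaining factors and \<open>I = n + l + 1\<close>, the indices in the two hypotheses are
  \<open>n - I = -(l + 1)\<close> and \<open>n - (I + 1) = -(l + 2)\<close>, just below the orders \<open>l\<close> and \<open>l + 1\<close> of the vectors to
  which \<open>S\<close> is applied; for the second vector the order is read off from the induction hypothesis.
\<close>

theorem exchange_seq:
  "Q k (foldr S (map int la) 1) = (\<Sum>tau\<in>comps_below (underlined la).
     const (prod_list (map (A_coeff x) tau) * \<epsilon> ^ sum_list tau) *
     foldr S (map2 (\<lambda>a t. int a - int t) la tau) (Q (k - int (sum_list tau * d)) 1))"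
proof (induction la arbitrary: k)
  case Nil
  have "comps_below (underlined []) = {[]}" by (auto simp: comps_below_def underlined_def)
  then show ?case by simp
next
  case (Cons n la)
  define F where "F = foldr S (map int la) 1"
  define I where "I = n + Suc (length la)"
  define G where "G k tau = foldr S (map2 (\<lambda>a t. int a - int t) la tau) (Q (k - int (sum_list tau * d)) 1)" for k tau
  define cf where "cf tau = prod_list (map (A_coeff x) tau) * \<epsilon> ^ sum_list tau" for tau
  have IH: "Q k F = (\<Sum>tau\<in>comps_below (underlined la). const (cf tau) * G k tau)" for k
    unfolding F_def G_def cf_def by (rule Cons)
  have "T.deg_le (int (length la)) F"
    using deg_le_S_seq[OF T.deg_le_one, of "map int la"] by (simp add: F_def)
  then have "S (int n - int I) F = 0" by (rule T.normal_op_eq_0) (simp_all add: H_neg I_def)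
  then have Q0: "Q (k - int (I * d)) (S (int n - int I) F) = 0" by (simp add: U.normal_op_0)
  have "T.deg_le (int (length la) + 1) (G k tau)" for k tau
  proof -
    have "T.deg_le (1 + int (length (map2 (\<lambda>a t. int a - int t) la tau))) (G k tau)"
      unfolding G_def U.normal_op_one by (intro deg_le_S_seq deg_le_E)
    then show ?thesis by (rule T.deg_le_mono) simp
  qed
  then have "T.deg_le (int (length la) + 1) (Q k F)" for k
    unfolding IH by (rule deg_le_lincomb)
  then have S0: "S (int n - int (Suc I)) (Q (k - int (Suc I * d)) F) = 0"
    by (rule T.normal_op_eq_0) (simp_all add: H_neg I_def)
  have und: "underlined (n # la) = I # underlined la"
    by (simp add: underlined_def I_def map_upt_Suc del: upt_Suc)
  have comps: "comps_below (u # us) = (\<lambda>(t, ts). t # ts) ` ({1..u} \<times> comps_below us)" for u us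
    by (auto simp: comps_below_def list_all2_Cons2 image_iff)
  have "Q k (foldr S (map int (n # la)) 1) = Q k (S (int n) F)" by (simp add: F_def)
  also have "\<dots> = (\<Sum>i=1..I. const (A_coeff x i * \<epsilon> ^ i) * S (int n - int i) (Q (k - int (i * d)) F))"
    by (rule exchange[OF _ Q0 S0]) (simp add: I_def)
  also have "\<dots> = (\<Sum>i=1..I. \<Sum>tau\<in>comps_below (underlined la).
      const (A_coeff x i * \<epsilon> ^ i) * (const (cf tau) * S (int n - int i) (G (k - int (i * d)) tau)))"
    unfolding IH by (simp only: T.normal_op_sum T.normal_op_scale sum_distrib_left)
  also have "\<dots> = (\<Sum>(i, tau)\<in>{1..I} \<times> comps_below (underlined la).
      const (A_coeff x i * \<epsilon> ^ i) * (const (cf tau) * S (int n - int i) (G (k - int (i * d)) tau)))"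
    by (rule sum.cartesian_product)
  also have "\<dots> = (\<Sum>tau\<in>(\<lambda>(t, ts). t # ts) ` ({1..I} \<times> comps_below (underlined la)). const (cf tau) *
     foldr S (map2 (\<lambda>a t. int a - int t) (n # la) tau) (Q (k - int (sum_list tau * d)) 1))"
    by (subst sum.reindex)
      (auto simp: inj_on_def G_def cf_def const_mult power_add algebra_simps intro!: sum.cong)
  finally show ?case unfolding und comps cf_def .
qed

end

section \<open>Vertex operators built from exponentials\<close>

text \<open>
  Local finiteness holds for constants and, since the derivations send indeterminates to constants and
  almost all of them to zero, for each indeterminate.  It passes to products because the exponential
  is multiplicative.
\<close>

lemma annihilation_op_exp_int:
  assumes D: "\<And>n. n \<ge> 1 \<Longrightarrow> derivation (D n)"
    and D_const: "\<And>n i. n \<ge> 1 \<Longrightarrow> \<exists>c. D n (indet i) = const c"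
    and D_finite: "\<And>i. \<exists>B. \<forall>n>B. D n (indet i) = 0"
  shows "annihilation (op_exp_int D)"
proof
  have mult_exp: "op_exp D j (F * G) = (\<Sum>l=0..j. op_exp D l F * op_exp D (j - l) G)" for j F G
  proof -
    have "op_exp_fps D (F * G) = op_exp_fps D F * op_exp_fps D G" by (rule op_exp_fps_mult) (rule D)
    then show ?thesis by (simp only: op_exp_fps_nth[symmetric] fps_mult_nth)
  qed
  have add_exp: "op_exp D j (F + G) = op_exp D j F + op_exp D j G" for j F G
  proof -
    have "op_exp_fps D (F + G) = op_exp_fps D F + op_exp_fps D G" by (rule op_exp_fps_add) (rule D)
    then show ?thesis by (simp only: op_exp_fps_nth[symmetric] fps_add_nth)
  qed
  have const_exp: "op_exp D j (const c) = (if j = 0 then const c else 0)" for j c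
  proof -
    have "op_exp_fps D (const c) = fps_const (const c)" by (rule op_exp_fps_const) (rule D)
    then show ?thesis unfolding op_exp_fps_nth[symmetric] by (simp del: op_exp_fps_nth)
  qed
  show "op_exp_int D b (F + G) = op_exp_int D b F + op_exp_int D b G" for b F G
    by (simp add: op_exp_int_def add_exp)
  show "op_exp_int D b (const c * F) = const c * op_exp_int D b F" for b c F
  proof -
    have "op_exp D j (const c * F) = const c * op_exp D j F" for j
    proof -
      have "op_exp D j (const c * F) = (\<Sum>l\<in>{0}. op_exp D l (const c) * op_exp D (j - l) F)"
        unfolding mult_exp by (rule sum.mono_neutral_right) (auto simp: const_exp)
      then show ?thesis by (simp add: const_exp)
    qed
    then show ?thesis by (simp add: op_exp_int_def)
  qed
  show "op_exp_int D b F = 0" if "b < 0" for b F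
    using that by (simp add: op_exp_int_def)
  show "op_exp_int D b 1 = (if b = 0 then 1 else 0)" for b
    using const_exp[of "nat b" 1] by (simp add: op_exp_int_def op_exp_0)
  have "\<exists>B. \<forall>j>B. op_exp D j F = 0" for F
  proof (induction F rule: cpoly_induct)
    case (const c)
    show ?case by (rule exI[of _ 0]) (simp add: const_exp)
  next
    case (add F G)
    then obtain B1 B2 where "\<forall>j>B1. op_exp D j F = 0" "\<forall>j>B2. op_exp D j G = 0" by blast
    then show ?case by (intro exI[of _ "max B1 B2"]) (simp add: add_exp)
  next
    case (mult i F)
    then obtain B1 where B1: "\<forall>j>B1. op_exp D j F = 0" by blast
    obtain B2 where B2: "\<forall>n>B2. D n (indet i) = 0" using D_finite by blast
    have "D n (D m (indet i)) = 0" if nm: "n \<ge> 1" "m \<ge> 1" for n m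
    proof -
      obtain c where "D m (indet i) = const c" using D_const[OF nm(2)] by blast
      then show ?thesis by (simp add: derivation_const[OF D[OF nm(1)]])
    qed
    then have "op_exp_fps D (indet i) = fps_const (indet i) + Abs_fps (\<lambda>j. if j = 0 then 0 else D j (indet i))"
      by (intro op_exp_fps_linear D)
    then have "op_exp D j (indet i) = (if j = 0 then indet i else 0) + (if j = 0 then 0 else D j (indet i))" for j
      unfolding op_exp_fps_nth[symmetric] by (simp del: op_exp_fps_nth)
    then have gen: "op_exp D j (indet i) = 0" if "j > B2" for j using B2 that by auto
    have "op_exp D j (indet i * F) = 0" if "j > B1 + B2" for j
      unfolding mult_exp
    proof (intro sum.neutral ballI)
      fix l assume "l \<in> {0..j}"
      show "op_exp D l (indet i) * op_exp D (j - l) F = 0"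
      proof (cases "l > B2")
        case False
        then have "j - l > B1" using that by simp
        then show ?thesis using B1 by simp
      qed (simp add: gen)
    qed
    then show ?case by blast
  qed
  then show "\<exists>B. \<forall>b>B. op_exp_int D b F = 0" for F
  proof -
    obtain B where "\<forall>j>B. op_exp D j F = 0" using \<open>\<And>F. \<exists>B. \<forall>j>B. op_exp D j F = 0\<close> by blast
    then show ?thesis by (intro exI[of _ "int B"]) (auto simp: op_exp_int_def)
  qed
qed

lemma op_exp_int_commute:
  assumes D: "\<And>n. n \<ge> 1 \<Longrightarrow> derivation (D n)" and D': "\<And>n. n \<ge> 1 \<Longrightarrow> derivation (D' n)"
    and A: "annihilation (op_exp_int D)" "annihilation (op_exp_int D')"
    and comm: "\<And>n m F. n \<ge> 1 \<Longrightarrow> m \<ge> 1 \<Longrightarrow> D n (D' m F) = D' m (D n F)"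
  shows "op_exp_int D a (op_exp_int D' b F) = op_exp_int D' b (op_exp_int D a F)"
proof (cases "a < 0 \<or> b < 0")
  case True
  then show ?thesis
    by (auto simp: annihilation.neg[OF A(1)] annihilation.neg[OF A(2)]
      annihilation.zero[OF A(1)] annihilation.zero[OF A(2)])
next
  case False
  have 1: "D' m (op_exp D j G) = op_exp D j (D' m G)" if "m \<ge> 1" for m j G
    by (rule op_exp_commute[of D "D' m"])
      (auto simp: D derivation_add[OF D'[OF that]] derivation_const_mult[OF D'[OF that]] comm[OF _ that, symmetric])
  have "op_exp D (nat a) (op_exp D' (nat b) F) = op_exp D' (nat b) (op_exp D (nat a) F)"
  proof (rule op_exp_commute[of D' "op_exp D (nat a)"])
    show "op_exp D (nat a) (F + G) = op_exp D (nat a) F + op_exp D (nat a) G" for F G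
      using annihilation.add[OF A(1), of a F G] False by (simp add: op_exp_int_def)
    show "op_exp D (nat a) (const c * F) = const c * op_exp D (nat a) F" for c F
      using annihilation.scale[OF A(1), of a c F] False by (simp add: op_exp_int_def)
  qed (auto simp: D' 1)
  with False show ?thesis by (simp add: op_exp_int_def)
qed

lemma laurent_coeff_normal_op:
  assumes "annihilation (op_exp_int D)"
  shows "laurent_coeff (op_exp (\<lambda>m F. c m * F)) (op_exp D) n F
    = normal_op (int_ext (\<lambda>j. op_exp (\<lambda>m F. c m * F) j 1)) (op_exp_int D) n F"
proof -
  interpret annihilation "op_exp_int D" by (rule assms)
  let ?e = "\<lambda>j. op_exp (\<lambda>m F. c m * F) j 1"
  obtain B where B: "\<And>b. b > B \<Longrightarrow> op_exp_int D b F = 0" using locally_finite by meson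
  have B': "op_exp D j F = 0" if "j > nat B" for j
    using B[of "int j"] that by (simp add: op_exp_int_def)
  have summand: "(if n + int j \<ge> 0 then op_exp (\<lambda>m F. c m * F) (nat (n + int j)) (op_exp D j F) else 0)
      = int_ext ?e (n + int j) * op_exp_int D (int j) F" for j
    by (subst op_exp_mult) (simp add: int_ext_def op_exp_int_def)
  have "laurent_coeff (op_exp (\<lambda>m F. c m * F)) (op_exp D) n F
      = Sum_any (\<lambda>j. int_ext ?e (n + int j) * op_exp_int D (int j) F)"
    unfolding laurent_coeff_def summand ..
  also have "\<dots> = (\<Sum>j\<in>{0..nat B}. int_ext ?e (n + int j) * op_exp_int D (int j) F)"
  proof (rule Sum_any.expand_superset)
    show "{j. int_ext ?e (n + int j) * op_exp_int D (int j) F \<noteq> 0} \<subseteq> {0..nat B}"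
      by (auto simp: op_exp_int_def intro: ccontr) (metis B' mult_zero_right not_le)
  qed simp
  also have "\<dots> = (\<Sum>b\<in>{0..int (nat B)}. int_ext ?e (n + b) * op_exp_int D b F)"
    by (rule sum.reindex_bij_witness[of _ nat int]) (auto split: if_splits)
  also have "\<dots> = normal_op (int_ext ?e) (op_exp_int D) n F"
    by (rule normal_op_eq[symmetric]) (rule B, auto split: if_splits)
  finally show ?thesis .
qed

section \<open>The derivative with respect to $p_n(f_1)$\<close>

lemma Mgrp_mono:
  fixes x :: "'a::finite_field alg_closure"
  assumes "x \<in> Mgrp m" "m dvd n"
  shows "x \<in> Mgrp n"
proof -
  have "x ^ (CARD('a) ^ (i * m)) = x" for i
    using assms(1) by (induction i) (simp_all add: power_card_add Mgrp_def add.commute)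
  then show ?thesis using assms by (auto simp: Mgrp_def mult.commute elim!: dvdE)
qed

lemma of_nat_card_power_minus_1_neq_0:
  assumes "n > 0"
  shows "of_nat CARD('a::finite_field) ^ n - 1 \<noteq> (0 :: complex)"
proof -
  have "of_nat (CARD('a) ^ n) \<noteq> (of_nat 1 :: complex)"
    unfolding of_nat_eq_iff using card_power_gt_1[OF assms, where 'a='a] by linarith
  then show ?thesis by simp
qed

text \<open>
  The expression of \<open>\<partial>/\<partial>p\<^sub>n(f\<^sub>1)\<close> in the derivatives with respect to the generators \<open>p\<^sub>m(\<phi>)\<close>; the sum runs over
  the orbits whose size divides \<open>n\<close>.
\<close>

definition d_f1 :: "nat \<Rightarrow> 'a::finite_field FG \<Rightarrow> 'a FG" where
  "d_f1 n F = const ((-1) ^ (n - 1)) *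
     (\<Sum>\<phi>\<in>(\<lambda>\<xi>. frob_orbit (Mstar_of n \<xi>)) ` Mchars n. d_star (n div PhiStar_size \<phi>) \<phi> F)"

lemma derivation_d_star: "derivation (d_star n \<phi>)"
  unfolding d_star_def by (rule derivation_pderiv_at)

lemma derivation_d_f1: "derivation (d_f1 n)"
  unfolding d_f1_def[abs_def] by (rule derivation_scaled_sum) (rule derivation_d_star)

lemma orbits_of_Mchars:
  assumes "n > 0"
  shows "(\<lambda>\<xi>. frob_orbit (Mstar_of n \<xi>)) ` Mchars n = {\<phi>. PhiStar_size \<phi> dvd n}"
  using PhiStar_size_dvd(1)[OF assms] PhiStar_of_char_lift[OF _ assms] by (auto simp: image_iff)

lemma d_star_indet: "d_star n \<phi> (indet (j, \<psi>)) = (if n - 1 = j \<and> \<psi> = \<phi> then 1 else 0)"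
  by (auto simp: d_star_def pderiv_at_indet)

text \<open>
  The index \<open>j\<close> stands for the generator \<open>p\<^sub>j\<^sub>+\<^sub>1(\<phi>)\<close>, whence the successor.
\<close>

lemma d_f1_indet:
  fixes \<phi> :: "'a::finite_field PhiStar"
  assumes n: "n > 0"
  shows "d_f1 n (indet (j, \<phi>)) = const (if n = Suc j * PhiStar_size \<phi> then (-1) ^ (n - 1) else 0)"
proof -
  let ?A = "(\<lambda>\<xi>. frob_orbit (Mstar_of n \<xi>)) ` Mchars n :: 'a PhiStar set"
  have fin: "finite ?A" by (intro finite_imageI card_Mchars(1) n)
  have "(\<Sum>\<psi>\<in>?A. d_star (n div PhiStar_size \<psi>) \<psi> (indet (j, \<phi>)))
      = (\<Sum>\<psi>\<in>?A. if \<psi> = \<phi> then (if n div PhiStar_size \<phi> - 1 = j then 1 else 0) else 0)"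
    by (intro sum.cong refl) (auto simp: d_star_indet)
  also have "\<dots> = (if PhiStar_size \<phi> dvd n \<and> n div PhiStar_size \<phi> - 1 = j then 1 else 0)"
    using fin by (simp add: orbits_of_Mchars[OF n])
  also have "PhiStar_size \<phi> dvd n \<and> n div PhiStar_size \<phi> - 1 = j \<longleftrightarrow> n = Suc j * PhiStar_size \<phi>"
  proof
    assume asm: "PhiStar_size \<phi> dvd n \<and> n div PhiStar_size \<phi> - 1 = j"
    define k where "k = n div PhiStar_size \<phi>"
    have k: "n = PhiStar_size \<phi> * k" using asm by (simp add: k_def)
    then have "k > 0" using n by (auto intro: gr0I)
    moreover have "k - 1 = j" using asm by (simp add: k_def)
    ultimately have "k = Suc j" by simp
    with k show "n = Suc j * PhiStar_size \<phi>" by (simp only: mult.commute)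
  qed (use PhiStar_size_pos[of \<phi>] in simp)
  finally show ?thesis by (simp add: d_f1_def)
qed

text \<open>
  The sum over characters in the definition of \<open>p\<^sub>n(f)\<close>, without the scalar and for an arbitrary point \<open>x\<close>
  instead of the chosen root of \<open>f\<close>.
\<close>

definition char_sum :: "nat \<Rightarrow> 'a::finite_field alg_closure \<Rightarrow> 'a FG" where
  "char_sum N x = (\<Sum>\<xi>\<in>Mchars N. const (cnj (\<xi> x)) *
     indet (N div PhiStar_size (frob_orbit (Mstar_of N \<xi>)) - 1, frob_orbit (Mstar_of N \<xi>)))"

lemma p_Phi_char_sum:
  fixes f :: "'a::finite_field Phi" and n :: nat
  defines "N \<equiv> n * Phi_deg f"
  shows "p_Phi n f = const ((-1) ^ (N - 1) / (of_nat CARD('a) ^ N - 1)) * char_sum N (Phi_root f)"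
  by (simp add: p_Phi_def char_sum_def p_star_def Let_def N_def)

lemma Mchars_index:
  fixes \<xi> :: "'a::finite_field alg_closure \<Rightarrow> complex"
  assumes "N > 0" "\<xi> \<in> Mchars N"
  shows "Suc (N div PhiStar_size (frob_orbit (Mstar_of N \<xi>)) - 1) * PhiStar_size (frob_orbit (Mstar_of N \<xi>)) = N"
proof -
  let ?s = "PhiStar_size (frob_orbit (Mstar_of N \<xi>))"
  have "?s dvd N" "?s > 0" by (rule PhiStar_size_dvd[OF assms])+
  moreover from this have "N div ?s > 0" using assms by (auto simp: div_greater_zero_iff dest: dvd_imp_le)
  ultimately show ?thesis by simp
qed

text \<open>
  All indeterminates in \<open>p\<^sub>m(f)\<close> have the same value under \<open>d_f1 n\<close>, so that what remains is the sum of the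
  characters at the root of \<open>f\<close>.  It vanishes unless the root is \<open>1\<close>, that is, unless \<open>f = f\<^sub>1\<close>.
\<close>

lemma d_f1_p_Phi:
  fixes f :: "'a::finite_field Phi"
  assumes n: "n > 0" and m: "m > 0"
  shows "d_f1 n (p_Phi m f) = (if f = f_one \<and> m = n then 1 else 0)"
proof -
  define N where "N = m * Phi_deg f"
  define K where "K = (-1) ^ (N - 1) / (of_nat CARD('a) ^ N - 1 :: complex)"
  have N: "N > 0" using m Phi_deg_pos[of f] by (simp add: N_def)
  have mem: "Phi_root f \<in> Mgrp N" by (rule Mgrp_mono[OF Phi_root_mem]) (simp add: N_def)
  have "d_f1 n (p_Phi m f) = const K * d_f1 n (char_sum N (Phi_root f))"
    unfolding p_Phi_char_sum N_def[symmetric] K_def[symmetric]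
    by (rule derivation_const_mult[OF derivation_d_f1])
  also have "d_f1 n (char_sum N (Phi_root f))
      = (\<Sum>\<xi>\<in>Mchars N. const (cnj (\<xi> (Phi_root f))) * const (if n = N then (-1) ^ (n - 1) else 0))"
    unfolding char_sum_def derivation_sum[OF derivation_d_f1]
    by (intro sum.cong refl)
      (simp only: derivation_const_mult[OF derivation_d_f1] d_f1_indet[OF n] Mchars_index[OF N])
  also have "\<dots> = const ((\<Sum>\<xi>\<in>Mchars N. cnj (\<xi> (Phi_root f))) * (if n = N then (-1) ^ (n - 1) else 0))"
    by (simp only: const_mult const_sum sum_distrib_right)
  also have "(\<Sum>\<xi>\<in>Mchars N. cnj (\<xi> (Phi_root f))) = (if f = f_one then of_nat CARD('a) ^ N - 1 else 0)"
    by (simp add: Mchars_orthogonal_elements[OF N mem] Phi_root_eq_1_iff)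
  finally have "d_f1 n (p_Phi m f) = const (K * ((if f = f_one then of_nat CARD('a) ^ N - 1 else 0)
      * (if n = N then (-1) ^ (n - 1) else 0)))" by (simp only: const_mult)
  also have "K * ((if f = f_one then of_nat CARD('a) ^ N - 1 else 0) * (if n = N then (-1) ^ (n - 1) else 0))
      = (if f = f_one \<and> m = n then 1 else 0)"
    using of_nat_card_power_minus_1_neq_0[OF N, where 'a='a]
    by (auto simp: K_def N_def Phi_deg_f_one simp flip: power_mult_distrib)
  finally show ?thesis by simp
qed

lemma from_Phi_add: "from_Phi (F + G) = from_Phi F + from_Phi G"
  and from_Phi_mult: "from_Phi (F * G) = from_Phi F * from_Phi G"
  and from_Phi_const: "from_Phi (const c) = const c"
  and from_Phi_indet: "from_Phi (indet (j, f)) = p_Phi (Suc j) f"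
  by (simp_all add: from_Phi_def substitute_add substitute_mult substitute_const substitute_indet)

lemma d_f1_from_Phi:
  assumes "n > 0"
  shows "d_f1 n (from_Phi G) = from_Phi (pderiv_at (n - 1, f_one) G)"
proof (induction G rule: cpoly_induct)
  case (const c)
  have "from_Phi (0 :: (nat \<times> 'a Phi) cpoly) = 0" using from_Phi_const[of 0] by simp
  then show ?case by (simp add: from_Phi_const derivation_const[OF derivation_d_f1]
    derivation_const[OF derivation_pderiv_at])
next
  case (add F G)
  then show ?case by (simp add: from_Phi_add derivation_add[OF derivation_d_f1]
    derivation_add[OF derivation_pderiv_at])
next
  case (mult i G)
  obtain j f where i: "i = (j, f)" by (cases i)
  have "d_f1 n (from_Phi (indet i)) = from_Phi (pderiv_at (n - 1, f_one) (indet i))"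
    using assms from_Phi_const[of 0] from_Phi_const[of 1]
    by (auto simp: i from_Phi_indet d_f1_p_Phi pderiv_at_indet)
  with mult show ?case by (simp add: from_Phi_add from_Phi_mult derivation_mult[OF derivation_d_f1]
    derivation_mult[OF derivation_pderiv_at])
qed

text \<open>
  The characters \<open>\<xi>\<close> and \<open>\<xi>\<^sup>q\<close> belong to the same orbit, so the sum may be reindexed along the Frobenius.
\<close>

lemma char_sum_frob:
  fixes x :: "'a::finite_field alg_closure"
  assumes N: "N > 0"
  shows "char_sum N (x ^ (CARD('a) ^ i)) = char_sum N x"
proof -
  define g :: "('a alg_closure \<Rightarrow> complex) \<Rightarrow> 'a FG" where
    "g \<xi> = indet (N div PhiStar_size (frob_orbit (Mstar_of N \<xi>)) - 1, frob_orbit (Mstar_of N \<xi>))" for \<xi>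
  have g: "g (\<lambda>y. \<xi> y ^ (CARD('a) ^ i)) = g \<xi>" if "\<xi> \<in> Mchars N" for \<xi> i
    unfolding g_def frob_orbit_frob[OF N that] ..
  have per: "\<xi> y ^ (CARD('a) ^ (j * N)) = \<xi> y" if "\<xi> \<in> Mchars N" for \<xi> :: "'a alg_closure \<Rightarrow> complex" and y j
    by (induction j) (simp_all add: power_card_add Mchars_frobenius_period[OF that] add.commute)
  \<comment> \<open>The \<open>N\<close>-th power of the Frobenius is trivial on characters, so its power \<open>i * N - i\<close> inverts the power \<open>i\<close>.\<close>
  have "i \<le> i * N" using N by simp
  then have iN: "i + (i * N - i) = i * N" "(i * N - i) + i = i * N" by simp_all
  have "char_sum N (x ^ (CARD('a) ^ i)) = (\<Sum>\<xi>\<in>Mchars N. const (cnj (\<xi> x ^ (CARD('a) ^ i))) * g (\<lambda>y. \<xi> y ^ (CARD('a) ^ i)))"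
    unfolding char_sum_def g_def[symmetric]
    by (intro sum.cong refl) (simp only: g, simp only: Mchars_power_card_power)
  also have "\<dots> = (\<Sum>\<xi>\<in>Mchars N. const (cnj (\<xi> x)) * g \<xi>)"
    by (rule sum.reindex_bij_witness[of _ "\<lambda>\<xi> y. \<xi> y ^ (CARD('a) ^ (i * N - i))" "\<lambda>\<xi> y. \<xi> y ^ (CARD('a) ^ i)"])
      (simp_all add: Mchars_char_power per iN flip: power_card_add)
  finally show ?thesis by (simp only: char_sum_def g_def)
qed

text \<open>
  The sum of \<open>\<xi>\<^sub>0(x) char_sum N x\<close> over \<open>x\<close> isolates the indeterminate belonging to \<open>\<xi>\<^sub>0\<close>, by orthogonality; and
  \<open>char_sum N x\<close> is a multiple of some \<open>p\<^sub>m(f)\<close> because \<open>x\<close> is conjugate to the chosen root of some \<open>f\<close>.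
\<close>

lemma from_Phi_surj: "surj (from_Phi :: (nat \<times> 'a::finite_field Phi) cpoly \<Rightarrow> 'a FG)"
proof -
  let ?R = "range (from_Phi :: (nat \<times> 'a Phi) cpoly \<Rightarrow> 'a FG)"
  have add: "F + G \<in> ?R" if "F \<in> ?R" "G \<in> ?R" for F G
    using that by (auto simp flip: from_Phi_add)
  have mult: "F * G \<in> ?R" if "F \<in> ?R" "G \<in> ?R" for F G
    using that by (auto simp flip: from_Phi_mult)
  have const: "const c \<in> ?R" for c by (metis from_Phi_const rangeI)
  have sum: "(\<Sum>i\<in>A. h i) \<in> ?R" if "\<And>i. i \<in> A \<Longrightarrow> h i \<in> ?R" for A :: "'a alg_closure set" and h
    using that
  proof (induction A rule: infinite_finite_induct)
    case (insert x A)
    then show ?case by (simp add: add)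
  qed (use const[of 0] in simp_all)
  have cs: "char_sum N x \<in> ?R" if N: "N > 0" and x: "x \<in> Mgrp N" for N x
  proof -
    obtain f i where f: "Phi_deg f dvd N" "Phi_root f = x ^ (CARD('a) ^ i)" using Phi_conjugate[OF x N] by blast
    define m where "m = N div Phi_deg f"
    have m: "m * Phi_deg f = N" "m > 0" using f N by (auto simp: m_def div_greater_zero_iff Phi_deg_pos dest: dvd_imp_le)
    define K where "K = (-1) ^ (N - 1) / (of_nat CARD('a) ^ N - 1 :: complex)"
    have K: "K \<noteq> 0" using of_nat_card_power_minus_1_neq_0[OF N, where 'a='a] by (simp add: K_def)
    have "p_Phi m f = const K * char_sum N x"
      unfolding p_Phi_char_sum m f(2) char_sum_frob[OF N] K_def ..
    then have "char_sum N x = const (1 / K) * p_Phi m f" by (simp add: const_inverse_mult K)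
    moreover have "p_Phi m f \<in> ?R" using m(2) from_Phi_indet[of "m - 1" f] by (metis Suc_pred' rangeI)
    ultimately show ?thesis by (simp add: mult const)
  qed
  have ind: "indet (j, \<phi>) \<in> ?R" for j and \<phi> :: "'a PhiStar"
  proof -
    define N where "N = Suc j * PhiStar_size \<phi>"
    have N: "N > 0" using PhiStar_size_pos[of \<phi>] by (simp add: N_def)
    obtain \<xi>0 where \<xi>0: "\<xi>0 \<in> Mchars N" "frob_orbit (Mstar_of N \<xi>0) = \<phi>"
      using PhiStar_of_char_lift[of \<phi> N] N by (auto simp: N_def)
    define g :: "('a alg_closure \<Rightarrow> complex) \<Rightarrow> 'a FG" where
      "g \<xi> = indet (N div PhiStar_size (frob_orbit (Mstar_of N \<xi>)) - 1, frob_orbit (Mstar_of N \<xi>))" for \<xi>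
    define c :: complex where "c = of_nat (CARD('a) ^ N - 1)"
    have c: "c \<noteq> 0" using card_power_gt_1[OF N, where 'a='a] by (simp add: c_def del: of_nat_diff)
    have "(\<Sum>x\<in>Mgrp N. const (\<xi>0 x) * char_sum N x)
        = (\<Sum>x\<in>Mgrp N. \<Sum>\<xi>\<in>Mchars N. const (\<xi>0 x * cnj (\<xi> x)) * g \<xi>)"
      by (simp only: char_sum_def g_def sum_distrib_left const_mult mult.assoc)
    also have "\<dots> = (\<Sum>\<xi>\<in>Mchars N. const (\<Sum>x\<in>Mgrp N. \<xi>0 x * cnj (\<xi> x)) * g \<xi>)"
      by (subst sum.swap) (simp only: const_sum sum_distrib_right)
    also have "\<dots> = (\<Sum>\<xi>\<in>Mchars N. if \<xi> = \<xi>0 then const c * g \<xi>0 else 0)"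
      by (intro sum.cong refl) (auto simp: Mchars_orthogonal_characters[OF N \<xi>0(1)] c_def)
    also have "\<dots> = const c * g \<xi>0" using \<xi>0(1) card_Mchars(1)[OF N, where 'a='a] by simp
    also have "g \<xi>0 = indet (j, \<phi>)"
    proof -
      have "N div PhiStar_size \<phi> = Suc j"
        unfolding N_def by (rule nonzero_mult_div_cancel_right) (use PhiStar_size_pos[of \<phi>] in simp)
      then show ?thesis by (simp only: g_def \<xi>0(2) diff_Suc_1)
    qed
    finally have "indet (j, \<phi>) = const (1 / c) * (\<Sum>x\<in>Mgrp N. const (\<xi>0 x) * char_sum N x)"
      by (simp add: const_inverse_mult c)
    then show ?thesis by (simp add: mult const sum cs N)
  qed
  have "F \<in> ?R" for F
  proof (induction F rule: cpoly_induct)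
    case (mult i F)
    then show ?case using ind \<open>\<And>F G. F \<in> ?R \<Longrightarrow> G \<in> ?R \<Longrightarrow> F * G \<in> ?R\<close> by (cases i) blast
  qed (simp_all add: const add)
  then show ?thesis by blast
qed

text \<open>
  The definition of \<open>d_Phi\<close> differentiates some preimage under \<open>from_Phi\<close>.  Since \<open>d_f1 n\<close> intertwines
  \<open>from_Phi\<close> with the formal derivative, the result is the same for every preimage.
\<close>

theorem d_Phi_f_one:
  assumes "n > 0"
  shows "d_Phi n f_one = d_f1 n"
proof
  fix F
  have "from_Phi (inv_into UNIV from_Phi F) = F" using from_Phi_surj by (rule surj_f_inv_f)
  then show "d_Phi n f_one F = d_f1 n F"
    using d_f1_from_Phi[OF assms, of "inv_into UNIV from_Phi F"] by (simp add: d_Phi_def)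
qed

text \<open>
  The indeterminate \<open>p\<^sub>m(\<phi>)\<close> occurs in \<open>p\<^sub>n(f\<^sub>1)\<close> once for each of the \<open>|\<phi>|\<close> characters of \<open>Mgrp n\<close> in \<open>\<phi>\<close>.
\<close>

lemma d_star_p_Phi_f_one:
  fixes \<phi> :: "'a::finite_field PhiStar"
  assumes n: "n > 0" and m: "m > 0"
  shows "d_star m \<phi> (p_Phi n f_one)
    = const (if n = m * PhiStar_size \<phi>
        then (-1) ^ (n - 1) * of_nat (PhiStar_size \<phi>) / (of_nat CARD('a) ^ n - 1) else 0)"
proof -
  define K where "K = (-1) ^ (n - 1) / (of_nat CARD('a) ^ n - 1 :: complex)"
  let ?A = "{\<xi> \<in> Mchars n. frob_orbit (Mstar_of n \<xi>) = \<phi>}"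
  have fin: "finite (Mchars n :: ('a alg_closure \<Rightarrow> complex) set)" by (rule card_Mchars(1)[OF n])
  have "d_star m \<phi> (p_Phi n f_one) = const K * d_star m \<phi> (char_sum n 1)"
    unfolding p_Phi_char_sum Phi_deg_f_one Phi_root_f_one mult_1_right K_def
    by (rule derivation_const_mult[OF derivation_d_star])
  also have "d_star m \<phi> (char_sum n 1)
      = (\<Sum>\<xi>\<in>Mchars n. if frob_orbit (Mstar_of n \<xi>) = \<phi> then (if n = m * PhiStar_size \<phi> then 1 else 0) else 0)"
    unfolding char_sum_def derivation_sum[OF derivation_d_star]
  proof (rule sum.cong[OF refl])
    fix \<xi> :: "'a alg_closure \<Rightarrow> complex" assume xi: "\<xi> \<in> Mchars n"
    let ?\<psi> = "frob_orbit (Mstar_of n \<xi>)"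
    have idx: "Suc (n div PhiStar_size ?\<psi> - 1) * PhiStar_size ?\<psi> = n" by (rule Mchars_index[OF n xi])
    have "m - 1 = n div PhiStar_size ?\<psi> - 1 \<longleftrightarrow> n = m * PhiStar_size ?\<psi>"
    proof
      assume "m - 1 = n div PhiStar_size ?\<psi> - 1"
      then have "Suc (m - 1) * PhiStar_size ?\<psi> = n" by (simp only: idx)
      then show "n = m * PhiStar_size ?\<psi>" using m by simp
    next
      assume "n = m * PhiStar_size ?\<psi>"
      then have "Suc (n div PhiStar_size ?\<psi> - 1) * PhiStar_size ?\<psi> = m * PhiStar_size ?\<psi>"
        by (simp only: idx)
      then have "Suc (n div PhiStar_size ?\<psi> - 1) = m" using PhiStar_size_pos[of ?\<psi>] by (subst (asm) mult_cancel2) simp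
      then show "m - 1 = n div PhiStar_size ?\<psi> - 1" by linarith
    qed
    then show "d_star m \<phi> (const (cnj (\<xi> 1)) * indet (n div PhiStar_size ?\<psi> - 1, ?\<psi>))
        = (if ?\<psi> = \<phi> then (if n = m * PhiStar_size \<phi> then 1 else 0) else 0)"
      by (auto simp: derivation_const_mult[OF derivation_d_star] d_star_indet Mchars_one[OF xi])
  qed
  also have "\<dots> = of_nat (card ?A) * (if n = m * PhiStar_size \<phi> then 1 else 0)"
    using fin by (simp add: sum.If_cases Int_def)
  also have "\<dots> = const (if n = m * PhiStar_size \<phi> then of_nat (PhiStar_size \<phi>) else 0)"
    using n by (auto simp: card_PhiStar_fibre const_of_nat)
  finally show ?thesis by (auto simp: K_def const_mult[symmetric])
qed

section \<open>The exchange formula in $\mathcal F_G$\<close>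

lemma op_exp_fps_monomial:
  fixes F :: "'i cpoly"
  assumes D: "\<And>n. n \<ge> 1 \<Longrightarrow> derivation (D n)"
    and val: "\<And>j. j \<ge> 1 \<Longrightarrow> D j F = const (if j = s * k then - a * c ^ k else 0)" and sk: "s * k > 0"
  shows "op_exp_fps D F = fps_const F - fps_const (const a) * (fps_const (const c) * fps_X ^ s) ^ k"
proof -
  have "D n (D m F) = 0" if "n \<ge> 1" "m \<ge> 1" for n m
    using that by (simp only: val derivation_const[OF D])
  then have "op_exp_fps D F = fps_const F + Abs_fps (\<lambda>j. if j = 0 then 0 else D j F)"
    by (intro op_exp_fps_linear D)
  also have "Abs_fps (\<lambda>j. if j = 0 then 0 else D j F)
      = - (fps_const (const a) * (fps_const (const c) * fps_X ^ s) ^ k)"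
  proof (rule fps_ext)
    fix j
    have M: "fps_const (const a) * (fps_const (const c) * fps_X ^ s) ^ k
        = fps_const (const (a * c ^ k)) * fps_X ^ (s * k)"
      by (simp add: power_mult_distrib const_mult const_power mult.commute flip: power_mult)
    show "fps_nth (Abs_fps (\<lambda>j. if j = 0 then 0 else D j F)) j
        = fps_nth (- (fps_const (const a) * (fps_const (const c) * fps_X ^ s) ^ k)) j"
      unfolding M using sk by (simp add: val const_uminus)
  qed
  finally show ?thesis by simp
qed

lemma minus_one_power_pred:
  assumes "r > 0" "d > 0"
  shows "(-1) ^ (r * d - 1) = - (((-1) ^ d) ^ r :: complex)"
proof -
  have "r * d = Suc (r * d - 1)" using assms by simp
  then have "((-1) ^ d) ^ r = (-1 :: complex) ^ Suc (r * d - 1)" by (metis mult.commute power_mult)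
  then show ?thesis by simp
qed

text \<open>
  The context of a fixed \<open>\<phi>\<close>.  The creation series of \<open>S(w)\<close> and \<open>Q(z)\<close> have coefficients \<open>h\<close> and \<open>e\<close>, and
  their annihilation exponentials come from the derivations \<open>DT\<close> and \<open>DU\<close>.
\<close>

locale FG_vertex =
  fixes \<phi> :: "'a::finite_field PhiStar"
begin

definition d :: nat where "d = PhiStar_size \<phi>"

definition x :: complex where "x = of_nat CARD('a) ^ d"

definition \<epsilon> :: complex where "\<epsilon> = (-1) ^ d"

definition DU :: "nat \<Rightarrow> 'a FG \<Rightarrow> 'a FG" where "DU = (\<lambda>m F. d_Phi m f_one F)"

definition DT :: "nat \<Rightarrow> 'a FG \<Rightarrow> 'a FG" where "DT = (\<lambda>m F. - d_star m \<phi> F)"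

definition h :: "nat \<Rightarrow> 'a FG" where
  "h = (\<lambda>j. op_exp (\<lambda>m F. const (1 / of_nat m) * p_star m \<phi> * F) j 1)"

text \<open>
  The \<open>r\<close>-th coefficient of \<open>z P'(z)\<close>, where \<open>E(z) = exp (P(z))\<close> is the creation exponential of \<open>Q(z)\<close>.
\<close>

definition b :: "nat \<Rightarrow> 'a FG" where
  "b = (\<lambda>r. - (const (1 - 1 / of_nat CARD('a) ^ r) * p_Phi r f_one))"

definition e :: "nat \<Rightarrow> 'a FG" where
  "e = (\<lambda>j. op_exp (\<lambda>m F. const (1 / of_nat m) * b m * F) j 1)"

lemma d_pos: "d > 0"
  unfolding d_def by (rule PhiStar_size_pos)

lemma DU: "derivation (DU n)" if "n \<ge> 1" for n
  using that derivation_d_f1[of n] by (simp add: DU_def d_Phi_f_one)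

lemma DT: "derivation (DT n)" for n
  unfolding DT_def by (intro derivation_uminus derivation_d_star)

lemma DU_indet: "DU n (indet (j, \<psi>)) = const (if n = Suc j * PhiStar_size \<psi> then (-1) ^ (n - 1) else 0)" if "n \<ge> 1"
  using that by (simp add: DU_def d_Phi_f_one d_f1_indet)

lemma DT_indet: "DT n (indet (j, \<psi>)) = const (if n - 1 = j \<and> \<psi> = \<phi> then -1 else 0)"
  by (simp add: DT_def d_star_indet const_uminus)

lemma annihilation_U: "annihilation (op_exp_int DU)"
proof (rule annihilation_op_exp_int[OF DU])
  show "\<exists>c. DU n (indet i) = const c" if "n \<ge> 1" for n i
    using that by (cases i) (simp only: DU_indet, blast)
  show "\<exists>B. \<forall>n>B. DU n (indet i) = 0" for i
  proof (cases i)
    case (Pair j \<psi>)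
    then show ?thesis by (intro exI[of _ "Suc j * PhiStar_size \<psi>"]) (auto simp: DU_indet)
  qed
qed

lemma annihilation_T: "annihilation (op_exp_int DT)"
proof (rule annihilation_op_exp_int[OF DT])
  show "\<exists>c. DT n (indet i) = const c" for n i
    by (cases i) (simp only: DT_indet, blast)
  show "\<exists>B. \<forall>n>B. DT n (indet i) = 0" for i
  proof (cases i)
    case (Pair j \<psi>)
    then show ?thesis by (intro exI[of _ "Suc j"]) (auto simp: DT_indet)
  qed
qed

lemma newton_of_scaled:
  fixes g b' :: "nat \<Rightarrow> 'a FG"
  defines "g \<equiv> \<lambda>j. op_exp (\<lambda>m F. const (1 / of_nat m) * b' m * F) j 1"
  shows "g 0 = 1" "of_nat j * g j = (\<Sum>r=1..j. b' r * g (j - r))"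
proof -
  show "g 0 = 1" by (simp add: g_def op_exp_0)
  have "of_nat r * (const (1 / of_nat r) * b' r) = b' r" if "r \<ge> 1" for r
    using that by (simp add: mult.assoc[symmetric] const_of_nat[symmetric] const_mult[symmetric])
  then show "of_nat j * g j = (\<Sum>r=1..j. b' r * g (j - r))"
    unfolding g_def op_exp_mult_newton by (intro sum.cong refl) simp
qed

lemma h_newton: "h 0 = 1" "of_nat j * h j = (\<Sum>r=1..j. p_star r \<phi> * h (j - r))"
  unfolding h_def by (rule newton_of_scaled)+

lemma e_newton: "e 0 = 1" "of_nat j * e j = (\<Sum>r=1..j. b r * e (j - r))"
  unfolding e_def by (rule newton_of_scaled)+

lemma U_p_star: "op_exp_fps DU (p_star r \<phi>) = fps_const (p_star r \<phi>)
    - (if 1 dvd r then of_nat 1 * (fps_const (const \<epsilon>) * fps_X ^ d) ^ (r div 1) else 0)" if "r \<ge> 1"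
proof -
  have "op_exp_fps DU (p_star r \<phi>) = fps_const (p_star r \<phi>)
      - fps_const (const 1) * (fps_const (const \<epsilon>) * fps_X ^ d) ^ r"
  proof (rule op_exp_fps_monomial[OF DU])
    show "DU j (p_star r \<phi>) = const (if j = d * r then - 1 * \<epsilon> ^ r else 0)" if "j \<ge> 1" for j
      using that \<open>r \<ge> 1\<close> minus_one_power_pred[of r d] d_pos
      by (simp add: p_star_def DU_indet d_def[symmetric] \<epsilon>_def mult.commute)
    show "d * r > 0" using that d_pos by simp
  qed
  then show ?thesis by simp
qed

lemma T_p_star: "op_exp_fps DT (p_star r \<phi>) = fps_const (p_star r \<phi>)
    - (if 1 dvd r then of_nat 1 * (fps_const (const 1) * fps_X ^ 1) ^ (r div 1) else 0)" if "r \<ge> 1"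
proof -
  have "op_exp_fps DT (p_star r \<phi>) = fps_const (p_star r \<phi>)
      - fps_const (const 1) * (fps_const (const 1) * fps_X ^ 1) ^ r"
    by (rule op_exp_fps_monomial[OF DT]) (use that in \<open>auto simp: p_star_def DT_indet\<close>)
  then show ?thesis by simp
qed

text \<open>
  For \<open>r = j d\<close> the product of \<open>1 - q\<^sup>-\<^sup>r\<close> with the coefficient \<open>(-1)\<^sup>r\<^sup>-\<^sup>1 d / (q\<^sup>r - 1)\<close> of \<open>p\<^sub>j(\<phi>)\<close> in \<open>p\<^sub>r(f\<^sub>1)\<close> is
  \<open>- d ((-1)\<^sup>d q\<^sup>-\<^sup>d)\<^sup>j\<close>, the coefficient of the logarithmic derivative of \<open>1 - (-1)\<^sup>d q\<^sup>-\<^sup>d w\<^sup>-\<^sup>1 z\<^sup>d\<close>.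
\<close>

lemma T_b: "op_exp_fps DT (b r) = fps_const (b r)
    - (if d dvd r then of_nat d * (fps_const (const (\<epsilon> / x)) * fps_X ^ 1) ^ (r div d) else 0)" if r: "r \<ge> 1"
proof -
  \<comment> \<open>If \<open>d\<close> does not divide \<open>r\<close>, the coefficient \<open>?a\<close> is zero and the exponent below is set to \<open>1\<close>, as it has to be positive.\<close>
  let ?a = "if d dvd r then of_nat d else 0 :: complex"
  let ?q = "of_nat CARD('a) :: complex"
  have qr: "?q ^ r \<noteq> 0" "?q ^ r - 1 \<noteq> 0" using of_nat_card_power_minus_1_neq_0[of r, where 'a='a] r by simp_all
  have "op_exp_fps DT (b r) = fps_const (b r)
      - fps_const (const ?a) * (fps_const (const (\<epsilon> / x)) * fps_X ^ 1) ^ (if d dvd r then r div d else 1)"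
  proof (rule op_exp_fps_monomial[OF DT])
    fix j :: nat assume j: "j \<ge> 1"
    have "DT j (b r) = const (1 - 1 / ?q ^ r) * d_star j \<phi> (p_Phi r f_one)"
      by (simp add: DT_def b_def derivation_minus[OF derivation_d_star]
        derivation_const_mult[OF derivation_d_star])
    also have "\<dots> = const (if r = j * d then (1 - 1 / ?q ^ r) * ((-1) ^ (r - 1) * of_nat d / (?q ^ r - 1)) else 0)"
      using r j by (simp add: d_star_p_Phi_f_one d_def[symmetric] const_mult[symmetric] del: const_mult)
    also have "(if r = j * d then (1 - 1 / ?q ^ r) * ((-1) ^ (r - 1) * of_nat d / (?q ^ r - 1)) else 0)
        = (if j = 1 * (if d dvd r then r div d else 1) then - ?a * (\<epsilon> / x) ^ (if d dvd r then r div d else 1) else 0)"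
    proof (cases "r = j * d")
      case True
      have xj: "?q ^ r = x ^ j" by (simp add: True x_def mult.commute flip: power_mult)
      have dd: "d dvd r" "r div d = j" using True d_pos by simp_all
      have "(1 - 1 / ?q ^ r) * ((-1) ^ (r - 1) * of_nat d / (?q ^ r - 1)) = (-1) ^ (r - 1) * of_nat d / ?q ^ r"
        using qr by (simp add: field_simps)
      moreover have "(-1) ^ (r - 1) = - (\<epsilon> ^ j)"
        using True j d_pos minus_one_power_pred[of j d] by (simp add: \<epsilon>_def)
      ultimately have lhs: "(1 - 1 / ?q ^ r) * ((-1) ^ (r - 1) * of_nat d / (?q ^ r - 1))
        = - (\<epsilon> ^ j) * of_nat d / x ^ j" by (simp only: xj)
      have rhs: "- ?a * (\<epsilon> / x) ^ (if d dvd r then r div d else 1) = - (\<epsilon> ^ j) * of_nat d / x ^ j"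
        using dd by (simp add: power_divide)
      show ?thesis unfolding lhs rhs using True dd by simp
    next
      case False
      then show ?thesis by auto
    qed
    finally show "DT j (b r) = const (if j = 1 * (if d dvd r then r div d else 1)
      then - ?a * (\<epsilon> / x) ^ (if d dvd r then r div d else 1) else 0)" .
  next
    show "1 * (if d dvd r then r div d else 1) > 0" using r d_pos by (auto simp: div_greater_zero_iff dest: dvd_imp_le)
  qed
  then show ?thesis by (auto simp: const_of_nat fps_of_nat)
qed

sublocale vertex_pair "op_exp_int DU" "op_exp_int DT" "int_ext e" "int_ext h" \<epsilon> x d
proof (intro vertex_pair.intro vertex_pair_axioms.intro annihilation_U annihilation_T)
  have comm: "DU n (DT m F) = DT m (DU n F)" if "n \<ge> 1" for n m F
  proof (rule derivations_commute[OF DU[OF that] DT])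
    fix i show "DU n (DT m (indet i)) = DT m (DU n (indet i))"
      using that by (cases i) (simp only: DU_indet DT_indet derivation_const[OF DU[OF that]] derivation_const[OF DT])
  qed
  show "op_exp_int DU a (op_exp_int DT b F) = op_exp_int DT b (op_exp_int DU a F)" for a b F
    by (rule op_exp_int_commute) (assumption | rule DU DT annihilation_U annihilation_T comm)+
  have comm': "DT n (DT m F) = DT m (DT n F)" for n m F
  proof (rule derivations_commute[OF DT DT])
    fix i show "DT n (DT m (indet i)) = DT m (DT n (indet i))"
      by (cases i) (simp only: DT_indet derivation_const[OF DT])
  qed
  show "op_exp_int DT a (op_exp_int DT b F) = op_exp_int DT b (op_exp_int DT a F)" for a b F
    by (rule op_exp_int_commute) (assumption | rule DT annihilation_T comm')+
  show "op_exp_int DU a (int_ext h m * F) = int_ext h m * op_exp_int DU a F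
      - const \<epsilon> * int_ext h (m - 1) * op_exp_int DU (a - int d) F" for a m F
  proof -
    have "op_exp_int DU a (int_ext h m * F) = int_ext h m * op_exp_int DU a F
        - const \<epsilon> * int_ext h (m - int 1) * op_exp_int DU (a - int d) F"
      by (rule op_exp_int_newton[where b = "\<lambda>r. p_star r \<phi>"])
        (assumption | rule DU h_newton U_p_star zero_less_one)+
    then show ?thesis by simp
  qed
  show "op_exp_int DT a (int_ext e m * F) = int_ext e m * op_exp_int DT a F
      - const (\<epsilon> / x) * int_ext e (m - int d) * op_exp_int DT (a - 1) F" for a m F
  proof -
    have "op_exp_int DT a (int_ext e m * F) = int_ext e m * op_exp_int DT a F
        - const (\<epsilon> / x) * int_ext e (m - int d) * op_exp_int DT (a - int 1) F"
      by (rule op_exp_int_newton[where b = b])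
        (assumption | rule DT e_newton d_pos T_b)+
    then show ?thesis by simp
  qed
  show "op_exp_int DT a (int_ext h m * F) = int_ext h m * op_exp_int DT a F
      - int_ext h (m - 1) * op_exp_int DT (a - 1) F" for a m F
  proof -
    have "op_exp_int DT a (int_ext h m * F) = int_ext h m * op_exp_int DT a F
        - const 1 * int_ext h (m - int 1) * op_exp_int DT (a - int 1) F"
      by (rule op_exp_int_newton[where b = "\<lambda>r. p_star r \<phi>"])
        (assumption | rule DT h_newton T_p_star zero_less_one)+
    then show ?thesis by simp
  qed
  show "int_ext h m = 0" if "m < 0" for m using that by (simp add: int_ext_def)
  show "\<epsilon> * \<epsilon> = 1" by (simp add: \<epsilon>_def flip: power_mult_distrib)
  show "x \<noteq> 0" "x \<noteq> 1"
    using of_nat_card_power_minus_1_neq_0[OF d_pos, where 'a='a] by (simp_all add: x_def)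
qed

lemma S_op_eq: "S_op \<phi> n = S n"
proof
  fix F
  show "S_op \<phi> n F = S n F"
    unfolding S_op_def h_def DT_def[symmetric] by (rule laurent_coeff_normal_op[OF annihilation_T])
qed

lemma Qstar_op_eq: "Qstar_op k = Q k"
proof
  fix F
  have "(\<lambda>m F. - (const ((1 - 1 / of_nat CARD('a) ^ m) / of_nat m) * p_Phi m f_one * F))
      = (\<lambda>m F. const (1 / of_nat m) * b m * F)"
    by (intro ext) (simp add: b_def const_mult[symmetric] mult.assoc[symmetric])
  then show "Qstar_op k F = Q k F"
    unfolding Qstar_op_def e_def DU_def[symmetric] by (simp only: laurent_coeff_normal_op[OF annihilation_U])
qed

theorem Qstar_S_seq:
  "Qstar_op k (S_seq \<phi> (map int la) 1) = (\<Sum>tau\<in>comps_below (underlined la).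
     const (prod_list (map (A_coeff x) tau) * \<epsilon> ^ sum_list tau) *
     S_seq \<phi> (map2 (\<lambda>a t. int a - int t) la tau) (Qstar_op (k - int (sum_list tau * d)) 1))"
proof -
  have S: "S_op \<phi> = S" by (rule ext) (rule S_op_eq)
  show ?thesis unfolding S_seq_def S Qstar_op_eq by (rule exchange_seq)
qed

end

theorem theorem3p3:
  fixes \<phi> :: "'a::finite_field PhiStar"
    and la :: "nat list"
    and k q d :: nat
  assumes "q = CARD('a)"
    and "d = PhiStar_size \<phi>"
    and "is_partition la"
    and "k > 0"
  shows "Qstar_op (int k) (S_seq \<phi> (map int la) 1) =
    (\<Sum>tau\<in>comps_below (underlined la).
       const (prod_list (map (A_coeff (of_nat q ^ d)) tau) * (-1) ^ (sum_list tau * d)) *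
       S_seq \<phi> (map2 (\<lambda>a t. int a - int t) la tau)
         (Qstar_op (int k - int (sum_list tau * d)) 1))"
proof -
  interpret FG_vertex \<phi> .
  have "(-1) ^ (sum_list tau * PhiStar_size \<phi>) = \<epsilon> ^ sum_list tau" for tau
    by (simp only: \<epsilon>_def d_def mult.commute power_mult)
  then show ?thesis
    using Qstar_S_seq[of "int k" la] by (simp only: assms(1,2) x_def d_def)
qed

end
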